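(* (Boltzmann-Gibbs principle) Fix a typical (i.e. $\mu$-almost every) realization $\omega$ of the environment. For every $G\in\mathcal S_W(\mathbb T^d)$, every $t>0$ and every local, uniformly Lipschitz function $f:\Omega\times\{0,1\}^{\mathbb T^d_N}\to\mathbb R$, $$\lim_{N\to\infty}E_{\nu_\rho}\Big[\Big(\int_0^t\frac1{N^{d/2}}\sum_{x\in\mathbb T^d_N}G(x/N)\,V_f(x,\eta_s)\,ds\Big)^2\Big]=0,$$ where $$V_f(x,\eta)=f(x,\eta)-E_{\nu_\rho}[f(x,\eta)]-\partial_\rho E\Big[\int f(x,\eta)\,d\nu_\rho(\eta)\Big](\eta(x)-\rho),$$ and $E$ denotes expectation with respect to the law $\mu$ of the random environment.
   Context: $\rho\in(0,1]$, $b>-1/2$. **Torus and $W$.** $\mathbb T^d=(\mathbb R/\mathbb Z)^d$, $\mathbb T=\mathbb T^1$, $\mathbb T^d_N=(\mathbb Z/N\mathbb Z)^d$, $d\ge1$; $e_1,\dots,e_d$ is the canonical basis. $W(x)=\sum_{k=1}^dW_k(x_k)$ where each $W_k:\mathbb R\to\mathbb R$ is strictly increasing, càdlàg, and $W_k(u+1)-W_k(u)=W_k(1)-W_k(0)$ for all $u$. $\partial_{W_k}f(x)=\lim_{\epsilon\to0}\frac{f(x+\epsilon e_k)-f(x)}{W_k(x_k+\epsilon)-W_k(x_k)}$ when the limit exists and is finite. **The space $\mathcal S_W(\mathbb T^d)$.** For each $k$, $\mathcal L_{W_k}=\partial_{x_k}\partial_{W_k}$ acts on the domain $\mathcal D_{W_k}\subset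 L^2(\mathbb T)$ of functions $g(x)=a+cW_k(x)+\int_{(0,x]}W_k(dy)\int_0^y\mathfrak g(z)dz$ with $a,c\in\mathbb R$, $\mathfrak g\in L^2(\mathbb T)$, $\int_0^1\mathfrak g=0$ and $\int_{(0,1]}W_k(dy)\{c+\int_0^y\mathfrak g(z)dz\}=0$, and $\mathcal L_{W_k}g=\mathfrak g$. It is known that $\mathcal L_{W_k}$ has a countable complete orthonormal system of eigenvectors $\mathcal A_{W_k}$ in $L^2(\mathbb T)$. Let $\mathcal A_W=\{\prod_kg_k(x_k):g_k\in\mathcal A_{W_k}\}$ and $\mathbb D_W=\mathrm{span}(\mathcal A_W)$. $\mathcal A_W=\{\varphi_j\}_{j\ge1}$ is a complete orthonormal system of $L^2(\mathbb T^d)$, with $-\sum_k\mathcal L_{W_k}\varphi_j=\alpha_j\varphi_j$, enumerated so that $0=\alpha_1\le\alpha_2\le\cdots\to\infty$ (finite multiplicities). Put $\lambda_j=1+\alpha_j$, let $\mathbb P_k$ be the orthogonal projection on the span of $\varphi_k$, and for $n\in\mathbb N$ (including $0$) let $\|g\|_n^2=\sum_{k\ge1}\|\mathbb P_kg\|^2\lambda_k^{2n}k^{2n}$, where $\|\cdot\|$ is the $L^2(\mathbb T^d)$ norm. $\mathcal S_n$ is the completion of $\mathbb D_W$ under $\|\cdot\|_n$, and $\mathcal S_W(\mathbb T^d)=\bigcap_{n\ge0}\mathcal S_n$. Its elements are evaluated pointwise through their canonical càdlàg representatives. **Environment.** $(\Omega,\mathcal F,\mu)$ is a standard probability space, $\{T_x\}_{x\in\mathbb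 Z^d}$ a group of measurable, $\mu$-preserving transformations of $\Omega$ ($T_0=I$, $T_xT_y=T_{x+y}$), ergodic. $a_1,\dots,a_d:\Omega\to\mathbb R$ are measurable with $\theta^{-1}\le a_j\le\theta$ for some $\theta>0$, and $a^N_j(x)=a_j(T_x\omega)$ for $x\in\mathbb T^d_N=\{0,\dots,N-1\}^d$. **Exclusion process.** Let $\xi_{x,x+e_j}=\xi_{x+e_j,x}=\dfrac{a^N_j(x)}{N[W((x+e_j)/N)-W(x/N)]}$ and $c_{x,x+e_j}(\eta)=1+b\{\eta(x-e_j)+\eta(x+2e_j)\}$ (sums modulo $N$). $\{\eta_t\}$ is the Markov process on $\{0,1\}^{\mathbb T^d_N}$ with generator $N^2L_N$, where $(L_Nh)(\eta)=\sum_{j=1}^d\sum_{x\in\mathbb T^d_N}\xi_{x,x+e_j}c_{x,x+e_j}(\eta)\{h(\sigma^{x,x+e_j}\eta)-h(\eta)\}$ and $\sigma^{x,x+e_j}\eta$ is $\eta$ with the values at $x$ and $x+e_j$ exchanged. $\nu_\rho$ is the Bernoulli product measure on $\{0,1\}^{\mathbb T^d_N}$ with $\nu_\rho\{\eta(x)=1\}=\rho$; it is reversible. $E_{\nu_\rho}$ is expectation for the process started from $\nu_\rho$ (and also expectation under $\nu_\rho$). **Local and Lipschitz functions.** For $f:\Omega\times\{0,1\}^{\mathbb T^d_N}\to\mathbb R$ and $x\in\mathbb T^d_N$, $f(x,\eta)=f(x,\eta,\omega)=f(T_x\omega,\tau_x\eta)$ with $\tau_x\eta(y)=\eta(x+y)$.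 $f$ is local if there is $R>0$ such that $f(\omega,\eta)$ depends on $\eta$ only through $\eta(y)$, $|y|\le R$ (so $f$ is regarded as defined on $\Omega\times\{0,1\}^{\mathbb T^d_N}$ for all $N\ge R$). $f$ is Lipschitz if there is $c=c(\omega)>0$ such that for all $x$, $|f(\omega,\eta)-f(\omega,\eta')|\le c|\eta(x)-\eta'(x)|$ whenever $\eta(y)=\eta'(y)$ for all $y\ne x$; uniformly Lipschitz if $c$ can be chosen independent of $\omega$.
   Formalization: The set of typical ω may depend on f (not on G or t): with one ω for all f the claim fails, e.g. for f equal to the indicator of the orbit of ω times η(0)η(e_1). Also f(·,η) is assumed μ-integrable, so that the expectation E in V_f is defined. *)

theory Defs
  imports "HOL-Probability.Probability"
begin

section \<open>Square-integrable functions on the torus\<close>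

text \<open>Functions on the torus are functions on \<open>\<real>\<close> (one-dimensional torus) or \<open>\<real>\<^sup>d\<close> that are
  1-periodic in every coordinate direction; both cases are instances of \<open>'a :: euclidean_space\<close>.\<close>

definition torus_periodic :: "('a::euclidean_space \<Rightarrow> real) \<Rightarrow> bool" where
  "torus_periodic g \<longleftrightarrow> (\<forall>x. \<forall>i\<in>Basis. g (x + i) = g x)"

definition torus_measure :: "'a::euclidean_space measure" where
  "torus_measure = restrict_space lborel {x. \<forall>i\<in>Basis. 0 \<le> x \<bullet> i \<and> x \<bullet> i < 1}"

definition torus_L2 :: "('a::euclidean_space \<Rightarrow> real) set" where
  "torus_L2 = {g. torus_periodic g \<and> g \<in> borel_measurable borel
                  \<and> integrable torus_measure (\<lambda>x. (g x)\<^sup>2)}"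

definition L2_ip :: "('a::euclidean_space \<Rightarrow> real) \<Rightarrow> ('a \<Rightarrow> real) \<Rightarrow> real" where
  "L2_ip f g = (\<integral>x. f x * g x \<partial>torus_measure)"

definition L2_nrm :: "('a::euclidean_space \<Rightarrow> real) \<Rightarrow> real" where
  "L2_nrm f = sqrt (L2_ip f f)"

definition complete_orthonormal :: "('a::euclidean_space \<Rightarrow> real) set \<Rightarrow> bool" where
  "complete_orthonormal B \<longleftrightarrow>
     B \<subseteq> torus_L2 \<and> (\<forall>g\<in>B. \<forall>h\<in>B. L2_ip g h = (if g = h then 1 else 0)) \<and>
     (\<forall>f\<in>torus_L2. (\<forall>g\<in>B. L2_ip f g = 0) \<longrightarrow> (AE x in torus_measure. f x = 0))"


section \<open>The functions \<open>W\<^sub>k\<close> and the operators \<open>L\<^sub>W\<close>\<close>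

definition admissible_W :: "(real \<Rightarrow> real) \<Rightarrow> bool" where
  "admissible_W w \<longleftrightarrow> strict_mono w
     \<and> (\<forall>x. continuous (at_right x) w) \<and> (\<forall>x. \<exists>l. (w \<longlongrightarrow> l) (at_left x))
     \<and> (\<forall>u. w (u + 1) - w u = w 1 - w 0)"

definition W_sum :: "('d::finite \<Rightarrow> real \<Rightarrow> real) \<Rightarrow> real ^ 'd \<Rightarrow> real" where
  "W_sum W x = (\<Sum>k\<in>UNIV. W k (x $ k))"

text \<open>\<open>LW w g h\<close> says that \<open>g\<close> is in the domain of \<open>d/dx d/dw\<close> and is mapped to \<open>h\<close>. The image is
  only determined almost everywhere, whereas \<open>g\<close> is the right-continuous representative given by
  the defining formula. \<open>interval_measure w\<close> is the Stieltjes measure of \<open>w\<close>.\<close>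

definition LW :: "(real \<Rightarrow> real) \<Rightarrow> (real \<Rightarrow> real) \<Rightarrow> (real \<Rightarrow> real) \<Rightarrow> bool" where
  "LW w g h \<longleftrightarrow> g \<in> torus_L2 \<and> h \<in> torus_L2 \<and> (LBINT z:{0..1}. h z) = 0 \<and>
     (\<exists>a c. (LINT y:{0<..1}|interval_measure w. c + (LBINT z:{0..y}. h z)) = 0 \<and>
        (\<forall>x\<in>{0..<1}. g x = a + c * w x
            + (LINT y:{0<..x}|interval_measure w. (LBINT z:{0..y}. h z))))"

definition eigenvector_LW :: "(real \<Rightarrow> real) \<Rightarrow> (real \<Rightarrow> real) \<Rightarrow> bool" where
  "eigenvector_LW w g \<longleftrightarrow>
     \<not> (AE x in torus_measure. g x = 0) \<and> (\<exists>\<beta>. LW w g (\<lambda>x. - \<beta> * g x))"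

definition eigenbasis_LW :: "(real \<Rightarrow> real) \<Rightarrow> (real \<Rightarrow> real) set \<Rightarrow> bool" where
  "eigenbasis_LW w B \<longleftrightarrow>
     countable B \<and> complete_orthonormal B \<and> (\<forall>g\<in>B. eigenvector_LW w g)"

text \<open>The one-dimensional operator acting on the \<open>k\<close>-th coordinate of a function on the
  \<open>d\<close>-dimensional torus.\<close>

definition LW_coord ::
  "(real \<Rightarrow> real) \<Rightarrow> 'd::finite \<Rightarrow> (real ^ 'd \<Rightarrow> real) \<Rightarrow> (real ^ 'd \<Rightarrow> real) \<Rightarrow> bool" where
  "LW_coord w k F H \<longleftrightarrow> H \<in> torus_L2 \<and>
     (\<forall>x. LW w (\<lambda>u. F (\<chi> i. if i = k then u else x $ i))
               (\<lambda>u. H (\<chi> i. if i = k then u else x $ i)))"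

definition product_system :: "('d::finite \<Rightarrow> (real \<Rightarrow> real) set) \<Rightarrow> (real ^ 'd \<Rightarrow> real) set" where
  "product_system A = {\<lambda>x. \<Prod>k\<in>UNIV. g k (x $ k) | g. \<forall>k. g k \<in> A k}"

text \<open>\<open>\<phi>\<close> and \<open>\<alpha>\<close> are indexed by \<open>j \<ge> 1\<close>; their values at \<open>0\<close> are irrelevant.\<close>

definition eigen_enumeration ::
  "('d::finite \<Rightarrow> real \<Rightarrow> real) \<Rightarrow> ('d \<Rightarrow> (real \<Rightarrow> real) set)
    \<Rightarrow> (nat \<Rightarrow> real ^ 'd \<Rightarrow> real) \<Rightarrow> (nat \<Rightarrow> real) \<Rightarrow> bool" where
  "eigen_enumeration W A \<phi> \<alpha> \<longleftrightarrow>
     bij_betw \<phi> {1..} (product_system A) \<and>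
     (\<forall>j\<ge>1. \<exists>H. (\<forall>k. LW_coord (W k) k (\<phi> j) (H k)) \<and>
               (AE x in torus_measure. - (\<Sum>k\<in>UNIV. H k x) = \<alpha> j * \<phi> j x)) \<and>
     \<alpha> 1 = 0 \<and> mono_on {1..} \<alpha> \<and> filterlim \<alpha> at_top sequentially"


section \<open>The test function space\<close>

definition L2_proj ::
  "('a::euclidean_space \<Rightarrow> real) \<Rightarrow> ('a \<Rightarrow> real) \<Rightarrow> 'a \<Rightarrow> real" where
  "L2_proj \<psi> g = (\<lambda>x. L2_ip g \<psi> / L2_ip \<psi> \<psi> * \<psi> x)"

definition S_nrm ::
  "(nat \<Rightarrow> real ^ 'd \<Rightarrow> real) \<Rightarrow> (nat \<Rightarrow> real) \<Rightarrow> nat \<Rightarrow> (real ^ 'd \<Rightarrow> real) \<Rightarrow> real" where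
  "S_nrm \<phi> \<alpha> n g =
     sqrt (\<Sum>\<^sub>\<infinity>k\<in>{1..}. (L2_nrm (L2_proj (\<phi> k) g))\<^sup>2 * (1 + \<alpha> k) ^ (2 * n) * real k ^ (2 * n))"

definition D_W :: "('d::finite \<Rightarrow> (real \<Rightarrow> real) set) \<Rightarrow> (real ^ 'd \<Rightarrow> real) set" where
  "D_W A = {\<lambda>x. \<Sum>h\<in>F. r h * h x | F r. finite F \<and> F \<subseteq> product_system A}"

text \<open>Every \<open>S_nrm \<phi> \<alpha> n\<close> dominates the \<open>L\<^sup>2\<close> norm on \<open>D_W A\<close> and is closable, so the abstract
  completion is realised in \<open>L\<^sup>2\<close>: it consists of the \<open>L\<^sup>2\<close> limits of sequences in \<open>D_W A\<close> that are
  Cauchy for \<open>S_nrm \<phi> \<alpha> n\<close>.\<close>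

definition S_completion ::
  "('d::finite \<Rightarrow> (real \<Rightarrow> real) set) \<Rightarrow> (nat \<Rightarrow> real ^ 'd \<Rightarrow> real) \<Rightarrow> (nat \<Rightarrow> real) \<Rightarrow> nat
    \<Rightarrow> (real ^ 'd \<Rightarrow> real) set" where
  "S_completion A \<phi> \<alpha> n = {g \<in> torus_L2. \<exists>h :: nat \<Rightarrow> real ^ 'd \<Rightarrow> real.
     (\<forall>m. h m \<in> D_W A) \<and>
     (\<forall>e>0. \<exists>m0. \<forall>m\<ge>m0. \<forall>l\<ge>m0. S_nrm \<phi> \<alpha> n (\<lambda>x. h m x - h l x) < e) \<and>
     (\<lambda>m. L2_nrm (\<lambda>x. h m x - g x)) \<longlonglongrightarrow> 0}"

text \<open>In several variables, cadlag means that the limits from all quadrants exist and that the one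
  from the closed upper quadrant is the value. Two such functions that agree almost everywhere are
  equal, so the elements of \<open>S_W\<close> below correspond one to one to \<open>L\<^sup>2\<close> classes.\<close>

definition quadrant :: "real ^ 'd::finite \<Rightarrow> 'd set \<Rightarrow> (real ^ 'd) set" where
  "quadrant x S = {y. \<forall>k. if k \<in> S then x $ k \<le> y $ k else y $ k < x $ k}"

definition cadlag :: "(real ^ 'd::finite \<Rightarrow> real) \<Rightarrow> bool" where
  "cadlag G \<longleftrightarrow> (\<forall>x. (G \<longlongrightarrow> G x) (at x within quadrant x UNIV)) \<and>
                 (\<forall>x S. \<exists>l. (G \<longlongrightarrow> l) (at x within quadrant x S))"

definition S_W ::
  "('d::finite \<Rightarrow> (real \<Rightarrow> real) set) \<Rightarrow> (nat \<Rightarrow> real ^ 'd \<Rightarrow> real) \<Rightarrow> (nat \<Rightarrow> real)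
    \<Rightarrow> (real ^ 'd \<Rightarrow> real) set" where
  "S_W A \<phi> \<alpha> = {G. cadlag G \<and> (\<forall>n. G \<in> S_completion A \<phi> \<alpha> n)}"


section \<open>The random environment\<close>

text \<open>Standard in the sense of Lebesgue and Rokhlin: up to completion and null sets, isomorphic to a
  Borel probability measure on \<open>\<real>\<close>, here the law of \<open>\<iota>\<close>. Standard Borel probability spaces are
  included.\<close>

definition standard_prob_space :: "'w measure \<Rightarrow> bool" where
  "standard_prob_space \<mu> \<longleftrightarrow> prob_space \<mu> \<and>
     (\<exists>\<iota> :: 'w \<Rightarrow> real. \<exists>E \<in> sets (completion \<mu>).
        \<iota> \<in> borel_measurable (completion \<mu>) \<and> (AE \<omega> in completion \<mu>. \<omega> \<in> E) \<and> inj_on \<iota> E \<and>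
        (\<forall>B \<in> sets (completion \<mu>). B \<subseteq> E \<longrightarrow>
            \<iota> ` B \<in> sets (completion (distr (completion \<mu>) borel \<iota>))))"

definition ergodic_action :: "'w measure \<Rightarrow> (int ^ 'd::finite \<Rightarrow> 'w \<Rightarrow> 'w) \<Rightarrow> bool" where
  "ergodic_action \<mu> T \<longleftrightarrow>
     (\<forall>x. T x \<in> measurable \<mu> \<mu> \<and> distr \<mu> \<mu> (T x) = \<mu>) \<and>
     (\<forall>\<omega>\<in>space \<mu>. T 0 \<omega> = \<omega>) \<and>
     (\<forall>x y. \<forall>\<omega>\<in>space \<mu>. T x (T y \<omega>) = T (x + y) \<omega>) \<and>
     (\<forall>B\<in>sets \<mu>. (\<forall>x. T x -` B \<inter> space \<mu> = B) \<longrightarrow> measure \<mu> B = 0 \<or> measure \<mu> B = 1)"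


section \<open>Configurations on the discrete torus\<close>

text \<open>The sites of the discrete torus are represented by \<open>{0..N-1}\<^sup>d\<close>, and a configuration on it is
  the corresponding \<open>N\<close>-periodic function on \<open>\<int>\<^sup>d\<close>; translations then need no reduction modulo \<open>N\<close>.\<close>

type_synonym 'd config = "int ^ 'd \<Rightarrow> bool"

definition sites :: "nat \<Rightarrow> (int ^ 'd::finite) set" where
  "sites N = {x. \<forall>k. 0 \<le> x $ k \<and> x $ k < int N}"

definition configs :: "nat \<Rightarrow> 'd::finite config set" where
  "configs N = {\<eta>. \<forall>x y. (\<forall>k. int N dvd x $ k - y $ k) \<longrightarrow> \<eta> x = \<eta> y}"

definition occ :: "'d::finite config \<Rightarrow> int ^ 'd \<Rightarrow> real" where
  "occ \<eta> x = of_bool (\<eta> x)"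

definition exchange :: "nat \<Rightarrow> int ^ 'd::finite \<Rightarrow> int ^ 'd \<Rightarrow> 'd config \<Rightarrow> 'd config" where
  "exchange N x y \<eta> = (\<lambda>z. if \<forall>k. int N dvd z $ k - x $ k then \<eta> y
                           else if \<forall>k. int N dvd z $ k - y $ k then \<eta> x else \<eta> z)"

definition shift :: "int ^ 'd::finite \<Rightarrow> 'd config \<Rightarrow> 'd config" where
  "shift x \<eta> = (\<lambda>y. \<eta> (x + y))"

definition bernoulli_product :: "nat \<Rightarrow> real \<Rightarrow> 'd::finite config pmf" where
  "bernoulli_product N \<rho> =
     map_pmf (\<lambda>\<eta> x. \<eta> (\<chi> k. x $ k mod int N)) (Pi_pmf (sites N) False (\<lambda>_. bernoulli_pmf \<rho>))"

definition site_point :: "nat \<Rightarrow> int ^ 'd::finite \<Rightarrow> real ^ 'd" where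
  "site_point N x = (\<chi> k. real_of_int (x $ k) / real N)"


section \<open>The exclusion process\<close>

text \<open>\<open>env j x\<close> stands for \<open>a\<^sub>j(T\<^sub>x \<omega>)\<close>.\<close>

definition conductance ::
  "('d::finite \<Rightarrow> real \<Rightarrow> real) \<Rightarrow> ('d \<Rightarrow> int ^ 'd \<Rightarrow> real) \<Rightarrow> nat \<Rightarrow> int ^ 'd \<Rightarrow> 'd \<Rightarrow> real" where
  "conductance W env N x j =
     env j x / (real N * (W_sum W (site_point N (x + axis j 1)) - W_sum W (site_point N x)))"

definition speed :: "real \<Rightarrow> int ^ 'd::finite \<Rightarrow> 'd \<Rightarrow> 'd config \<Rightarrow> real" where
  "speed b x j \<eta> = 1 + b * (occ \<eta> (x - axis j 1) + occ \<eta> (x + axis j 2))"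

definition L_N ::
  "('d::finite \<Rightarrow> real \<Rightarrow> real) \<Rightarrow> ('d \<Rightarrow> int ^ 'd \<Rightarrow> real) \<Rightarrow> real \<Rightarrow> nat
    \<Rightarrow> ('d config \<Rightarrow> real) \<Rightarrow> 'd config \<Rightarrow> real" where
  "L_N W env b N h \<eta> = (\<Sum>j\<in>UNIV. \<Sum>x\<in>sites N.
     conductance W env N x j * speed b x j \<eta> * (h (exchange N x (x + axis j 1) \<eta>) - h \<eta>))"

text \<open>Transition probabilities \<open>(exp(tA) 1\<^sub>{\<^sub>\<zeta>\<^sub>})(\<eta>)\<close> for a generator \<open>A\<close> on a finite state space.\<close>

definition transition ::
  "(('s \<Rightarrow> real) \<Rightarrow> 's \<Rightarrow> real) \<Rightarrow> real \<Rightarrow> 's \<Rightarrow> 's \<Rightarrow> real" where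
  "transition A t \<eta> \<zeta> = (\<Sum>n. t ^ n / fact n * (A ^^ n) (\<lambda>\<eta>'. of_bool (\<eta>' = \<zeta>)) \<eta>)"

text \<open>Continuous-time Markov process with cadlag paths (for the discrete topology), finite state space
  \<open>S\<close>, generator \<open>A\<close> and initial law \<open>\<nu>\<close>; the Markov property is expressed by the
  finite-dimensional distributions.\<close>

definition markov_process ::
  "'s set \<Rightarrow> (('s \<Rightarrow> real) \<Rightarrow> 's \<Rightarrow> real) \<Rightarrow> 's pmf \<Rightarrow> 'p measure \<Rightarrow> (real \<Rightarrow> 'p \<Rightarrow> 's) \<Rightarrow> bool" where
  "markov_process S A \<nu> P X \<longleftrightarrow> prob_space P \<and>
     (\<forall>t\<ge>0. X t \<in> measurable P (count_space S)) \<and>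
     (\<forall>n (\<tau> :: nat \<Rightarrow> real) \<zeta>. \<tau> 0 = 0 \<longrightarrow> mono \<tau> \<longrightarrow> (\<forall>i. \<zeta> i \<in> S) \<longrightarrow>
        measure P {p \<in> space P. \<forall>i\<le>n. X (\<tau> i) p = \<zeta> i}
          = pmf \<nu> (\<zeta> 0) * (\<Prod>i<n. transition A (\<tau> (Suc i) - \<tau> i) (\<zeta> i) (\<zeta> (Suc i)))) \<and>
     (\<forall>p\<in>space P.
        (\<forall>t\<ge>0. \<forall>\<^sub>F s in at_right t. X s p = X t p) \<and>
        (\<forall>t>0. \<exists>\<zeta>. \<forall>\<^sub>F s in at_left t. X s p = \<zeta>))"

definition exclusion_process ::
  "('d::finite \<Rightarrow> real \<Rightarrow> real) \<Rightarrow> ('d \<Rightarrow> int ^ 'd \<Rightarrow> real) \<Rightarrow> real \<Rightarrow> real \<Rightarrow> nat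
    \<Rightarrow> 'p measure \<Rightarrow> (real \<Rightarrow> 'p \<Rightarrow> 'd config) \<Rightarrow> bool" where
  "exclusion_process W env b \<rho> N P X \<longleftrightarrow>
     markov_process (configs N) (\<lambda>h \<eta>. (real N)\<^sup>2 * L_N W env b N h \<eta>)
       (bernoulli_product N \<rho>) P X"


section \<open>Local and Lipschitz functions\<close>

text \<open>A local function is defined on configurations on \<open>\<int>\<^sup>d\<close>; evaluating it at periodic configurations
  yields the function on the discrete torus for every \<open>N\<close>.\<close>

definition local_fn :: "'w set \<Rightarrow> ('w \<Rightarrow> 'd::finite config \<Rightarrow> real) \<Rightarrow> bool" where
  "local_fn \<Omega> f \<longleftrightarrow> (\<exists>R::nat. \<forall>\<omega>\<in>\<Omega>. \<forall>\<eta> \<eta>'.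
     (\<forall>y. (\<forall>k. \<bar>y $ k\<bar> \<le> int R) \<longrightarrow> \<eta> y = \<eta>' y) \<longrightarrow> f \<omega> \<eta> = f \<omega> \<eta>')"

definition uniformly_Lipschitz :: "'w set \<Rightarrow> ('w \<Rightarrow> 'd::finite config \<Rightarrow> real) \<Rightarrow> bool" where
  "uniformly_Lipschitz \<Omega> f \<longleftrightarrow> (\<exists>c>0. \<forall>\<omega>\<in>\<Omega>. \<forall>x \<eta> \<eta>'.
     (\<forall>y. y \<noteq> x \<longrightarrow> \<eta> y = \<eta>' y) \<longrightarrow> \<bar>f \<omega> \<eta> - f \<omega> \<eta>'\<bar> \<le> c * \<bar>occ \<eta> x - occ \<eta>' x\<bar>)"

definition f_at ::
  "(int ^ 'd::finite \<Rightarrow> 'w \<Rightarrow> 'w) \<Rightarrow> ('w \<Rightarrow> 'd config \<Rightarrow> real) \<Rightarrow> 'w \<Rightarrow> int ^ 'd \<Rightarrow> 'd config \<Rightarrow> real" where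
  "f_at T f \<omega> x \<eta> = f (T x \<omega>) (shift x \<eta>)"

text \<open>The derivative in the density is taken within \<open>[0,1]\<close>, so that it is one-sided at \<open>\<rho> = 1\<close>
  (\<open>bernoulli_pmf\<close> truncates its parameter to \<open>[0,1]\<close>).\<close>

definition V_f ::
  "'w measure \<Rightarrow> (int ^ 'd::finite \<Rightarrow> 'w \<Rightarrow> 'w) \<Rightarrow> real \<Rightarrow> ('w \<Rightarrow> 'd config \<Rightarrow> real) \<Rightarrow> nat
    \<Rightarrow> 'w \<Rightarrow> int ^ 'd \<Rightarrow> 'd config \<Rightarrow> real" where
  "V_f \<mu> T \<rho> f N \<omega> x \<eta> =
     f_at T f \<omega> x \<eta>
     - measure_pmf.expectation (bernoulli_product N \<rho>) (f_at T f \<omega> x)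
     - vector_derivative
         (\<lambda>r. \<integral>\<omega>'. measure_pmf.expectation (bernoulli_product N r) (f_at T f \<omega>' x) \<partial>\<mu>)
         (at \<rho> within {0..1})
       * (occ \<eta> x - \<rho>)"

end

theory Submission imports Defs begin

text \<open>Expand the local function \<open>f\<close> in products of the centred variables \<open>\<eta>(z) - \<rho>\<close>. The constant term is
  cancelled by the quenched mean, and the derivative of the annealed mean is the sum of the averaged
  coefficients of degree one. What remains are products of degree at least two, gradients
  \<open>\<eta>(x + z) - \<eta>(x)\<close> with bounded coefficients, and \<open>h(T\<^sub>x \<omega>) (\<eta>(x) - \<rho>)\<close> with \<open>h\<close> bounded and of mean zero.

  After time scaling all bonds exchange at rate at least of order \<open>N\<close>, so gradients have
  \<open>H\<^sub>-\<^sub>1\<close> norm of order \<open>N\<^sup>-\<^sup>1\<^sup>/\<^sup>2\<close> and their time integrals vanish. Modulo gradients, one factor of a product can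
  be spread over \<open>l\<close> sites, which reduces the static variance to order \<open>1/l\<close>; and \<open>h\<close> can be replaced by
  a convex combination of its translates. Some such combinations tend to \<open>0\<close> in \<open>L\<^sup>2\<close> by ergodicity, and
  the maximal inequality turns this into smallness of the spatial averages of their squares,
  uniformly in \<open>N\<close>, for almost every \<open>\<omega>\<close>. Moving the translation off \<open>h\<close> puts it on \<open>G\<close>, which is harmless
  because a cadlag function oscillates little away from finitely many hyperplanes.\<close>

section \<open>Reversible Markov processes on a finite state space\<close>

text \<open>In every approximation an auxiliary parameter, the length l of an average or the
  accuracy \<delta> of a convex combination, is fixed while N tends to infinity. Each value of the
  parameter costs finitely many gradients, so a bound of order 1/N for a single gradient suffices,
  and neither a spectral gap on boxes nor an equivalence of ensembles enters. What the averaging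
  leaves over is bounded by its stationary variance alone.

  Under the stationary law the centred products are orthogonal, so a linear functional with
  coefficients c(x) costs the spatial average of c(x)^2. Hence the squares of the averaged
  environment must be small along the orbit of one fixed \<omega>, for all N at once; convergence in
  L^2(\<mu>) alone does not give this, and the maximal inequality bridges the gap. The null set
  depends on h only, so it is chosen before G, t and the processes.

  The dynamics enters through two-time correlations and Riemann sums, because the process is given
  by its finite-dimensional distributions and right-continuous paths.\<close>

definition exp_series :: "(nat \<Rightarrow> real) \<Rightarrow> real \<Rightarrow> real" where
  "exp_series m t = (\<Sum>n. t ^ n / fact n * m n)"

lemma exp_series_summable:
  assumes "\<And>n. \<bar>m n\<bar> \<le> C * M ^ n"
  shows "summable (\<lambda>n. t ^ n / fact n * m n :: real)"
proof (rule summable_comparison_test')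
  show "summable (\<lambda>n. C * (inverse (fact n) * (\<bar>t\<bar> * M) ^ n))"
    by (intro summable_mult summable_exp)
  show "norm (t ^ n / fact n * m n) \<le> C * (inverse (fact n) * (\<bar>t\<bar> * M) ^ n)" if "n \<ge> 0" for n
  proof -
    have "norm (t ^ n / fact n * m n) = \<bar>t\<bar> ^ n / fact n * \<bar>m n\<bar>"
      by (simp add: abs_mult power_abs)
    also have "\<dots> \<le> \<bar>t\<bar> ^ n / fact n * (C * M ^ n)"
      using assms by (intro mult_left_mono) auto
    finally show ?thesis by (simp add: field_simps power_mult_distrib)
  qed
qed

text \<open>Differentiation shifts the coefficient sequence by one index. With coefficients
  \<open>(A ^^ n) f \<eta>\<close> this is the backward equation, and shifting in the other
  direction gives the time integral of the semigroup.\<close>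

lemma exp_series_deriv:
  assumes "\<And>n. \<bar>m n\<bar> \<le> C * M ^ n"
  shows "(exp_series m has_real_derivative exp_series (\<lambda>n. m (Suc n)) t) (at t)"
proof -
  have *: "exp_series m = (\<lambda>x. \<Sum>n. (m n / fact n) * x ^ n)"
    by (auto simp: exp_series_def fun_eq_iff mult_ac)
  have "summable (\<lambda>n. (m n / fact n) * y ^ n)" for y
    using exp_series_summable[OF assms, of y] by (simp add: mult_ac)
  then have "((\<lambda>x. \<Sum>n. (m n / fact n) * x ^ n) has_real_derivative
      (\<Sum>n. diffs (\<lambda>n. m n / fact n) n * t ^ n)) (at t)"
    by (rule termdiffs_strong_converges_everywhere)
  moreover have "diffs (\<lambda>n. m n / fact n) n * t ^ n = t ^ n / fact n * m (Suc n)" for n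
    by (simp add: diffs_def field_simps del: of_nat_Suc)
  ultimately show ?thesis by (simp add: exp_series_def *)
qed

lemma exp_series_0 [simp]: "exp_series m 0 = m 0"
  using suminf_finite[of "{0}" "\<lambda>n. 0 ^ n / fact n * m n"]
  by (simp add: exp_series_def)

section \<open>The semigroup of a symmetric generator on a finite set\<close>

locale reversible_generator =
  fixes S :: "'s set" and A :: "('s \<Rightarrow> real) \<Rightarrow> 's \<Rightarrow> real" and \<nu> :: "'s pmf"
  assumes finite_S: "finite S" and supp: "set_pmf \<nu> \<subseteq> S"
    and lin: "\<And>c f g \<xi>. A (\<lambda>\<eta>. c * f \<eta> + g \<eta>) \<xi> = c * A f \<xi> + A g \<xi>"
    and bounded: "\<exists>M\<ge>0. \<forall>f B. (\<forall>\<eta>\<in>S. \<bar>f \<eta>\<bar> \<le> B) \<longrightarrow> (\<forall>\<eta>\<in>S. \<bar>A f \<eta>\<bar> \<le> M * B)"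
    and A_one: "\<And>\<eta>. \<eta> \<in> S \<Longrightarrow> A (\<lambda>_. 1) \<eta> = 0"
    and sym: "\<And>f g. (\<Sum>\<eta>\<in>S. pmf \<nu> \<eta> * (f \<eta> * A g \<eta>)) = (\<Sum>\<eta>\<in>S. pmf \<nu> \<eta> * (A f \<eta> * g \<eta>))"
    and nonpos: "\<And>f. (\<Sum>\<eta>\<in>S. pmf \<nu> \<eta> * (f \<eta> * A f \<eta>)) \<le> 0"
begin

definition ip :: "('s \<Rightarrow> real) \<Rightarrow> ('s \<Rightarrow> real) \<Rightarrow> real" where
  "ip f g = (\<Sum>\<eta>\<in>S. pmf \<nu> \<eta> * (f \<eta> * g \<eta>))"

definition semi :: "real \<Rightarrow> ('s \<Rightarrow> real) \<Rightarrow> 's \<Rightarrow> real" where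
  "semi t f \<eta> = exp_series (\<lambda>n. (A ^^ n) f \<eta>) t"

text \<open>The integral of exp(sA) f over s in [0,t], written as a power series so that its pairing
  with g is again an \<open>exp_series\<close>.\<close>

definition int_semi :: "real \<Rightarrow> ('s \<Rightarrow> real) \<Rightarrow> 's \<Rightarrow> real" where
  "int_semi t f \<eta> = exp_series (\<lambda>n. case n of 0 \<Rightarrow> 0 | Suc k \<Rightarrow> (A ^^ k) f \<eta>) t"

lemma ip_commute: "ip f g = ip g f"
  by (simp add: ip_def mult.commute)

lemma ip_sym: "ip f (A g) = ip (A f) g"
  using sym by (simp add: ip_def)

lemma ip_nonneg: "0 \<le> ip f f"
  by (auto simp: ip_def intro!: sum_nonneg)

lemma ip_sym_pow: "ip f ((A ^^ n) g) = ip ((A ^^ n) f) g"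
  by (induction n arbitrary: g) (simp_all add: funpow_swap1 ip_sym)

lemma pow_bound:
  obtains C M where "C \<ge> 0" "M \<ge> 0" "\<And>n \<eta>. \<eta> \<in> S \<Longrightarrow> \<bar>(A ^^ n) f \<eta>\<bar> \<le> C * M ^ n"
proof -
  obtain M where M: "M \<ge> 0" "\<And>f B \<eta>. (\<forall>\<eta>\<in>S. \<bar>f \<eta>\<bar> \<le> B) \<Longrightarrow> \<eta> \<in> S \<Longrightarrow> \<bar>A f \<eta>\<bar> \<le> M * B"
    using bounded by blast
  define C where "C = (\<Sum>\<eta>\<in>S. \<bar>f \<eta>\<bar>)"
  have "\<forall>\<eta>\<in>S. \<bar>(A ^^ n) f \<eta>\<bar> \<le> C * M ^ n" for n
  proof (induction n)
    case 0
    then show ?case using finite_S by (auto simp: C_def intro!: member_le_sum)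
  next
    case (Suc n)
    then show ?case using M(2)[of "(A ^^ n) f" "C * M ^ n"] by (auto simp: mult_ac)
  qed
  moreover have "C \<ge> 0" by (auto simp: C_def intro!: sum_nonneg)
  ultimately show ?thesis using that M(1) by blast
qed

lemma shifted_pow_bound:
  obtains C M where "\<And>n \<eta>. \<eta> \<in> S \<Longrightarrow> \<bar>case n of 0 \<Rightarrow> 0 | Suc k \<Rightarrow> (A ^^ k) f \<eta>\<bar> \<le> C * M ^ n"
proof -
  obtain C M where CM: "C \<ge> 0" "M \<ge> 0" "\<And>n \<eta>. \<eta> \<in> S \<Longrightarrow> \<bar>(A ^^ n) f \<eta>\<bar> \<le> C * M ^ n"
    by (metis pow_bound[of f])
  \<comment> \<open>The base M + 1 is at least 1 and at least M, so the extra power produced by the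
    index shift does no harm even if M < 1.\<close>
  have "\<bar>case n of 0 \<Rightarrow> 0 | Suc k \<Rightarrow> (A ^^ k) f \<eta>\<bar> \<le> C * (M + 1) ^ n" if "\<eta> \<in> S" for n \<eta>
  proof (cases n)
    case (Suc k)
    have "C * M ^ k \<le> C * (M + 1) ^ Suc k"
      using CM order_trans[OF power_mono[of M "M + 1" k] power_increasing[of k "Suc k" "M + 1"]]
      by (intro mult_left_mono) auto
    then show ?thesis using CM(3)[OF that, of k] Suc by simp
  qed (use CM in simp)
  then show ?thesis using that by blast
qed

lemma ip_exp_series:
  assumes "\<And>n \<eta>. \<eta> \<in> S \<Longrightarrow> \<bar>m n \<eta>\<bar> \<le> C * M ^ n"
  shows "ip g (\<lambda>\<eta>. exp_series (\<lambda>n. m n \<eta>) t) = exp_series (\<lambda>n. ip g (m n)) t"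
proof -
  have "ip g (\<lambda>\<eta>. exp_series (\<lambda>n. m n \<eta>) t)
      = (\<Sum>\<eta>\<in>S. \<Sum>n. pmf \<nu> \<eta> * g \<eta> * (t ^ n / fact n * m n \<eta>))"
    unfolding ip_def exp_series_def
  proof (intro sum.cong refl)
    fix \<eta> assume "\<eta> \<in> S"
    then have "summable (\<lambda>n. t ^ n / fact n * m n \<eta>)"
      by (intro exp_series_summable[of _ C M] assms)
    from suminf_mult[OF this, of "pmf \<nu> \<eta> * g \<eta>"]
    show "pmf \<nu> \<eta> * (g \<eta> * (\<Sum>n. t ^ n / fact n * m n \<eta>))
      = (\<Sum>n. pmf \<nu> \<eta> * g \<eta> * (t ^ n / fact n * m n \<eta>))" by (simp only: mult.assoc)
  qed
  also have "\<dots> = (\<Sum>n. \<Sum>\<eta>\<in>S. pmf \<nu> \<eta> * g \<eta> * (t ^ n / fact n * m n \<eta>))"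
    by (rule suminf_sum[symmetric]) (intro summable_mult exp_series_summable[of _ C M] assms)
  also have "\<dots> = exp_series (\<lambda>n. ip g (m n)) t"
    unfolding ip_def exp_series_def sum_distrib_left by (simp add: mult_ac)
  finally show ?thesis .
qed

lemma ip_semi: "ip g (semi t f) = exp_series (\<lambda>n. ip g ((A ^^ n) f)) t"
proof -
  obtain C M where "\<And>n \<eta>. \<eta> \<in> S \<Longrightarrow> \<bar>(A ^^ n) f \<eta>\<bar> \<le> C * M ^ n"
    by (metis pow_bound[of f])
  from ip_exp_series[OF this] show ?thesis by (simp add: semi_def[abs_def])
qed

lemma ip_int_semi:
  "ip g (int_semi t f) = exp_series (\<lambda>n. case n of 0 \<Rightarrow> 0 | Suc k \<Rightarrow> ip g ((A ^^ k) f)) t"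
proof -
  obtain C M where "\<And>n \<eta>. \<eta> \<in> S \<Longrightarrow> \<bar>case n of 0 \<Rightarrow> 0 | Suc k \<Rightarrow> (A ^^ k) f \<eta>\<bar> \<le> C * M ^ n"
    by (metis shifted_pow_bound[of f])
  from ip_exp_series[OF this] have "ip g (int_semi t f)
      = exp_series (\<lambda>n. ip g (\<lambda>\<eta>. case n of 0 \<Rightarrow> 0 | Suc k \<Rightarrow> (A ^^ k) f \<eta>)) t"
    by (simp add: int_semi_def[abs_def])
  also have "(\<lambda>n. ip g (\<lambda>\<eta>. case n of 0 \<Rightarrow> 0 | Suc k \<Rightarrow> (A ^^ k) f \<eta>))
      = (\<lambda>n. case n of 0 \<Rightarrow> 0 | Suc k \<Rightarrow> ip g ((A ^^ k) f))"
    by (auto simp: fun_eq_iff ip_def split: nat.split)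
  finally show ?thesis .
qed

lemma ip_semi_swap: "ip g (semi t f) = ip (semi t g) f"
proof -
  have "ip g ((A ^^ n) f) = ip f ((A ^^ n) g)" for n
    by (metis ip_sym_pow ip_commute)
  then show ?thesis by (simp add: ip_commute[of "semi t g"] ip_semi)
qed

lemma ip_semi_A: "ip g (semi t (A f)) = ip (A g) (semi t f)"
proof -
  have "(A ^^ n) (A f) = A ((A ^^ n) f)" for n by (simp add: funpow_swap1)
  then show ?thesis by (simp add: ip_semi ip_sym)
qed

lemma semi_deriv:
  assumes "\<eta> \<in> S"
  shows "((\<lambda>t. semi t f \<eta>) has_real_derivative semi t (A f) \<eta>) (at t)"
proof -
  obtain C M where "\<And>n \<eta>. \<eta> \<in> S \<Longrightarrow> \<bar>(A ^^ n) f \<eta>\<bar> \<le> C * M ^ n"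
    by (metis pow_bound[of f])
  with assms have "\<And>n. \<bar>(A ^^ n) f \<eta>\<bar> \<le> C * M ^ n" by simp
  from exp_series_deriv[OF this] show ?thesis
    by (simp add: semi_def[abs_def] funpow_swap1)
qed

lemma int_semi_deriv:
  assumes "\<eta> \<in> S"
  shows "((\<lambda>t. int_semi t f \<eta>) has_real_derivative semi t f \<eta>) (at t)"
proof -
  obtain C M where "\<And>n \<eta>. \<eta> \<in> S \<Longrightarrow> \<bar>case n of 0 \<Rightarrow> 0 | Suc k \<Rightarrow> (A ^^ k) f \<eta>\<bar> \<le> C * M ^ n"
    by (metis shifted_pow_bound[of f])
  with assms have "\<And>n. \<bar>case n of 0 \<Rightarrow> 0 | Suc k \<Rightarrow> (A ^^ k) f \<eta>\<bar> \<le> C * M ^ n" by simp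
  from exp_series_deriv[OF this] show ?thesis
    by (simp add: semi_def[abs_def] int_semi_def[abs_def])
qed

lemma ip_int_semi_deriv:
  "((\<lambda>t. ip g (int_semi t f)) has_real_derivative ip g (semi t f)) (at t)"
  unfolding ip_def by (intro derivative_intros DERIV_cmult int_semi_deriv) auto

lemma semi_0 [simp]: "semi 0 f = f"
  by (simp add: semi_def fun_eq_iff)

lemma int_semi_0 [simp]: "int_semi 0 f = (\<lambda>_. 0)"
  by (simp add: int_semi_def fun_eq_iff)

text \<open>Interpolation: by symmetry of A the pairing of exp((a-s)A) f with exp((b+s)A) g has
  derivative 0 in s, and s = 0, s = a give the two sides. This weak form of the semigroup law avoids
  multiplying power series.\<close>

lemma semigroup: "ip (semi a f) (semi b g) = ip f (semi (a + b) g)"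
proof -
  define \<phi> where "\<phi> s = ip (semi (a - s) f) (semi (b + s) g)" for s
  have "(\<phi> has_real_derivative
      (\<Sum>\<eta>\<in>S. pmf \<nu> \<eta> * (semi (a - s) (A f) \<eta> * (- 1) * semi (b + s) g \<eta>
         + semi (b + s) (A g) \<eta> * 1 * semi (a - s) f \<eta>))) (at s)" for s
    unfolding \<phi>_def ip_def
    by (intro DERIV_sum DERIV_cmult DERIV_mult DERIV_chain'[OF _ semi_deriv])
      (auto intro!: derivative_eq_intros)
  moreover have "(\<Sum>\<eta>\<in>S. pmf \<nu> \<eta> * (semi (a - s) (A f) \<eta> * (- 1) * semi (b + s) g \<eta>
         + semi (b + s) (A g) \<eta> * 1 * semi (a - s) f \<eta>)) = 0" for s
  proof -
    have "(\<Sum>\<eta>\<in>S. pmf \<nu> \<eta> * (semi (a - s) (A f) \<eta> * (- 1) * semi (b + s) g \<eta>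
         + semi (b + s) (A g) \<eta> * 1 * semi (a - s) f \<eta>))
      = ip (semi (a - s) f) (semi (b + s) (A g)) - ip (semi (b + s) g) (semi (a - s) (A f))"
      unfolding ip_def sum_subtractf[symmetric] by (rule sum.cong) (auto simp: algebra_simps)
    also have "\<dots> = 0"
      by (simp only: ip_semi_A ip_sym ip_commute[of "A (semi (b + s) g)"])
    finally show ?thesis .
  qed
  ultimately have "(\<phi> has_real_derivative 0) (at s)" for s by metis
  then have "\<phi> a = \<phi> 0" by (intro DERIV_isconst_all) auto
  then show ?thesis by (simp add: \<phi>_def add.commute)
qed

text \<open>Splitting r into two halves turns the autocorrelation into a squared norm; here
  reversibility yields positivity.\<close>

lemma corr_nonneg: "0 \<le> ip f (semi r f)"
  using semigroup[of "r/2" f "r/2" f] ip_nonneg[of "semi (r/2) f"] by simp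

text \<open>The derivative in time, split into halves again, is the quadratic form of A at exp(xA/2)
  f, which is non-positive.\<close>

lemma corr_antimono:
  assumes "r \<le> s" shows "ip f (semi s f) \<le> ip f (semi r f)"
proof (rule DERIV_nonpos_imp_nonincreasing[OF assms], intro exI conjI)
  fix x :: real
  show "((\<lambda>s. ip f (semi s f)) has_real_derivative ip f (semi x (A f))) (at x)"
    unfolding ip_def by (intro derivative_intros DERIV_cmult semi_deriv) auto
  have "ip f (semi x (A f)) = ip (semi (x/2) f) (semi (x/2) (A f))"
    by (simp add: semigroup)
  also have "\<dots> = ip (semi (x/2) f) (A (semi (x/2) f))"
    by (simp only: ip_semi_A ip_sym)
  also have "\<dots> \<le> 0" using nonpos by (simp add: ip_def)
  finally show "ip f (semi x (A f)) \<le> 0" .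
qed

text \<open>With \<open>u = int_semi t f\<close> one has \<open>A u = semi t f - f\<close>, so the Dirichlet form of \<open>u\<close> is at most
  \<open>ip f u\<close>, and the hypothesis applied to \<open>u\<close> closes up.\<close>

lemma int_corr_le:
  assumes K: "\<And>\<psi>. (ip f \<psi>)\<^sup>2 \<le> K * (- ip \<psi> (A \<psi>))" "K \<ge> 0" and t: "t \<ge> 0"
  shows "ip f (int_semi t f) \<le> K"
proof -
  define u where "u = int_semi t f"
  have "ip u (A u) = ip (A u) (int_semi t f)" by (simp add: ip_sym u_def)
  also have "\<dots> = exp_series (\<lambda>n. case n of 0 \<Rightarrow> 0 | Suc k \<Rightarrow> ip u ((A ^^ Suc k) f)) t"
    by (simp add: ip_int_semi ip_sym cong: nat.case_cong)
  also have "\<dots> = ip u (semi t f) - ip u f"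
  proof -
    have *: "summable (\<lambda>n. t ^ n / fact n * (case n of 0 \<Rightarrow> 0 | Suc k \<Rightarrow> ip u ((A ^^ Suc k) f)))"
    proof -
      obtain C M where "C \<ge> 0" "M \<ge> 0" and CM: "\<And>n \<eta>. \<eta> \<in> S \<Longrightarrow> \<bar>(A ^^ n) f \<eta>\<bar> \<le> C * M ^ n"
        by (metis pow_bound[of f])
      have "\<bar>case n of 0 \<Rightarrow> 0 | Suc k \<Rightarrow> ip u ((A ^^ Suc k) f)\<bar> \<le> (\<Sum>\<eta>\<in>S. pmf \<nu> \<eta> * \<bar>u \<eta>\<bar> * C) * M ^ n" for n
      proof (cases n)
        case (Suc k)
        have "\<bar>ip u ((A ^^ n) f)\<bar> \<le> (\<Sum>\<eta>\<in>S. pmf \<nu> \<eta> * \<bar>u \<eta>\<bar> * (C * M ^ n))"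
          unfolding ip_def
          by (rule order_trans[OF sum_abs sum_mono])
            (auto simp: abs_mult mult.assoc intro!: mult_left_mono CM)
        then show ?thesis by (simp add: Suc sum_distrib_right sum_distrib_left mult_ac)
      qed (use \<open>C \<ge> 0\<close> \<open>M \<ge> 0\<close> in \<open>auto intro!: sum_nonneg\<close>)
      then show ?thesis by (rule exp_series_summable)
    qed
    have "ip u (semi t f) = exp_series (\<lambda>n. case n of 0 \<Rightarrow> ip u f | Suc k \<Rightarrow> ip u ((A ^^ Suc k) f)) t"
      unfolding ip_semi by (rule arg_cong[where f = "\<lambda>m. exp_series m t"]) (auto split: nat.split)
    also have "\<dots> = (\<Sum>n. t ^ n / fact n * (case n of 0 \<Rightarrow> 0 | Suc k \<Rightarrow> ip u ((A ^^ Suc k) f))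
        + (if n = 0 then ip u f else 0))"
      unfolding exp_series_def by (rule suminf_cong) (auto split: nat.split)
    also have "\<dots> = exp_series (\<lambda>n. case n of 0 \<Rightarrow> 0 | Suc k \<Rightarrow> ip u ((A ^^ Suc k) f)) t + ip u f"
      using suminf_add[OF *, of "\<lambda>n. if n = 0 then ip u f else 0"] suminf_finite[of "{0}" "\<lambda>n. if n = 0 then ip u f else 0"]
      by (simp add: exp_series_def summable_finite[of "{0}"])
    finally show ?thesis by simp
  qed
  finally have 1: "- ip u (A u) = ip f u - ip u (semi t f)" by (simp add: ip_commute)
  \<comment> \<open>This pairing is the integral over x in [0,t] of the correlations at time t + x,
    all of them non-negative.\<close>
  have "ip u (semi t f) \<ge> 0"
  proof -
    have "ip (semi t f) (int_semi 0 f) \<le> ip (semi t f) (int_semi t f)"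
    proof (rule DERIV_nonneg_imp_nondecreasing[OF t], intro exI conjI)
      fix x :: real
      show "((\<lambda>s. ip (semi t f) (int_semi s f)) has_real_derivative ip (semi t f) (semi x f)) (at x)"
        by (rule ip_int_semi_deriv)
      show "0 \<le> ip (semi t f) (semi x f)" by (simp add: semigroup corr_nonneg)
    qed
    then show ?thesis by (simp add: u_def ip_commute[of "int_semi t f"]) (simp add: ip_def)
  qed
  with 1 have "K * (- ip u (A u)) \<le> K * ip f u" using K(2) by (intro mult_left_mono) auto
  with K(1)[of u] have "ip f u * ip f u \<le> K * ip f u" by (simp add: power2_eq_square)
  then have "ip f u \<le> K"
    using K(2) by (cases "ip f u > 0") (auto simp: mult_le_cancel_right)
  then show ?thesis by (simp add: u_def)
qed


lemma transition_semi: "transition A t \<eta> \<zeta> = semi t (\<lambda>\<eta>'. of_bool (\<eta>' = \<zeta>)) \<eta>"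
  by (simp add: transition_def semi_def exp_series_def)

lemma ip_of_bool: "\<zeta> \<in> S \<Longrightarrow> ip f (\<lambda>\<eta>'. of_bool (\<eta>' = \<zeta>)) = pmf \<nu> \<zeta> * f \<zeta>"
proof -
  assume "\<zeta> \<in> S"
  have "ip f (\<lambda>\<eta>'. of_bool (\<eta>' = \<zeta>)) = (\<Sum>\<eta>\<in>S. if \<eta> = \<zeta> then pmf \<nu> \<zeta> * f \<zeta> else 0)"
    unfolding ip_def by (intro sum.cong) auto
  then show ?thesis using finite_S \<open>\<zeta> \<in> S\<close> by simp
qed

text \<open>Expanding g in point indicators under the semigroup would require its linearity.
  Symmetry moves the semigroup to f, where pairing with an indicator evaluates at a point, and then
  back.\<close>

lemma corr_transition:
  "(\<Sum>\<eta>\<in>S. \<Sum>\<zeta>\<in>S. pmf \<nu> \<eta> * f \<eta> * transition A t \<eta> \<zeta> * g \<zeta>) = ip f (semi t g)"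
proof -
  have "ip f (semi t g) = ip (semi t f) g" by (rule ip_semi_swap)
  also have "\<dots> = (\<Sum>\<zeta>\<in>S. ip (semi t f) (\<lambda>\<eta>'. of_bool (\<eta>' = \<zeta>)) * g \<zeta>)"
    by (simp add: ip_of_bool) (simp add: ip_def mult_ac)
  also have "\<dots> = (\<Sum>\<zeta>\<in>S. \<Sum>\<eta>\<in>S. pmf \<nu> \<eta> * f \<eta> * transition A t \<eta> \<zeta> * g \<zeta>)"
    unfolding ip_semi_swap[symmetric] transition_semi
    by (simp add: ip_def sum_distrib_left sum_distrib_right mult_ac)
  also have "\<dots> = (\<Sum>\<eta>\<in>S. \<Sum>\<zeta>\<in>S. pmf \<nu> \<eta> * f \<eta> * transition A t \<eta> \<zeta> * g \<zeta>)"
    by (rule sum.swap)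
  finally show ?thesis ..
qed

text \<open>The semigroup fixes constants on S, and symmetry turns this into invariance of
  \<nu>.\<close>

lemma stationary:
  assumes "\<zeta> \<in> S"
  shows "(\<Sum>\<eta>\<in>S. pmf \<nu> \<eta> * transition A t \<eta> \<zeta>) = pmf \<nu> \<zeta>"
proof -
  have A0: "A (\<lambda>_. 0) = (\<lambda>_. 0)"
    using lin[of "-1" "\<lambda>_. 0" "\<lambda>_. 0"] by (simp add: fun_eq_iff)
  have *: "\<forall>\<eta>\<in>S. (A ^^ n) (\<lambda>_. 1) \<eta> = (if n = 0 then 1 else 0)" for n
  proof (induction n)
    case (Suc n)
    obtain M where M: "M \<ge> 0" "\<And>f B \<eta>. (\<forall>\<eta>\<in>S. \<bar>f \<eta>\<bar> \<le> B) \<Longrightarrow> \<eta> \<in> S \<Longrightarrow> \<bar>A f \<eta>\<bar> \<le> M * B"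
      using bounded by blast
    show ?case
    proof (cases "n = 0")
      case False
      \<comment> \<open>The case B = 0 of \<open>bounded\<close>: A maps functions vanishing on S to
        functions vanishing on S, so every positive power annihilates the constant 1 there.\<close>
      with Suc M(2)[of "(A ^^ n) (\<lambda>_. 1)" 0] show ?thesis by auto
    qed (use A_one in auto)
  qed simp
  have semi1: "semi t (\<lambda>_. 1) \<eta> = 1" if "\<eta> \<in> S" for \<eta>
  proof -
    have "semi t (\<lambda>_. 1) \<eta> = exp_series (\<lambda>n. if n = 0 then 1 else 0) t"
      using * that by (simp add: semi_def)
    also have "\<dots> = 1"
      using suminf_finite[of "{0}" "\<lambda>n. t ^ n / fact n * (if n = 0 then 1 else 0)"]
      by (simp add: exp_series_def)
    finally show ?thesis .
  qed
  have "(\<Sum>\<eta>\<in>S. pmf \<nu> \<eta> * transition A t \<eta> \<zeta>) = ip (\<lambda>_. 1) (semi t (\<lambda>\<eta>'. of_bool (\<eta>' = \<zeta>)))"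
    by (simp add: ip_def transition_semi)
  also have "\<dots> = ip (semi t (\<lambda>_. 1)) (\<lambda>\<eta>'. of_bool (\<eta>' = \<zeta>))" by (rule ip_semi_swap)
  also have "\<dots> = pmf \<nu> \<zeta>" using assms semi1 by (simp add: ip_of_bool)
  finally show ?thesis .
qed

end

section \<open>Stationary reversible processes: two-time correlations and path integrals\<close>

locale reversible_process = reversible_generator S A \<nu> for S :: "'s set" and A \<nu> +
  fixes P :: "'p measure" and X :: "real \<Rightarrow> 'p \<Rightarrow> 's"
  assumes markov: "markov_process S A \<nu> P X"
begin

sublocale prob_space P
  using markov by (simp add: markov_process_def)

lemma X_measurable: "t \<ge> 0 \<Longrightarrow> X t \<in> measurable P (count_space S)"
  using markov by (simp add: markov_process_def)

lemma X_in_S: "t \<ge> 0 \<Longrightarrow> p \<in> space P \<Longrightarrow> X t p \<in> S"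
  using measurable_space[OF X_measurable] by simp

lemma X_right_continuous: "t \<ge> 0 \<Longrightarrow> p \<in> space P \<Longrightarrow> \<forall>\<^sub>F s in at_right t. X s p = X t p"
  using markov by (simp add: markov_process_def)

lemma fX_measurable [measurable]: "t \<ge> 0 \<Longrightarrow> (\<lambda>p. f (X t p) :: real) \<in> borel_measurable P"
  by (rule measurable_compose[OF X_measurable]) auto

definition f_bound :: "('s \<Rightarrow> real) \<Rightarrow> real" where
  "f_bound f = (\<Sum>\<eta>\<in>S. \<bar>f \<eta>\<bar>)"

lemma f_bound: "t \<ge> 0 \<Longrightarrow> p \<in> space P \<Longrightarrow> \<bar>f (X t p)\<bar> \<le> f_bound f"
  unfolding f_bound_def using X_in_S finite_S by (intro member_le_sum) auto

lemma f_bound_nonneg: "f_bound f \<ge> 0"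
  by (auto simp: f_bound_def intro!: sum_nonneg)

lemma two_time:
  assumes "0 \<le> s" "s \<le> r"
  shows "(\<integral>p. f (X s p) * g (X r p) \<partial>P) = ip f (semi (r - s) g)"
proof -
  \<comment> \<open>Time 0 is included because the finite-dimensional distributions are prescribed
    only along sequences starting at 0; stationarity later sums out the initial value.\<close>
  define E where "E \<zeta> = {p \<in> space P. X 0 p = fst \<zeta> \<and> X s p = fst (snd \<zeta>) \<and> X r p = snd (snd \<zeta>)}"
    for \<zeta>
  let ?S3 = "S \<times> S \<times> S"
  have E_sets: "E \<zeta> \<in> sets P" if "\<zeta> \<in> ?S3" for \<zeta>
  proof -
    have "E \<zeta> = (X 0 -` {fst \<zeta>} \<inter> space P) \<inter> (X s -` {fst (snd \<zeta>)} \<inter> space P)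
       \<inter> (X r -` {snd (snd \<zeta>)} \<inter> space P)"
      by (auto simp: E_def)
    also have "\<dots> \<in> sets P"
      using assms that by (intro sets.Int measurable_sets[OF X_measurable]) auto
    finally show ?thesis .
  qed
  have E_meas: "measure P (E \<zeta>)
      = pmf \<nu> (fst \<zeta>) * transition A s (fst \<zeta>) (fst (snd \<zeta>)) * transition A (r - s) (fst (snd \<zeta>)) (snd (snd \<zeta>))"
    if "\<zeta> \<in> ?S3" for \<zeta>
  proof -
    \<comment> \<open>The Markov property speaks of infinite monotone sequences of times, so \<tau>
      and z are continued as constants from index 2 on.\<close>
    define \<tau> where "\<tau> = (\<lambda>i::nat. if i = 0 then 0 else if i = 1 then s else r)"
    define z where "z = (\<lambda>i::nat. if i = 0 then fst \<zeta> else if i = 1 then fst (snd \<zeta>) else snd (snd \<zeta>))"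
    have "mono \<tau>" using assms by (auto simp: \<tau>_def mono_def)
    moreover have "\<forall>i. z i \<in> S" using that by (auto simp: z_def)
    moreover have "\<tau> 0 = 0" by (simp add: \<tau>_def)
    ultimately have "measure P {p \<in> space P. \<forall>i\<le>2. X (\<tau> i) p = z i}
          = pmf \<nu> (z 0) * (\<Prod>i<2. transition A (\<tau> (Suc i) - \<tau> i) (z i) (z (Suc i)))"
      using markov unfolding markov_process_def by blast
    moreover have "{p \<in> space P. \<forall>i\<le>2. X (\<tau> i) p = z i} = E \<zeta>"
      by (auto simp: E_def \<tau>_def z_def le_Suc_eq numeral_2_eq_2)
    ultimately show ?thesis by (simp add: z_def \<tau>_def numeral_2_eq_2)
  qed
  have "f (X s p) * g (X r p)
      = (\<Sum>\<zeta>\<in>?S3. f (fst (snd \<zeta>)) * g (snd (snd \<zeta>)) * indicator (E \<zeta>) p)" if "p \<in> space P" for p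
  proof -
    define \<zeta>' where "\<zeta>' = (X 0 p, X s p, X r p)"
    have "\<zeta>' \<in> ?S3" using X_in_S that assms by (auto simp: \<zeta>'_def)
    have "(\<Sum>\<zeta>\<in>?S3. f (fst (snd \<zeta>)) * g (snd (snd \<zeta>)) * indicator (E \<zeta>) p)
       = (\<Sum>\<zeta>\<in>?S3. if \<zeta> = \<zeta>' then f (X s p) * g (X r p) else 0)"
      using that by (intro sum.cong) (auto simp: E_def \<zeta>'_def indicator_def)
    with \<open>\<zeta>' \<in> ?S3\<close> finite_S show ?thesis by simp
  qed
  then have "(\<integral>p. f (X s p) * g (X r p) \<partial>P)
      = (\<integral>p. (\<Sum>\<zeta>\<in>?S3. f (fst (snd \<zeta>)) * g (snd (snd \<zeta>)) * indicator (E \<zeta>) p) \<partial>P)"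
    by (intro Bochner_Integration.integral_cong) auto
  also have "\<dots> = (\<Sum>\<zeta>\<in>?S3. f (fst (snd \<zeta>)) * g (snd (snd \<zeta>)) * measure P (E \<zeta>))"
    using E_sets
    by (subst Bochner_Integration.integral_sum)
      (auto intro!: integrable_mult_right integrable_real_indicator sum.cong
        simp: sets.Int_space_eq2 emeasure_eq_measure)
  also have "\<dots> = (\<Sum>\<zeta>\<in>?S3. f (fst (snd \<zeta>)) * g (snd (snd \<zeta>)) *
      (pmf \<nu> (fst \<zeta>) * transition A s (fst \<zeta>) (fst (snd \<zeta>)) * transition A (r - s) (fst (snd \<zeta>)) (snd (snd \<zeta>))))"
    by (intro sum.cong) (auto simp: E_meas)
  also have "\<dots> = (\<Sum>x\<in>S. \<Sum>y\<in>S. \<Sum>z\<in>S. f y * g z * (pmf \<nu> x * transition A s x y * transition A (r - s) y z))"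
    by (simp add: sum.cartesian_product case_prod_beta)
  also have "\<dots> = (\<Sum>y\<in>S. \<Sum>z\<in>S. \<Sum>x\<in>S. f y * g z * (pmf \<nu> x * transition A s x y * transition A (r - s) y z))"
    by (subst sum.swap) (intro sum.cong refl sum.swap)
  also have "\<dots> = (\<Sum>y\<in>S. \<Sum>z\<in>S. (\<Sum>x\<in>S. pmf \<nu> x * transition A s x y) * (f y * transition A (r - s) y z * g z))"
    by (simp add: sum_distrib_right sum_distrib_left mult_ac)
  also have "\<dots> = (\<Sum>y\<in>S. \<Sum>z\<in>S. pmf \<nu> y * f y * transition A (r - s) y z * g z)"
    by (simp add: stationary mult_ac)
  also have "\<dots> = ip f (semi (r - s) g)" by (rule corr_transition)
  finally show ?thesis .
qed

definition riemann :: "('s \<Rightarrow> real) \<Rightarrow> real \<Rightarrow> nat \<Rightarrow> 'p \<Rightarrow> real" where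
  "riemann f t n p = t / real n * (\<Sum>k=1..n. f (X (real k * t / real n) p))"

text \<open>Sampling at the right end points makes right continuity sufficient for convergence.\<close>

lemma riemann_tendsto:
  assumes t: "t > 0" and p: "p \<in> space P"
  shows "(\<lambda>n. riemann f t n p) \<longlonglongrightarrow> (LBINT s:{0..t}. f (X s p))"
    and "\<bar>LBINT s:{0..t}. f (X s p)\<bar> \<le> t * f_bound f"
proof -
  define u where "u n s = (\<Sum>k=1..n. f (X (real k * t / real n) p) *
      indicator {real (k - 1) * t / real n ..< real k * t / real n} s)" for n s
  have cell: "u n s = f (X ((real_of_int \<lfloor>s * real n / t\<rfloor> + 1) * t / real n) p)"
    if "0 \<le> s" "s < t" "n > 0" for n s
  proof -
    define m where "m = nat \<lfloor>s * real n / t\<rfloor>"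
    have m: "real m = real_of_int \<lfloor>s * real n / t\<rfloor>" using that t by (simp add: m_def)
    have m1: "real m \<le> s * real n / t" "s * real n / t < real m + 1" by (auto simp: m)
    have "s * real n / t < real n" using that t by (simp add: field_simps)
    with m1 have "m < n" by linarith
    have "s \<in> {real (k - 1) * t / real n ..< real k * t / real n} \<longleftrightarrow> k = m + 1"
      if "k \<in> {1..n}" for k
    proof -
      have "s \<in> {real (k - 1) * t / real n ..< real k * t / real n}
          \<longleftrightarrow> real (k - 1) \<le> s * real n / t \<and> s * real n / t < real k"
        using t \<open>n > 0\<close> by (simp add: field_simps)
      also have "\<dots> \<longleftrightarrow> k = m + 1"
      proof
        assume "real (k - 1) \<le> s * real n / t \<and> s * real n / t < real k"
        with m1 have "real (k - 1) < real (m + 1)" "real m < real k" by linarith+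
        then show "k = m + 1" by simp
      qed (use m1 in auto)
      finally show ?thesis .
    qed
    then have "u n s = (\<Sum>k=1..n. if k = m + 1 then f (X (real (m + 1) * t / real n) p) else 0)"
      unfolding u_def by (intro sum.cong) (auto simp: indicator_def)
    also have "\<dots> = f (X (real (m + 1) * t / real n) p)" using \<open>m < n\<close> by simp
    finally show ?thesis by (simp add: m add.commute)
  qed
  define v where "v s = indicator {0..<t} s * f (X s p)" for s
  have lim: "(\<lambda>n. indicator {0..<t} s * u n s) \<longlonglongrightarrow> v s" for s
  proof (cases "0 \<le> s \<and> s < t")
    case True
    define r where "r n = (real_of_int \<lfloor>s * real n / t\<rfloor> + 1) * t / real n" for n
    have r: "s < r n" "r n \<le> s + t / real n" if "n > 0" for n
    proof -
      have "s * real n / t < real_of_int \<lfloor>s * real n / t\<rfloor> + 1" by simp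
      then show "s < r n" using t that by (simp add: r_def field_simps)
      have "real_of_int \<lfloor>s * real n / t\<rfloor> + 1 \<le> s * real n / t + 1" by simp
      then have "r n \<le> (s * real n / t + 1) * t / real n"
        unfolding r_def using t that by (intro divide_right_mono mult_right_mono) auto
      also have "\<dots> = s + t / real n" using t that by (simp add: field_simps)
      finally show "r n \<le> s + t / real n" .
    qed
    have "r \<longlonglongrightarrow> s"
    proof (rule tendsto_sandwich[of "\<lambda>_. s" _ _ "\<lambda>n. s + t / real n"])
      show "\<forall>\<^sub>F n in sequentially. s \<le> r n"
        using eventually_gt_at_top[of 0] by eventually_elim (use r in \<open>auto intro: less_imp_le\<close>)
      show "\<forall>\<^sub>F n in sequentially. r n \<le> s + t / real n"
        using eventually_gt_at_top[of 0] by eventually_elim (use r in auto)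
      have "(\<lambda>n. s + t / real n) \<longlonglongrightarrow> s + 0"
        by (intro tendsto_add tendsto_const lim_const_over_n)
      then show "(\<lambda>n. s + t / real n) \<longlonglongrightarrow> s" by simp
    qed simp
    \<comment> \<open>The filter \<open>at_right s\<close> excludes s, hence the strict inequality;
      the cells, closed on the left and open on the right, provide it.\<close>
    moreover have "\<forall>\<^sub>F n in sequentially. r n > s"
      using eventually_gt_at_top[of 0] by eventually_elim (use r in auto)
    ultimately have "filterlim r (at_right s) sequentially"
      by (auto simp: filterlim_at elim: eventually_mono)
    with X_right_continuous[of s p] True p
    have "\<forall>\<^sub>F n in sequentially. X (r n) p = X s p" by (auto simp: filterlim_iff)
    then have "\<forall>\<^sub>F n in sequentially. indicator {0..<t} s * u n s = v s"
      using eventually_gt_at_top[of 0] by eventually_elim (use True in \<open>simp add: cell r_def v_def\<close>)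
    then show ?thesis by (rule tendsto_eventually)
  qed (simp add: v_def)
  have bound: "\<bar>indicator {0..<t} s * u n s\<bar> \<le> indicator {0..<t} s * f_bound f" for n s
  proof (cases "0 \<le> s \<and> s < t \<and> n > 0")
    case True
    have "real_of_int \<lfloor>s * real n / t\<rfloor> \<ge> 0" using True t by simp
    then show ?thesis using True t p by (auto simp: cell intro!: f_bound divide_nonneg_nonneg mult_nonneg_nonneg)
  qed (auto simp: u_def f_bound_nonneg split: split_indicator)
  have u_meas: "(\<lambda>s. indicator {0..<t} s * u n s) \<in> borel_measurable lborel" for n
    unfolding u_def by measurable
  \<comment> \<open>The path is a pointwise limit of step functions, hence measurable in s; no joint
    measurability in s and p enters.\<close>
  have v_meas: "v \<in> borel_measurable lborel"
    by (rule borel_measurable_LIMSEQ_real[OF lim]) (rule u_meas)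
  have dom: "integrable lborel (\<lambda>s. indicator {0..<t} s * f_bound f)"
    using t by (intro integrable_mult_left integrable_real_indicator) auto
  have conv: "(\<lambda>n. \<integral>s. indicator {0..<t} s * u n s \<partial>lborel) \<longlonglongrightarrow> (\<integral>s. v s \<partial>lborel)"
    by (rule integral_dominated_convergence[OF v_meas u_meas dom]) (use lim bound in auto)
  have "(LBINT s:{0..t}. f (X s p)) = (LBINT s:{0..<t}. f (X s p))"
    unfolding set_lebesgue_integral_def
    by (rule integral_discrete_difference[of "{t}"]) (auto split: split_indicator)
  then have int: "(LBINT s:{0..t}. f (X s p)) = (\<integral>s. v s \<partial>lborel)"
    by (simp add: set_lebesgue_integral_def v_def)
  have int_u: "(\<integral>s. indicator {0..<t} s * u n s \<partial>lborel) = riemann f t n p" for n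
  proof (cases "n = 0")
    case False
    have sub: "indicator {0..<t} s * u n s = u n s" for s
    proof (cases "0 \<le> s \<and> s < t")
      case F: False
      have "s \<notin> {real (k - 1) * t / real n ..< real k * t / real n}" if "k \<in> {1..n}" for k
      proof -
        have "0 \<le> real (k - 1) * t / real n"
          using t by (intro divide_nonneg_nonneg mult_nonneg_nonneg) auto
        moreover have "real k * t / real n \<le> t" using that t False by (simp add: field_simps)
        ultimately show ?thesis using F by (simp only: atLeastLessThan_iff) linarith
      qed
      then have "u n s = 0" unfolding u_def by (intro sum.neutral) (auto simp: indicator_def)
        then show ?thesis by simp
    qed auto
    have len': "(real k - 1) * t / real n \<le> real k * t / real n" for k
      using t by (intro divide_right_mono mult_right_mono) auto
    have len: "real (k - 1) * t / real n \<le> real k * t / real n" for k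
      using t by (intro divide_right_mono mult_right_mono) auto
    have "(\<integral>s. u n s \<partial>lborel) = (\<Sum>k=1..n. f (X (real k * t / real n) p) *
        measure lborel {real (k - 1) * t / real n ..< real k * t / real n})"
      unfolding u_def
      by (subst Bochner_Integration.integral_sum)
        (auto intro!: integrable_mult_right integrable_real_indicator simp: len')
    also have "\<dots> = (\<Sum>k=1..n. f (X (real k * t / real n) p) * (t / real n))"
    proof (intro sum.cong refl arg_cong2[where f = "(*)"])
      fix k assume "k \<in> {1..n}"
      then have "real k * t / real n - real (k - 1) * t / real n = t / real n"
        by (simp add: of_nat_diff diff_divide_distrib[symmetric] left_diff_distrib)
      with len[of k]
      show "measure lborel {real (k - 1) * t / real n ..< real k * t / real n} = t / real n"
        by simp
    qed
    also have "\<dots> = riemann f t n p" by (simp add: riemann_def sum_distrib_left mult_ac)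
    finally show ?thesis by (simp add: sub)
  qed (simp add: riemann_def u_def)
  show "(\<lambda>n. riemann f t n p) \<longlonglongrightarrow> (LBINT s:{0..t}. f (X s p))"
    using conv by (simp add: int int_u)
  have "norm (\<integral>s. v s \<partial>lborel) \<le> (\<integral>s. indicator {0..<t} s * f_bound f \<partial>lborel)"
  proof (rule Bochner_Integration.integral_norm_bound_integral)
    show "integrable lborel v"
      by (rule Bochner_Integration.integrable_bound[OF dom v_meas])
        (use p f_bound f_bound_nonneg in \<open>auto simp: v_def split: split_indicator\<close>)
    show "integrable lborel (\<lambda>s. indicator {0..<t} s * f_bound f)" by (rule dom)
    show "norm (v s) \<le> indicator {0..<t} s * f_bound f" for s
      using p f_bound by (auto simp: v_def split: split_indicator)
  qed
  also have "\<dots> = t * f_bound f" using t by simp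
  finally show "\<bar>LBINT s:{0..t}. f (X s p)\<bar> \<le> t * f_bound f" by (simp add: int)
qed

section \<open>Second moments of time integrals\<close>

definition J :: "real \<Rightarrow> ('s \<Rightarrow> real) \<Rightarrow> real" where
  "J t f = (\<integral>p. (LBINT s:{0..t}. f (X s p))\<^sup>2 \<partial>P)"

lemma riemann_measurable [measurable]: "t \<ge> 0 \<Longrightarrow> riemann f t n \<in> borel_measurable P"
  unfolding riemann_def[abs_def] by (intro borel_measurable_times borel_measurable_sum fX_measurable) auto

lemma time_integral_measurable:
  fixes f :: "'s \<Rightarrow> real"
  shows "t > 0 \<Longrightarrow> (\<lambda>p. LBINT s:{0..t}. f (X s p)) \<in> borel_measurable P"
  by (rule borel_measurable_LIMSEQ_real[where u = "riemann f t"]) (auto simp: riemann_tendsto)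

lemma time_integral_square_integrable:
  fixes f :: "'s \<Rightarrow> real"
  assumes "t > 0"
  shows "integrable P (\<lambda>p. (LBINT s:{0..t}. f (X s p))\<^sup>2)"
proof (rule integrable_const_bound[where B = "(t * f_bound f)\<^sup>2"])
  show "AE p in P. norm ((LBINT s:{0..t}. f (X s p))\<^sup>2) \<le> (t * f_bound f)\<^sup>2"
  proof (intro AE_I2)
    fix p assume "p \<in> space P"
    from power_mono[OF riemann_tendsto(2)[OF assms this, of f], of 2]
    show "norm ((LBINT s:{0..t}. f (X s p))\<^sup>2) \<le> (t * f_bound f)\<^sup>2" by simp
  qed
qed (use time_integral_measurable[OF assms] in measurable)

lemma riemann_bound:
  assumes "t \<ge> 0" "p \<in> space P"
  shows "\<bar>riemann f t n p\<bar> \<le> t * f_bound f"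
proof -
  have "\<bar>\<Sum>k=1..n. f (X (real k * t / real n) p)\<bar> \<le> real n * f_bound f"
    using sum_norm_bound[of "{1..n}" "\<lambda>k. f (X (real k * t / real n) p)" "f_bound f"] assms f_bound
    by auto
  then have "t / real n * \<bar>\<Sum>k=1..n. f (X (real k * t / real n) p)\<bar> \<le> t / real n * (real n * f_bound f)"
    using assms by (intro mult_left_mono) auto
  also have "\<dots> \<le> t * f_bound f" using assms f_bound_nonneg by simp
  finally show ?thesis using assms by (simp add: riemann_def abs_mult)
qed

text \<open>The square of a Riemann sum involves two-time correlations only, and dominated
  convergence under P then replaces an exchange of the time integrals with the expectation.\<close>

lemma J_limit:
  assumes t: "t > 0"
  shows "(\<lambda>n. (t / real n)\<^sup>2 * (\<Sum>k=1..n. \<Sum>l=1..n. ip f (semi (\<bar>real k - real l\<bar> * t / real n) f)))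
    \<longlonglongrightarrow> J t f"
proof -
  have "(\<lambda>n. \<integral>p. (riemann f t n p)\<^sup>2 \<partial>P) \<longlonglongrightarrow> J t f"
    unfolding J_def
  proof (rule integral_dominated_convergence[where w = "\<lambda>_. (t * f_bound f)\<^sup>2"])
    show "(\<lambda>p. (LBINT s:{0..t}. f (X s p))\<^sup>2) \<in> borel_measurable P"
      using time_integral_measurable[OF t] by measurable
    show "(\<lambda>p. (riemann f t n p)\<^sup>2) \<in> borel_measurable P" for n
      using riemann_measurable[of t f n] t by (intro borel_measurable_power) simp
    show "AE p in P. (\<lambda>n. (riemann f t n p)\<^sup>2) \<longlonglongrightarrow> (LBINT s:{0..t}. f (X s p))\<^sup>2"
      using riemann_tendsto(1)[OF t] by (auto intro!: tendsto_power)
    show "AE p in P. norm ((riemann f t n p)\<^sup>2) \<le> (t * f_bound f)\<^sup>2" for n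
      using t power_mono[OF riemann_bound, of t _ f n 2] by (intro AE_I2) auto
  qed simp
  moreover have "(\<integral>p. (riemann f t n p)\<^sup>2 \<partial>P)
      = (t / real n)\<^sup>2 * (\<Sum>k=1..n. \<Sum>l=1..n. ip f (semi (\<bar>real k - real l\<bar> * t / real n) f))" for n
  proof -
    have int: "integrable P (\<lambda>p. f (X r p) * f (X s p))" if "r \<ge> 0" "s \<ge> 0" for r s
    proof (rule integrable_const_bound)
      show "AE p in P. norm (f (X r p) * f (X s p)) \<le> f_bound f * f_bound f"
        using that f_bound by (intro AE_I2) (auto simp: abs_mult intro!: mult_mono f_bound_nonneg)
    qed (use that in measurable)
    have two: "(\<integral>p. f (X (real k * t / real n) p) * f (X (real l * t / real n) p) \<partial>P)
        = ip f (semi (\<bar>real k - real l\<bar> * t / real n) f)" for k l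
    proof (cases "k \<le> l")
      case True
      then have "real k * t / real n \<le> real l * t / real n"
        using t by (intro divide_right_mono mult_right_mono) auto
      from two_time[OF _ this, of f f] show ?thesis using t True
        by (simp add: diff_divide_distrib left_diff_distrib)
    next
      case False
      then have "real l * t / real n \<le> real k * t / real n"
        using t by (intro divide_right_mono mult_right_mono) auto
      from two_time[OF _ this, of f f] show ?thesis using t False
        by (simp add: diff_divide_distrib left_diff_distrib right_diff_distrib mult.commute)
    qed
    have "(riemann f t n p)\<^sup>2 = (t / real n)\<^sup>2 *
        (\<Sum>k=1..n. \<Sum>l=1..n. f (X (real k * t / real n) p) * f (X (real l * t / real n) p))" for p
      unfolding riemann_def power_mult_distrib by (simp only: power2_eq_square sum_product)
    then show ?thesis
      using t by (simp add: two int Bochner_Integration.integral_sum Bochner_Integration.integrable_sum)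
  qed
  ultimately show ?thesis by simp
qed

text \<open>No correlation exceeds the one at time 0. The bound ignores the dynamics, so it serves
  for terms whose stationary variance is already small.\<close>

lemma J_le_static:
  assumes t: "t > 0" shows "J t f \<le> t\<^sup>2 * ip f f"
proof (rule LIMSEQ_le_const2[OF J_limit[OF t]], intro exI allI impI)
  fix n :: nat assume "n \<ge> 1"
  have "(\<Sum>k=1..n. \<Sum>l=1..n. ip f (semi (\<bar>real k - real l\<bar> * t / real n) f))
      \<le> (\<Sum>k=1..n. \<Sum>l=1..n. ip f f)"
    using t corr_antimono[of 0 _ f] by (intro sum_mono) simp
  also have "\<dots> = (real n)\<^sup>2 * ip f f" by (simp add: power2_eq_square)
  finally have "(t / real n)\<^sup>2 * (\<Sum>k=1..n. \<Sum>l=1..n. ip f (semi (\<bar>real k - real l\<bar> * t / real n) f))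
      \<le> (t / real n)\<^sup>2 * ((real n)\<^sup>2 * ip f f)"
    by (intro mult_left_mono) auto
  also have "\<dots> = t\<^sup>2 * ip f f" using \<open>n \<ge> 1\<close> by (simp add: power2_eq_square)
  finally show "(t / real n)\<^sup>2 * (\<Sum>k=1..n. \<Sum>l=1..n. ip f (semi (\<bar>real k - real l\<bar> * t / real n) f))
    \<le> t\<^sup>2 * ip f f" .
qed

text \<open>The hypothesis says that K dominates the squared \<open>H_{-1}\<close> norm of f in its
  variational form. The double time integral of the correlations is at most 2t times their single
  time integral, which \<open>int_corr_le\<close> bounds by K.\<close>

lemma J_le_dual:
  assumes K: "\<And>\<psi>. (ip f \<psi>)\<^sup>2 \<le> K * (- ip \<psi> (A \<psi>))" "K \<ge> 0" and t: "t > 0"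
  shows "J t f \<le> 2 * t * K"
proof -
  define q where "q r = ip f (semi r f)" for r
  have q0: "q r \<ge> 0" for r by (simp add: q_def corr_nonneg)
  have mono: "q s \<le> q r" if "r \<le> s" for r s using that by (simp add: q_def corr_antimono)
  \<comment> \<open>In row k the lags on either side of the diagonal lie among 1, ..., n, whence the
    diagonal term q 0 and twice the sum over all lags.\<close>
  have step: "(\<Sum>k=1..n. \<Sum>l=1..n. q (\<bar>real k - real l\<bar> * t / real n))
      \<le> real n * (q 0 + 2 * (\<Sum>m=1..n. q (real m * t / real n)))" for n
  proof -
    define a where "a m = q (real m * t / real n)" for m :: nat
    have "(\<Sum>l=1..n. q (\<bar>real k - real l\<bar> * t / real n)) \<le> q 0 + 2 * (\<Sum>m=1..n. a m)"
      if k: "k \<in> {1..n}" for k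
    proof -
      have "(\<Sum>l=1..n. q (\<bar>real k - real l\<bar> * t / real n))
          = (\<Sum>l\<in>{1..<k} \<union> {k} \<union> {k<..n}. q (\<bar>real k - real l\<bar> * t / real n))"
        using k by (intro sum.cong) auto
      also have "\<dots> = (\<Sum>l\<in>{1..<k}. q (\<bar>real k - real l\<bar> * t / real n)) + q 0
          + (\<Sum>l\<in>{k<..n}. q (\<bar>real k - real l\<bar> * t / real n))"
        by (subst sum.union_disjoint; (subst sum.union_disjoint)?) auto
      also have "(\<Sum>l\<in>{1..<k}. q (\<bar>real k - real l\<bar> * t / real n)) = (\<Sum>m\<in>{1..<k}. a m)"
        by (rule sum.reindex_bij_witness[of _ "\<lambda>m. k - m" "\<lambda>m. k - m"])
          (auto simp: a_def of_nat_diff)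
      also have "(\<Sum>l\<in>{k<..n}. q (\<bar>real k - real l\<bar> * t / real n)) = (\<Sum>m\<in>{1..n-k}. a m)"
        by (rule sum.reindex_bij_witness[of _ "\<lambda>m. m + k" "\<lambda>m. m - k"])
          (auto simp: a_def of_nat_diff)
      finally have eq: "(\<Sum>l=1..n. q (\<bar>real k - real l\<bar> * t / real n))
        = (\<Sum>m\<in>{1..<k}. a m) + q 0 + (\<Sum>m\<in>{1..n-k}. a m)" .
      have "(\<Sum>m\<in>{1..<k}. a m) \<le> (\<Sum>m=1..n. a m)" "(\<Sum>m\<in>{1..n-k}. a m) \<le> (\<Sum>m=1..n. a m)"
        using k q0 by (auto intro!: sum_mono2 simp: a_def)
      with eq show ?thesis by linarith
    qed
    then have "(\<Sum>k=1..n. \<Sum>l=1..n. q (\<bar>real k - real l\<bar> * t / real n))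
      \<le> (\<Sum>k=1..n. q 0 + 2 * (\<Sum>m=1..n. a m))" by (intro sum_mono)
    then show ?thesis by (simp add: a_def)
  qed
  \<comment> \<open>As q is decreasing, its Riemann sum at right end points stays below its
    integral; the mean value theorem shows this cell by cell for the primitive Q.\<close>
  have riem: "t / real n * (\<Sum>m=1..n. q (real m * t / real n)) \<le> K" if n: "n \<ge> 1" for n
  proof -
    define Q where "Q r = ip f (int_semi r f)" for r
    have Qd: "(Q has_real_derivative q r) (at r)" for r
      unfolding Q_def[abs_def] q_def by (rule ip_int_semi_deriv)
    have "t / real n * q (real (Suc m) * t / real n) \<le> Q (real (Suc m) * t / real n) - Q (real m * t / real n)" for m
    proof -
      have "real m * t / real n < real (Suc m) * t / real n"
        using t n by (intro divide_strict_right_mono mult_strict_right_mono) auto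
      from MVT2[OF this, of Q q] Qd obtain z where z: "real m * t / real n < z" "z < real (Suc m) * t / real n"
        "Q (real (Suc m) * t / real n) - Q (real m * t / real n)
          = (real (Suc m) * t / real n - real m * t / real n) * q z" by auto
      have "real (Suc m) * t / real n - real m * t / real n = t / real n"
        by (simp add: diff_divide_distrib[symmetric] algebra_simps)
      with z show ?thesis using mono[of z "real (Suc m) * t / real n"] t
        by (auto intro!: mult_left_mono divide_right_mono)
    qed
    then have "(\<Sum>m<n. t / real n * q (real (Suc m) * t / real n))
        \<le> (\<Sum>m<n. Q (real (Suc m) * t / real n) - Q (real m * t / real n))" by (intro sum_mono)
    also have "\<dots> = Q (real n * t / real n) - Q (real 0 * t / real n)"
      by (rule sum_lessThan_telescope)
    also have "\<dots> = Q t" using n by (simp add: Q_def ip_def)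
    also have "\<dots> \<le> K" unfolding Q_def using K t by (intro int_corr_le) auto
    finally have "(\<Sum>m<n. t / real n * q (real (Suc m) * t / real n)) \<le> K" .
    moreover have "(\<Sum>m=1..n. q (real m * t / real n)) = (\<Sum>m<n. q (real (Suc m) * t / real n))"
      by (rule sum.reindex_bij_witness[of _ Suc "\<lambda>m. m - 1"]) auto
    ultimately show ?thesis by (simp add: sum_distrib_left)
  qed
  \<comment> \<open>The first summand is the contribution of the diagonal, which disappears as the
    mesh is refined.\<close>
  have "(\<lambda>n. t * (t * q 0 / real n) + 2 * t * K) \<longlonglongrightarrow> t * 0 + 2 * t * K"
    by (intro tendsto_intros lim_const_over_n)
  moreover have "(t / real n)\<^sup>2 * (\<Sum>k=1..n. \<Sum>l=1..n. q (\<bar>real k - real l\<bar> * t / real n))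
      \<le> t * (t * q 0 / real n) + 2 * t * K" if n: "n \<ge> 1" for n
  proof -
    have "(t / real n)\<^sup>2 * (\<Sum>k=1..n. \<Sum>l=1..n. q (\<bar>real k - real l\<bar> * t / real n))
        \<le> (t / real n)\<^sup>2 * (real n * (q 0 + 2 * (\<Sum>m=1..n. q (real m * t / real n))))"
      by (intro mult_left_mono step) auto
    also have "\<dots> = t * (t * q 0 / real n) + 2 * t * (t / real n * (\<Sum>m=1..n. q (real m * t / real n)))"
      using n by (simp add: power2_eq_square distrib_left)
    also have "\<dots> \<le> t * (t * q 0 / real n) + 2 * t * K"
      using riem[OF n] t by (intro add_left_mono mult_left_mono) auto
    finally show ?thesis .
  qed
  ultimately show ?thesis
    using J_limit[OF t, of f]
    by (intro LIMSEQ_le[where X = "\<lambda>n. (t / real n)\<^sup>2 * (\<Sum>k=1..n. \<Sum>l=1..n. q (\<bar>real k - real l\<bar> * t / real n))"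
      and Y = "\<lambda>n. t * (t * q 0 / real n) + 2 * t * K"]) (auto simp: q_def)
qed

text \<open>Riemann sums are additive and converge for every path, so additivity passes to the limit
  without a discussion of integrability in s.\<close>

lemma time_integral_add:
  fixes f g :: "'s \<Rightarrow> real"
  assumes "t > 0" "p \<in> space P"
  shows "(LBINT s:{0..t}. f (X s p) + g (X s p)) = (LBINT s:{0..t}. f (X s p)) + (LBINT s:{0..t}. g (X s p))"
proof -
  have "(\<lambda>n. riemann (\<lambda>\<eta>. f \<eta> + g \<eta>) t n p) \<longlonglongrightarrow>
      (LBINT s:{0..t}. f (X s p)) + (LBINT s:{0..t}. g (X s p))"
    using tendsto_add[OF riemann_tendsto(1)[OF assms, of f] riemann_tendsto(1)[OF assms, of g]]
    by (simp add: riemann_def sum.distrib distrib_left)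
  with riemann_tendsto(1)[OF assms, of "\<lambda>\<eta>. f \<eta> + g \<eta>"] show ?thesis by (rule LIMSEQ_unique)
qed

lemma J_add:
  assumes t: "t > 0"
  shows "J t (\<lambda>\<eta>. f \<eta> + g \<eta>) \<le> 2 * J t f + 2 * J t g"
proof -
  have "J t (\<lambda>\<eta>. f \<eta> + g \<eta>)
      \<le> (\<integral>p. 2 * (LBINT s:{0..t}. f (X s p))\<^sup>2 + 2 * (LBINT s:{0..t}. g (X s p))\<^sup>2 \<partial>P)"
    unfolding J_def
  proof (rule integral_mono)
    fix p assume "p \<in> space P"
    define x y where "x = (LBINT s:{0..t}. f (X s p))" and "y = (LBINT s:{0..t}. g (X s p))"
    have "(x + y)\<^sup>2 \<le> 2 * x\<^sup>2 + 2 * y\<^sup>2"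
      using zero_le_power2[of "x - y"] by (simp add: power2_eq_square algebra_simps)
    with t \<open>p \<in> space P\<close>
    show "(LBINT s:{0..t}. f (X s p) + g (X s p))\<^sup>2
      \<le> 2 * (LBINT s:{0..t}. f (X s p))\<^sup>2 + 2 * (LBINT s:{0..t}. g (X s p))\<^sup>2"
      by (simp add: time_integral_add x_def y_def)
  qed (use t time_integral_square_integrable[OF t] in
      \<open>auto intro!: Bochner_Integration.integrable_add\<close>)
  also have "\<dots> = 2 * J t f + 2 * J t g"
    using t time_integral_square_integrable by (simp add: J_def)
  finally show ?thesis .
qed

lemma J_cong:
  assumes "\<And>\<eta>. \<eta> \<in> S \<Longrightarrow> f \<eta> = g \<eta>"
  shows "J t f = J t g"
  unfolding J_def set_lebesgue_integral_def
  by (intro Bochner_Integration.integral_cong refl arg_cong[where f = "\<lambda>x. x\<^sup>2"])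
    (auto simp: assms X_in_S split: split_indicator)

lemma J_nonneg: "J t f \<ge> 0"
  by (simp add: J_def)

end

section \<open>Maximal inequality and mean ergodic theorem for \<open>\<int>\<^sup>d\<close>-actions\<close>

lemma bij_vec_box:
  "bij_betw (\<lambda>f. \<chi> k. f k) (PiE UNIV S) {x :: int ^ 'd::finite. \<forall>k. x $ k \<in> S k}"
  by (rule bij_betw_byWitness[where f' = "\<lambda>x k. x $ k"]) auto

lemma card_vec_box: "card {x :: int ^ 'd::finite. \<forall>k. x $ k \<in> S k} = (\<Prod>k\<in>UNIV. card (S k))"
  using bij_betw_same_card[OF bij_vec_box[of S]] by (simp add: card_PiE)

lemma finite_vec_box:
  assumes "\<And>k. finite (S k)"
  shows "finite {x :: int ^ 'd::finite. \<forall>k. x $ k \<in> S k}"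
  using bij_betw_finite[OF bij_vec_box[of S]] assms by (simp add: finite_PiE)

lemma sites_eq: "sites N = {x :: int ^ 'd::finite. \<forall>k. x $ k \<in> {0..<int N}}"
  by (auto simp: sites_def)

lemma finite_sites [simp, intro]: "finite (sites N :: (int ^ 'd::finite) set)"
  unfolding sites_eq by (rule finite_vec_box) auto

lemma card_sites [simp]: "card (sites N :: (int ^ 'd::finite) set) = N ^ CARD('d)"
  unfolding sites_eq card_vec_box by simp

text \<open>Vitali's selection: keep a largest cube and discard all cubes whose corner is so close that they
  might meet it.\<close>

lemma cube_covering:
  fixes F :: "int ^ 'd::finite \<Rightarrow> real" and n :: "int ^ 'd \<Rightarrow> nat"
  assumes "finite E" "\<And>x. F x \<ge> 0" "c \<ge> 0"
    and "\<And>x. x \<in> E \<Longrightarrow> c * real (n x) ^ CARD('d) \<le> (\<Sum>y\<in>sites (n x). F (x + y))"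
    and "\<And>x. x \<in> E \<Longrightarrow> n x > 0"
  shows "c * real (card E) \<le> 2 ^ CARD('d) * (\<Sum>z\<in>(\<Union>x\<in>E. (+) x ` sites (n x)). F z)"
  using assms(1,4,5)
proof (induction "card E" arbitrary: E rule: less_induct)
  case less
  let ?d = "CARD('d)"
  show ?case
  proof (cases "E = {}")
    case False
    have "Max (n ` E) \<in> n ` E" using less.prems(1) False by (intro Max_in) auto
    then obtain x0 where "x0 \<in> E" "n x0 = Max (n ` E)" by (metis imageE)
    then have x0: "x0 \<in> E" "\<And>x. x \<in> E \<Longrightarrow> n x \<le> n x0" using less.prems(1) by auto
    \<comment> \<open>Corners that differ from x0 by at least n x0 in some coordinate survive. As no
      cube is larger than that of x0, their cubes are disjoint from it.\<close>
    define E' where "E' = {x \<in> E. \<exists>k. \<bar>x $ k - x0 $ k\<bar> \<ge> int (n x0)}"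
    have fin: "finite E'" using less.prems(1) by (simp add: E'_def)
    have "x0 \<notin> E'" using less.prems(3)[OF x0(1)] by (simp add: E'_def)
    moreover have "E' \<subseteq> E" by (auto simp: E'_def)
    ultimately have "E' \<subset> E" using x0(1) by blast
    then have "card E' < card E" using less.prems(1) by (rule psubset_card_mono[rotated])
    then have IH: "c * real (card E') \<le> 2 ^ ?d * (\<Sum>z\<in>(\<Union>x\<in>E'. (+) x ` sites (n x)). F z)"
      by (rule less.hyps) (use fin less.prems in \<open>auto simp: E'_def\<close>)
    \<comment> \<open>The discarded corners lie in a box with 2 n x0 - 1 lattice points per side;
      this is the origin of the factor 2^d.\<close>
    have "E - E' \<subseteq> {x. \<forall>k. x $ k \<in> {x0 $ k - int (n x0)<..<x0 $ k + int (n x0)}}"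
    proof
      fix x assume "x \<in> E - E'"
      then have "\<bar>x $ k - x0 $ k\<bar> < int (n x0)" for k by (auto simp: E'_def not_le)
      then have "x $ k \<in> {x0 $ k - int (n x0)<..<x0 $ k + int (n x0)}" for k
        by (smt (verit) greaterThanLessThan_iff)
      then show "x \<in> {x. \<forall>k. x $ k \<in> {x0 $ k - int (n x0)<..<x0 $ k + int (n x0)}}" by simp
    qed
    then have "card (E - E') \<le> card {x. \<forall>k. x $ k \<in> {x0 $ k - int (n x0)<..<x0 $ k + int (n x0)}}"
      by (intro card_mono finite_vec_box) auto
    also have "\<dots> = (2 * n x0 - 1) ^ ?d"
    proof -
      have "card {x0 $ k - int (n x0)<..<x0 $ k + int (n x0)} = 2 * n x0 - 1" for k
        unfolding card_greaterThanLessThan_int by linarith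
      then show ?thesis unfolding card_vec_box by simp
    qed
    also have "\<dots> \<le> (2 * n x0) ^ ?d" by (intro power_mono) auto
    finally have "real (card (E - E')) \<le> real ((2 * n x0) ^ ?d)" by (simp only: of_nat_le_iff)
    then have "c * real (card (E - E')) \<le> c * (2 ^ ?d * real (n x0) ^ ?d)"
      using assms(3) by (intro mult_left_mono) (auto simp: power_mult_distrib)
    also have "\<dots> \<le> 2 ^ ?d * (\<Sum>y\<in>sites (n x0). F (x0 + y))"
      using less.prems(2)[OF x0(1)] by simp
    also have "(\<Sum>y\<in>sites (n x0). F (x0 + y)) = (\<Sum>z\<in>(+) x0 ` sites (n x0). F z)"
      by (subst sum.reindex) auto
    finally have 1: "c * real (card (E - E')) \<le> 2 ^ ?d * (\<Sum>z\<in>(+) x0 ` sites (n x0). F z)" .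
    have disj: "(+) x0 ` sites (n x0) \<inter> (\<Union>x\<in>E'. (+) x ` sites (n x)) = {}"
    proof (rule ccontr)
      assume "\<not> ?thesis"
      then obtain x y y0 where *: "x \<in> E'" "y \<in> sites (n x)" "y0 \<in> sites (n x0)" "x0 + y0 = x + y" by auto
      from \<open>x \<in> E'\<close> obtain k where k: "\<bar>x $ k - x0 $ k\<bar> \<ge> int (n x0)" "x \<in> E" by (auto simp: E'_def)
      have "x0 $ k + y0 $ k = x $ k + y $ k" using *(4) by (metis vector_add_component)
      moreover have "0 \<le> y $ k" "y $ k < int (n x)" "0 \<le> y0 $ k" "y0 $ k < int (n x0)"
        using *(2,3) by (auto simp: sites_def)
      moreover have "int (n x) \<le> int (n x0)" using x0(2)[OF k(2)] by simp
      ultimately show False using k(1) by linarith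
    qed
    have "card E = card (E - E') + card E'"
      using less.prems(1) \<open>E' \<subset> E\<close> by (simp add: card_Diff_subset fin psubset_imp_subset card_mono)
    then have "c * real (card E) = c * real (card (E - E')) + c * real (card E')"
      by (simp add: distrib_left)
    also have "\<dots> \<le> 2 ^ ?d * ((\<Sum>z\<in>(+) x0 ` sites (n x0). F z) + (\<Sum>z\<in>(\<Union>x\<in>E'. (+) x ` sites (n x)). F z))"
      using 1 IH by (simp add: distrib_left)
    also have "(\<Sum>z\<in>(+) x0 ` sites (n x0). F z) + (\<Sum>z\<in>(\<Union>x\<in>E'. (+) x ` sites (n x)). F z)
      = (\<Sum>z\<in>(+) x0 ` sites (n x0) \<union> (\<Union>x\<in>E'. (+) x ` sites (n x)). F z)"
      using disj fin by (subst sum.union_disjoint) auto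
    also have "\<dots> \<le> (\<Sum>z\<in>(\<Union>x\<in>E. (+) x ` sites (n x)). F z)"
      using assms(2) x0(1) less.prems(1) by (intro sum_mono2) (auto simp: E'_def)
    finally show ?thesis by simp
  qed simp
qed

text \<open>A replacement for the completeness of L^2: sequences with geometrically small increments
  converge almost everywhere, so that limits are actual measurable functions.\<close>

lemma AE_summable_L2:
  fixes g :: "nat \<Rightarrow> 'a \<Rightarrow> real"
  assumes "prob_space M" and [measurable]: "\<And>n. g n \<in> borel_measurable M"
    and b: "\<And>n x. x \<in> space M \<Longrightarrow> \<bar>g n x\<bar> \<le> C"
    and g: "\<And>n. (\<integral>x. (g n x)\<^sup>2 \<partial>M) \<le> 4 / 4 ^ n"
  shows "AE x in M. summable (\<lambda>n. \<bar>g n x\<bar>)"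
proof -
  interpret prob_space M by fact
  have int: "integrable M (\<lambda>x. \<bar>g n x\<bar>)" for n
    by (rule integrable_const_bound[where B = C]) (use b in auto)
  have int2: "integrable M (\<lambda>x. (g n x)\<^sup>2)" for n
  proof (rule integrable_const_bound[where B = "C\<^sup>2"])
    show "AE x in M. norm ((g n x)\<^sup>2) \<le> C\<^sup>2"
      using power_mono[OF b, of _ n 2] by (intro AE_I2) auto
  qed auto
  have le: "(\<integral>x. \<bar>g n x\<bar> \<partial>M) \<le> 3 * (1/2) ^ n" for n
  proof -
    \<comment> \<open>Young's inequality with weight 2^n, matched to an L^2 norm of at most 2 / 2^n;
      both terms become of order 2^-n.\<close>
    have "(\<integral>x. \<bar>g n x\<bar> \<partial>M) \<le> (\<integral>x. (1/2)^n / 2 + 2^n / 2 * (g n x)\<^sup>2 \<partial>M)"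
    proof (rule integral_mono)
      show "integrable M (\<lambda>x. (1/2)^n / 2 + 2^n / 2 * (g n x)\<^sup>2)"
        by (intro Bochner_Integration.integrable_add integrable_mult_right int2) auto
      fix x
      define p y where "p = (2::real) ^ n" and "y = \<bar>g n x\<bar>"
      have p: "p > 0" "(1/2) ^ n = 1 / p" by (auto simp: p_def power_divide)
      have "0 \<le> (p * y - 1)\<^sup>2 / (2 * p)" using p by simp
      also have "(p * y - 1)\<^sup>2 / (2 * p) = 1 / p / 2 + p / 2 * y\<^sup>2 - y"
        using p by (simp add: field_simps power2_eq_square)
      finally show "\<bar>g n x\<bar> \<le> (1/2)^n / 2 + 2^n / 2 * (g n x)\<^sup>2"
        unfolding p(2) p_def[symmetric] by (simp add: y_def)
    qed (rule int)
    also have "\<dots> = (1/2)^n / 2 + 2^n / 2 * (\<integral>x. (g n x)\<^sup>2 \<partial>M)"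
      using int2 by (subst Bochner_Integration.integral_add) (auto simp: prob_space)
    also have "\<dots> \<le> (1/2)^n / 2 + 2^n / 2 * (4 / 4^n)"
      using g by (intro add_left_mono mult_left_mono) auto
    also have "\<dots> \<le> 3 * (1/2) ^ n"
    proof -
      define p where "p = (2::real) ^ n"
      have p: "p > 0" "(1/2) ^ n = 1 / p" "4 ^ n = p * p"
        by (auto simp: p_def power_divide simp flip: power_mult_distrib)
      show ?thesis unfolding p(2,3) p_def[symmetric] using p(1) by (simp add: field_simps)
    qed
    finally show ?thesis .
  qed
  have "(\<integral>\<^sup>+x. (\<Sum>n. ennreal \<bar>g n x\<bar>) \<partial>M) = (\<Sum>n. \<integral>\<^sup>+x. ennreal \<bar>g n x\<bar> \<partial>M)"
    by (rule nn_integral_suminf) auto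
  also have "\<dots> = (\<Sum>n. ennreal (\<integral>x. \<bar>g n x\<bar> \<partial>M))"
    by (intro suminf_cong nn_integral_eq_integral int) auto
  also have "\<dots> \<le> (\<Sum>n. ennreal (3 * (1/2) ^ n))"
    by (intro suminf_le ennreal_leI le) auto
  also have "\<dots> = ennreal (\<Sum>n. 3 * (1/2) ^ n)"
    by (rule suminf_ennreal2) (auto intro!: summable_mult summable_geometric)
  also have "\<dots> < \<infinity>" by simp
  finally have "AE x in M. (\<Sum>n. ennreal \<bar>g n x\<bar>) \<noteq> \<infinity>"
    by (intro nn_integral_noteq_infinite) auto
  then show ?thesis
    by eventually_elim (auto intro!: summable_suminf_not_top)
qed

text \<open>Convex combinations of translates of h with dyadic weights. Being generated by rules,
  the set lets "replacing h by u costs nothing" be proved by induction: a coboundary for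
  \<open>shift\<close>, linearity for \<open>mean\<close>.\<close>

inductive_set conv_orbit :: "(int ^ 'd::finite \<Rightarrow> 'w \<Rightarrow> 'w) \<Rightarrow> ('w \<Rightarrow> real) \<Rightarrow> ('w \<Rightarrow> real) set"
  for T h where
  base: "h \<in> conv_orbit T h"
| shift: "u \<in> conv_orbit T h \<Longrightarrow> (\<lambda>\<omega>. u (T x \<omega>)) \<in> conv_orbit T h"
| mean: "u \<in> conv_orbit T h \<Longrightarrow> v \<in> conv_orbit T h \<Longrightarrow> (\<lambda>\<omega>. (u \<omega> + v \<omega>) / 2) \<in> conv_orbit T h"

section \<open>Averages along orbits of an ergodic action\<close>

locale ergodic_env = prob_space \<mu> for \<mu> :: "'w measure" +
  fixes T :: "int ^ 'd::finite \<Rightarrow> 'w \<Rightarrow> 'w"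
  assumes ergodic: "ergodic_action \<mu> T"
begin

lemma T_measurable [measurable]: "T x \<in> measurable \<mu> \<mu>"
  using ergodic by (simp add: ergodic_action_def)

lemma T_space: "\<omega> \<in> space \<mu> \<Longrightarrow> T x \<omega> \<in> space \<mu>"
  using measurable_space[OF T_measurable] by simp

lemma T_distr: "distr \<mu> \<mu> (T x) = \<mu>"
  using ergodic by (simp add: ergodic_action_def)

lemma T_add: "\<omega> \<in> space \<mu> \<Longrightarrow> T x (T y \<omega>) = T (x + y) \<omega>"
  using ergodic by (simp add: ergodic_action_def)

lemma T_0: "\<omega> \<in> space \<mu> \<Longrightarrow> T 0 \<omega> = \<omega>"
  using ergodic by (simp add: ergodic_action_def)

lemma integral_T: 
  fixes g :: "'w \<Rightarrow> real"
  assumes "g \<in> borel_measurable \<mu>" shows "(\<integral>\<omega>. g (T x \<omega>) \<partial>\<mu>) = (\<integral>\<omega>. g \<omega> \<partial>\<mu>)"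
  using integral_distr[OF T_measurable[of x] assms] by (simp add: T_distr)

lemma integrable_T:
  fixes g :: "'w \<Rightarrow> real"
  assumes "integrable \<mu> g" shows "integrable \<mu> (\<lambda>\<omega>. g (T x \<omega>))"
  using integrable_distr[OF T_measurable[of x], of g] assms by (simp add: T_distr)

lemma AE_T:
  assumes "AE \<omega> in \<mu>. Q \<omega>" shows "AE \<omega> in \<mu>. Q (T x \<omega>)"
proof -
  obtain N where N: "{\<omega> \<in> space \<mu>. \<not> Q \<omega>} \<subseteq> N" "N \<in> null_sets \<mu>"
    using assms by (auto elim!: AE_E simp: null_sets_def)
  have "AE \<omega> in distr \<mu> \<mu> (T x). \<omega> \<notin> N"
    using N(2) by (simp add: T_distr AE_not_in)
  then have "AE \<omega> in \<mu>. T x \<omega> \<notin> N"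
    using N(2) by (subst (asm) AE_distr_iff) auto
  then show ?thesis using AE_space by eventually_elim (use N(1) T_space in auto)
qed


text \<open>Transference: the covering lemma is applied along one orbit inside a box of side L.
  Integration and invariance of \<mu> turn the sums into multiples of volumes, and letting L tend to
  infinity removes the boundary.\<close>

lemma maximal_inequality:
  assumes g: "integrable \<mu> g" "\<And>\<omega>. g \<omega> \<ge> 0" and c: "c \<ge> 0"
  shows "c * measure \<mu> {\<omega> \<in> space \<mu>. \<exists>n\<ge>1. c * real n ^ CARD('d) < (\<Sum>y\<in>sites n. g (T y \<omega>))}
    \<le> 2 ^ CARD('d) * (\<integral>\<omega>. g \<omega> \<partial>\<mu>)"
proof -
  let ?d = "CARD('d)"
  have [measurable]: "g \<in> borel_measurable \<mu>" using g(1) by simp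
  \<comment> \<open>Cubes of side at most M with corner in the box of side L stay in the box of side
    L + M.\<close>
  define D where "D M = {\<omega> \<in> space \<mu>. \<exists>n\<in>{1..M}. c * real n ^ ?d < (\<Sum>y\<in>sites n. g (T y \<omega>))}" for M
  have D_sets [measurable]: "D M \<in> sets \<mu>" for M unfolding D_def by measurable
  have pointwise: "c * (\<Sum>x\<in>sites L. indicator (D M) (T x \<omega>)) \<le> 2 ^ ?d * (\<Sum>z\<in>sites (L + M). g (T z \<omega>))"
    if \<omega>: "\<omega> \<in> space \<mu>" for \<omega> L M
  proof -
    define E where "E = {x \<in> sites L. T x \<omega> \<in> D M}"
    define n where "n x = (SOME n. n \<in> {1..M} \<and> c * real n ^ ?d < (\<Sum>y\<in>sites n. g (T y (T x \<omega>))))" for x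
    have n: "n x \<in> {1..M}" "c * real (n x) ^ ?d < (\<Sum>y\<in>sites (n x). g (T (x + y) \<omega>))" if "x \<in> E" for x
    proof -
      have "\<exists>n. n \<in> {1..M} \<and> c * real n ^ ?d < (\<Sum>y\<in>sites n. g (T y (T x \<omega>)))"
        using that by (auto simp: E_def D_def)
      from someI_ex[OF this] show "n x \<in> {1..M}" "c * real (n x) ^ ?d < (\<Sum>y\<in>sites (n x). g (T (x + y) \<omega>))"
        using \<omega> by (simp_all add: n_def T_add add.commute)
    qed
    have "c * real (card E) \<le> 2 ^ ?d * (\<Sum>z\<in>(\<Union>x\<in>E. (+) x ` sites (n x)). g (T z \<omega>))"
      using n c g(2) by (intro cube_covering) (auto simp: E_def intro: less_imp_le Suc_le_lessD)
    also have "\<dots> \<le> 2 ^ ?d * (\<Sum>z\<in>sites (L + M). g (T z \<omega>))"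
    proof (intro mult_left_mono sum_mono2)
      show "(\<Union>x\<in>E. (+) x ` sites (n x)) \<subseteq> sites (L + M)"
      proof
        fix z assume "z \<in> (\<Union>x\<in>E. (+) x ` sites (n x))"
        then obtain x y where *: "x \<in> E" "y \<in> sites (n x)" "z = x + y" by auto
        have "0 \<le> z $ k \<and> z $ k < int (L + M)" for k
        proof -
          have "0 \<le> x $ k" "x $ k < int L" using *(1) by (auto simp: E_def sites_def)
          moreover have "0 \<le> y $ k" "y $ k < int (n x)" using *(2) by (auto simp: sites_def)
          moreover have "n x \<le> M" using n(1)[OF *(1)] by simp
          ultimately show ?thesis by (simp add: *(3))
        qed
        then show "z \<in> sites (L + M)" by (simp add: sites_def)
      qed
    qed (use g in auto)
    also have "real (card E) = (\<Sum>x\<in>sites L. indicator (D M) (T x \<omega>))"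
      by (simp add: E_def indicator_def sum.If_cases Int_def)
    finally show ?thesis .
  qed
  have integrated: "c * (real L ^ ?d * measure \<mu> (D M)) \<le> 2 ^ ?d * (real (L + M) ^ ?d * (\<integral>\<omega>. g \<omega> \<partial>\<mu>))" for L M
  proof -
    have int1: "integrable \<mu> (indicator (D M) :: _ \<Rightarrow> real)"
      by (rule integrable_real_indicator) (auto simp: emeasure_eq_measure)
    have "(\<integral>\<omega>. c * (\<Sum>x\<in>sites L. indicator (D M) (T x \<omega>)) \<partial>\<mu>) \<le> (\<integral>\<omega>. 2 ^ ?d * (\<Sum>z\<in>sites (L + M). g (T z \<omega>)) \<partial>\<mu>)"
      by (intro integral_mono integrable_mult_right Bochner_Integration.integrable_sum pointwise
          integrable_T[OF g(1)] integrable_T[OF int1])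
    moreover have "(\<integral>\<omega>. c * (\<Sum>x\<in>sites L. indicator (D M) (T x \<omega>)) \<partial>\<mu>) = c * (real L ^ ?d * measure \<mu> (D M))"
      using integral_T[of "indicator (D M)"]
      by (simp add: Bochner_Integration.integral_sum integrable_T[OF int1])
    moreover have "(\<integral>\<omega>. 2 ^ ?d * (\<Sum>z\<in>sites (L + M). g (T z \<omega>)) \<partial>\<mu>) = 2 ^ ?d * (real (L + M) ^ ?d * (\<integral>\<omega>. g \<omega> \<partial>\<mu>))"
      using integral_T[of g] by (simp add: Bochner_Integration.integral_sum integrable_T[OF g(1)])
    ultimately show ?thesis by linarith
  qed
  have DM: "c * measure \<mu> (D M) \<le> 2 ^ ?d * (\<integral>\<omega>. g \<omega> \<partial>\<mu>)" for M
  proof (rule LIMSEQ_le_const)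
    \<comment> \<open>The factor (1 + M/L)^d is the volume ratio of the enlarged box to the original
      one.\<close>
    have "(\<lambda>L. 2 ^ ?d * ((1 + real M / real L) ^ ?d * (\<integral>\<omega>. g \<omega> \<partial>\<mu>)))
        \<longlonglongrightarrow> 2 ^ ?d * ((1 + 0) ^ ?d * (\<integral>\<omega>. g \<omega> \<partial>\<mu>))"
      by (intro tendsto_intros lim_const_over_n)
    then show "(\<lambda>L. 2 ^ ?d * ((1 + real M / real L) ^ ?d * (\<integral>\<omega>. g \<omega> \<partial>\<mu>))) \<longlonglongrightarrow> 2 ^ ?d * (\<integral>\<omega>. g \<omega> \<partial>\<mu>)"
      by simp
    show "\<exists>L0. \<forall>L\<ge>L0. c * measure \<mu> (D M) \<le> 2 ^ ?d * ((1 + real M / real L) ^ ?d * (\<integral>\<omega>. g \<omega> \<partial>\<mu>))"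
    proof (intro exI allI impI)
      fix L :: nat assume L: "L \<ge> 1"
      have "c * (real L ^ ?d * measure \<mu> (D M)) / real L ^ ?d
          \<le> 2 ^ ?d * (real (L + M) ^ ?d * (\<integral>\<omega>. g \<omega> \<partial>\<mu>)) / real L ^ ?d"
        by (intro divide_right_mono integrated) auto
      moreover have "1 + real M / real L = real (L + M) / real L" using L by (simp add: field_simps)
      ultimately show "c * measure \<mu> (D M) \<le> 2 ^ ?d * ((1 + real M / real L) ^ ?d * (\<integral>\<omega>. g \<omega> \<partial>\<mu>))"
        using L by (simp add: power_divide)
    qed
  qed
  have "(\<lambda>M. measure \<mu> (D M)) \<longlonglongrightarrow> measure \<mu> (\<Union>M. D M)"
    by (rule finite_Lim_measure_incseq) (auto simp: incseq_def D_def intro: order_trans)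
  then have "(\<lambda>M. c * measure \<mu> (D M)) \<longlonglongrightarrow> c * measure \<mu> (\<Union>M. D M)" by (rule tendsto_mult_left)
  then have "c * measure \<mu> (\<Union>M. D M) \<le> 2 ^ ?d * (\<integral>\<omega>. g \<omega> \<partial>\<mu>)"
    by (rule LIMSEQ_le_const2) (use DM in auto)
  moreover have "(\<Union>M. D M) = {\<omega> \<in> space \<mu>. \<exists>n\<ge>1. c * real n ^ ?d < (\<Sum>y\<in>sites n. g (T y \<omega>))}"
  proof (intro equalityI subsetI)
    fix \<omega> assume "\<omega> \<in> {\<omega> \<in> space \<mu>. \<exists>n\<ge>1. c * real n ^ ?d < (\<Sum>y\<in>sites n. g (T y \<omega>))}"
    then obtain n where "\<omega> \<in> space \<mu>" "n \<ge> 1" "c * real n ^ ?d < (\<Sum>y\<in>sites n. g (T y \<omega>))" by blast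
    then have "\<omega> \<in> D n" by (auto simp: D_def)
    then show "\<omega> \<in> (\<Union>M. D M)" by blast
  qed (auto simp: D_def)
  ultimately show ?thesis by simp
qed

lemma conv_orbit_props:
  assumes u: "u \<in> conv_orbit T h" and h: "h \<in> borel_measurable \<mu>" "\<And>\<omega>. \<omega> \<in> space \<mu> \<Longrightarrow> \<bar>h \<omega>\<bar> \<le> C"
  shows "u \<in> borel_measurable \<mu>" "\<And>\<omega>. \<omega> \<in> space \<mu> \<Longrightarrow> \<bar>u \<omega>\<bar> \<le> C" "(\<integral>\<omega>. u \<omega> \<partial>\<mu>) = (\<integral>\<omega>. h \<omega> \<partial>\<mu>)"
proof -
  have int: "integrable \<mu> u" if "u \<in> borel_measurable \<mu>" "\<forall>\<omega>\<in>space \<mu>. \<bar>u \<omega>\<bar> \<le> C" for u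
    by (rule integrable_const_bound[where B = C]) (use that in auto)
  have "u \<in> borel_measurable \<mu> \<and> (\<forall>\<omega>\<in>space \<mu>. \<bar>u \<omega>\<bar> \<le> C) \<and> (\<integral>\<omega>. u \<omega> \<partial>\<mu>) = (\<integral>\<omega>. h \<omega> \<partial>\<mu>)"
    using u
  proof induction
    case (shift u x)
    then have [measurable]: "u \<in> borel_measurable \<mu>" by simp
    show ?case using shift T_space integral_T[of u x] by auto
  next
    case (mean u v)
    then have [measurable]: "u \<in> borel_measurable \<mu>" "v \<in> borel_measurable \<mu>" by simp_all
    have "\<forall>\<omega>\<in>space \<mu>. \<bar>(u \<omega> + v \<omega>) / 2\<bar> \<le> C"
    proof
      fix \<omega> assume "\<omega> \<in> space \<mu>"
      with mean have "\<bar>u \<omega>\<bar> \<le> C" "\<bar>v \<omega>\<bar> \<le> C" by auto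
      then have "\<bar>u \<omega> + v \<omega>\<bar> \<le> 2 * C" by linarith
      then show "\<bar>(u \<omega> + v \<omega>) / 2\<bar> \<le> C" by simp
    qed
    moreover have "integrable \<mu> u" "integrable \<mu> v" using mean by (auto intro!: int)
    ultimately show ?case using mean by simp
  qed (use h in auto)
  then show "u \<in> borel_measurable \<mu>" "\<And>\<omega>. \<omega> \<in> space \<mu> \<Longrightarrow> \<bar>u \<omega>\<bar> \<le> C" "(\<integral>\<omega>. u \<omega> \<partial>\<mu>) = (\<integral>\<omega>. h \<omega> \<partial>\<mu>)"
    by auto
qed

text \<open>Ergodicity excludes v > q on a set of full measure for any q > 0, as the mean would be
  positive. Thus v \<le> 0 almost everywhere, and a non-positive function with mean 0 vanishes
  almost everywhere.\<close>

lemma invariant_AE_zero: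
  assumes [measurable]: "v \<in> borel_measurable \<mu>" and int: "integrable \<mu> v"
    and mean: "(\<integral>\<omega>. v \<omega> \<partial>\<mu>) = 0"
    and inv: "\<And>x. AE \<omega> in \<mu>. v (T x \<omega>) = (v \<omega> :: real)"
  shows "AE \<omega> in \<mu>. v \<omega> = 0"
proof -
  have inv': "AE \<omega> in \<mu>. \<forall>x. v (T x \<omega>) = v \<omega>" using inv by (simp add: AE_all_countable)
  have le: "AE \<omega> in \<mu>. v \<omega> \<le> q" if "q > 0" for q
  proof -
    \<comment> \<open>Demanding the inequality along the whole orbit makes B strictly invariant, as
      the notion of ergodicity requires, although v is invariant only almost everywhere.\<close>
    define B where "B = {\<omega> \<in> space \<mu>. \<forall>x. v (T x \<omega>) > q}"
    have B [measurable]: "B \<in> sets \<mu>" unfolding B_def by measurable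
    have "T y -` B \<inter> space \<mu> = B" for y
    proof (intro equalityI subsetI)
      fix \<omega> assume "\<omega> \<in> T y -` B \<inter> space \<mu>"
      then have \<omega>: "\<omega> \<in> space \<mu>" "\<And>x. v (T (x + y) \<omega>) > q" by (auto simp: B_def T_add)
      from \<omega>(2)[of "x - y" for x] \<omega>(1) show "\<omega> \<in> B" by (auto simp: B_def)
    qed (auto simp: B_def T_add T_space)
    then have "measure \<mu> B = 0 \<or> measure \<mu> B = 1"
      using ergodic B unfolding ergodic_action_def by blast
    moreover have "measure \<mu> B \<noteq> 1"
    proof
      assume "measure \<mu> B = 1"
      then have "AE \<omega> in \<mu>. \<omega> \<in> B" using prob_eq_1[OF B] by simp
      then have "AE \<omega> in \<mu>. q \<le> v \<omega>"
        by eventually_elim (auto simp: B_def T_0 dest!: spec[of _ 0] intro: less_imp_le)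
      then have "(\<integral>\<omega>. q \<partial>\<mu>) \<le> (\<integral>\<omega>. v \<omega> \<partial>\<mu>)" by (intro integral_mono_AE int) auto
      with mean that show False by (simp add: prob_space)
    qed
    ultimately have "AE \<omega> in \<mu>. \<omega> \<notin> B" using prob_eq_0[OF B] by simp
    with inv' AE_space show ?thesis by eventually_elim (auto simp: B_def not_less)
  qed
  have "AE \<omega> in \<mu>. \<forall>n::nat. v \<omega> \<le> 1 / real (Suc n)"
    unfolding AE_all_countable by (intro allI le) auto
  then have neg: "AE \<omega> in \<mu>. 0 \<le> - v \<omega>"
  proof eventually_elim
    case (elim \<omega>)
    then show ?case by (metis neg_0_le_iff_le not_le reals_Archimedean inverse_eq_divide)
  qed
  have "AE \<omega> in \<mu>. - v \<omega> = 0"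
    using integral_nonneg_eq_0_iff_AE[of \<mu> "\<lambda>\<omega>. - v \<omega>"] int neg mean by simp
  then show ?thesis by eventually_elim simp
qed

text \<open>The element of least norm in the closed convex hull of the orbit is unique, hence
  invariant, hence zero by ergodicity and the vanishing mean. A sufficiently fast minimising
  sequence realises it as an almost everywhere limit.\<close>

lemma conv_orbit_small:
  assumes h [measurable]: "h \<in> borel_measurable \<mu>" and bound: "\<And>\<omega>. \<omega> \<in> space \<mu> \<Longrightarrow> \<bar>h \<omega>\<bar> \<le> C"
    and mean: "(\<integral>\<omega>. h \<omega> \<partial>\<mu>) = 0"
  obtains u where "\<And>n::nat. u n \<in> conv_orbit T h" "(\<lambda>n. \<integral>\<omega>. (u n \<omega>)\<^sup>2 \<partial>\<mu>) \<longlonglongrightarrow> 0"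
proof -
  let ?S = "conv_orbit T h"
  have props: "u \<in> borel_measurable \<mu>" "\<And>\<omega>. \<omega> \<in> space \<mu> \<Longrightarrow> \<bar>u \<omega>\<bar> \<le> C" "(\<integral>\<omega>. u \<omega> \<partial>\<mu>) = (\<integral>\<omega>. h \<omega> \<partial>\<mu>)"
    if "u \<in> ?S" for u
    using conv_orbit_props[OF that h, of C] bound by auto
  have C: "C \<ge> 0" using bound not_empty by (metis abs_ge_zero all_not_in_conv order_trans)
  have sqint: "integrable \<mu> (\<lambda>\<omega>. (u \<omega>)\<^sup>2)"
    if "u \<in> borel_measurable \<mu>" "\<And>\<omega>. \<omega> \<in> space \<mu> \<Longrightarrow> \<bar>u \<omega>\<bar> \<le> B" for u and B :: real
  proof (rule integrable_const_bound[where B = "B\<^sup>2"])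
    show "AE \<omega> in \<mu>. norm ((u \<omega>)\<^sup>2) \<le> B\<^sup>2"
      using power_mono[OF that(2), of _ 2] by (intro AE_I2) auto
  qed (use that in measurable)
  define I where "I u = (\<integral>\<omega>. (u \<omega>)\<^sup>2 \<partial>\<mu>)" for u :: "'w \<Rightarrow> real"
  have I0: "I u \<ge> 0" for u by (simp add: I_def)
  define c where "c = Inf (I ` ?S)"
  have bounded_field: "bdd_below (I ` ?S)" using I0 by (intro bdd_belowI[of _ 0]) auto
  have c_le: "c \<le> I u" if "u \<in> ?S" for u unfolding c_def using bounded_field that by (intro cInf_lower) auto
  \<comment> \<open>Parallelogram identity; the midpoint belongs to the hull again, so its squared
    norm is at least c.\<close>
  have para: "I (\<lambda>\<omega>. u \<omega> - v \<omega>) \<le> 2 * (I u - c) + 2 * (I v - c)" if uv: "u \<in> ?S" "v \<in> ?S" for u v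
  proof -
    note [measurable] = props(1)[OF uv(1)] props(1)[OF uv(2)]
    note iu = sqint[OF props(1,2)[OF uv(1)]] and iv = sqint[OF props(1,2)[OF uv(2)]]
    have im: "integrable \<mu> (\<lambda>\<omega>. ((u \<omega> + v \<omega>) / 2)\<^sup>2)"
      using sqint[OF props(1,2)[OF conv_orbit.mean[OF uv]]] by simp
    have "I (\<lambda>\<omega>. u \<omega> - v \<omega>) = (\<integral>\<omega>. 2 * (u \<omega>)\<^sup>2 + 2 * (v \<omega>)\<^sup>2 - 4 * ((u \<omega> + v \<omega>) / 2)\<^sup>2 \<partial>\<mu>)"
      unfolding I_def by (intro Bochner_Integration.integral_cong refl) (simp add: power2_eq_square field_simps)
    also have "\<dots> = 2 * I u + 2 * I v - 4 * I (\<lambda>\<omega>. (u \<omega> + v \<omega>) / 2)"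
      unfolding I_def using iu iv im by simp
    also have "\<dots> \<le> 2 * (I u - c) + 2 * (I v - c)"
      using c_le[OF conv_orbit.mean[OF uv]] by simp
    finally show ?thesis .
  qed
  \<comment> \<open>The accuracy 4^-n makes \<open>para\<close> yield squared distances of at most 4
    / 4^n, as \<open>AE_summable_L2\<close> asks.\<close>
  have "\<exists>u\<in>?S. I u < c + 1 / 4 ^ n" for n
    using cInf_lessD[of "I ` ?S" "c + 1 / 4 ^ n"] conv_orbit.base[of h T] by (auto simp: c_def)
  then obtain u where u: "\<And>n. u n \<in> ?S" "\<And>n::nat. I (u n) < c + 1 / 4 ^ n" by metis
  note [measurable] = props(1)[OF u(1)]
  have sum1: "AE \<omega> in \<mu>. summable (\<lambda>n. \<bar>u (Suc n) \<omega> - u n \<omega>\<bar>)"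
  proof (rule AE_summable_L2[where C = "2 * C"])
    show "\<bar>u (Suc n) \<omega> - u n \<omega>\<bar> \<le> 2 * C" if "\<omega> \<in> space \<mu>" for n \<omega>
      using props(2)[OF u(1) that, of n] props(2)[OF u(1) that, of "Suc n"] by linarith
    show "(\<integral>\<omega>. (u (Suc n) \<omega> - u n \<omega>)\<^sup>2 \<partial>\<mu>) \<le> 4 / 4 ^ n" for n
    proof -
      have "(1::real) / 4 ^ Suc n \<le> 1 / 4 ^ n" by (simp add: field_simps)
      then show ?thesis
        using para[OF u(1) u(1), of "Suc n" n] u(2)[of n] u(2)[of "Suc n"] by (simp add: I_def)
    qed
  qed (unfold_locales, measurable)
  \<comment> \<open>As T x preserves \<mu>, the translate of u n is as nearly minimal as u n itself;
    the two are therefore close, which makes the limit invariant.\<close>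
  have sum2: "AE \<omega> in \<mu>. summable (\<lambda>n. \<bar>u n (T x \<omega>) - u n \<omega>\<bar>)" for x
  proof (rule AE_summable_L2[where C = "2 * C"])
    show "\<bar>u n (T x \<omega>) - u n \<omega>\<bar> \<le> 2 * C" if "\<omega> \<in> space \<mu>" for n \<omega>
      using props(2)[OF u(1) that, of n] props(2)[OF u(1) T_space[OF that], of n x] by linarith
    have "I (\<lambda>\<omega>. u n (T x \<omega>)) = I (u n)" for n unfolding I_def by (rule integral_T) measurable
    then show "(\<integral>\<omega>. (u n (T x \<omega>) - u n \<omega>)\<^sup>2 \<partial>\<mu>) \<le> 4 / 4 ^ n" for n
      using para[OF conv_orbit.shift[OF u(1)] u(1), of n x n] u(2)[of n] by (simp add: I_def)
  qed (unfold_locales, measurable)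
  \<comment> \<open>\<open>lim\<close> is total; its arbitrary value where the sequence diverges
    concerns a null set only.\<close>
  define v where "v \<omega> = lim (\<lambda>n. u n \<omega>)" for \<omega>
  have [measurable]: "v \<in> borel_measurable \<mu>"
    unfolding v_def by (rule borel_measurable_lim_metric) measurable
  have lim: "AE \<omega> in \<mu>. (\<lambda>n. u n \<omega>) \<longlonglongrightarrow> v \<omega>"
    using sum1
  proof eventually_elim
    case (elim \<omega>)
    then have "summable (\<lambda>n. u (Suc n) \<omega> - u n \<omega>)" by (rule summable_rabs_cancel)
    then have "(\<lambda>n. \<Sum>i<n. u (Suc i) \<omega> - u i \<omega>) \<longlonglongrightarrow> (\<Sum>i. u (Suc i) \<omega> - u i \<omega>)"
      by (rule summable_LIMSEQ)
    then have "(\<lambda>n. u n \<omega> - u 0 \<omega>) \<longlonglongrightarrow> (\<Sum>i. u (Suc i) \<omega> - u i \<omega>)"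
      by (subst (asm) sum_lessThan_telescope[of "\<lambda>i. u i \<omega>"])
    from tendsto_add[OF this tendsto_const[of "u 0 \<omega>"]]
    have "convergent (\<lambda>n. u n \<omega>)" by (auto simp: convergent_def)
    then show ?case by (simp add: v_def convergent_LIMSEQ_iff)
  qed
  have vbound: "AE \<omega> in \<mu>. \<bar>v \<omega>\<bar> \<le> C"
    using lim AE_space
  proof eventually_elim
    case (elim \<omega>)
    then show ?case
      by (intro LIMSEQ_le_const2[OF tendsto_rabs]) (use props(2)[OF u(1)] in auto)
  qed
  have vint: "integrable \<mu> v"
    by (rule integrable_const_bound[where B = C]) (use vbound in auto)
  have "(\<lambda>n. \<integral>\<omega>. u n \<omega> \<partial>\<mu>) \<longlonglongrightarrow> (\<integral>\<omega>. v \<omega> \<partial>\<mu>)"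
    by (rule integral_dominated_convergence[where w = "\<lambda>_. C"]) (use lim props(2)[OF u(1)] in auto)
  moreover have "(\<integral>\<omega>. u n \<omega> \<partial>\<mu>) = 0" for n using props(3)[OF u(1)] mean by simp
  ultimately have "(\<integral>\<omega>. v \<omega> \<partial>\<mu>) = 0" by (simp add: LIMSEQ_const_iff)
  moreover have "AE \<omega> in \<mu>. v (T x \<omega>) = v \<omega>" for x
    using lim AE_T[OF lim, of x] sum2[of x]
  proof eventually_elim
    case (elim \<omega>)
    have "(\<lambda>n. u n (T x \<omega>) - u n \<omega>) \<longlonglongrightarrow> 0"
      using summable_LIMSEQ_zero[OF summable_rabs_cancel[OF elim(3)]] .
    moreover have "(\<lambda>n. u n (T x \<omega>) - u n \<omega>) \<longlonglongrightarrow> v (T x \<omega>) - v \<omega>"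
      using elim by (intro tendsto_diff)
    ultimately have "v (T x \<omega>) - v \<omega> = 0" using LIMSEQ_unique by blast
    then show ?case by simp
  qed
  ultimately have "AE \<omega> in \<mu>. v \<omega> = 0" using vint by (intro invariant_AE_zero) auto
  with lim have "AE \<omega> in \<mu>. (\<lambda>n. (u n \<omega>)\<^sup>2) \<longlonglongrightarrow> 0"
    by eventually_elim (auto intro: tendsto_eq_intros)
  then have "(\<lambda>n. \<integral>\<omega>. (u n \<omega>)\<^sup>2 \<partial>\<mu>) \<longlonglongrightarrow> (\<integral>\<omega>. 0 \<partial>\<mu>)"
  proof (intro integral_dominated_convergence[where w = "\<lambda>_. C\<^sup>2"])
    show "AE \<omega> in \<mu>. norm ((u n \<omega>)\<^sup>2) \<le> C\<^sup>2" for n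
      using power_mono[OF props(2)[OF u(1)], of _ n 2] by (intro AE_I2) auto
  qed auto
  then show ?thesis using that[of u] u(1) by simp
qed

text \<open>The good index n may depend on \<omega>. The points bad for every n have measure at most
  2^d / \<delta> times the integral of the square of each u n, hence measure 0; the values \<delta>
  = 1/(k+1) combine into one null set.\<close>

lemma AE_sup_average_small:
  assumes h: "h \<in> borel_measurable \<mu>" and bound: "\<And>\<omega>. \<omega> \<in> space \<mu> \<Longrightarrow> \<bar>h \<omega>\<bar> \<le> C"
    and mean: "(\<integral>\<omega>. h \<omega> \<partial>\<mu>) = 0"
  shows "AE \<omega> in \<mu>. \<forall>\<delta>>0. \<exists>u\<in>conv_orbit T h. \<forall>N\<ge>1. (\<Sum>x\<in>sites N. (u (T x \<omega>))\<^sup>2) \<le> \<delta> * real N ^ CARD('d)"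
proof -
  let ?d = "CARD('d)"
  obtain u where u: "\<And>n::nat. u n \<in> conv_orbit T h" "(\<lambda>n. \<integral>\<omega>. (u n \<omega>)\<^sup>2 \<partial>\<mu>) \<longlonglongrightarrow> 0"
    using conv_orbit_small[OF h bound mean] by blast
  have props: "u n \<in> borel_measurable \<mu>" "\<And>\<omega>. \<omega> \<in> space \<mu> \<Longrightarrow> \<bar>u n \<omega>\<bar> \<le> C" for n
    using conv_orbit_props[OF u(1) h, of C] bound by auto
  note [measurable] = props(1)
  have int: "integrable \<mu> (\<lambda>\<omega>. (u n \<omega>)\<^sup>2)" for n
  proof (rule integrable_const_bound[where B = "C\<^sup>2"])
    show "AE \<omega> in \<mu>. norm ((u n \<omega>)\<^sup>2) \<le> C\<^sup>2"
      using power_mono[OF props(2), of _ n 2] by (intro AE_I2) auto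
  qed measurable
  define B where "B \<delta> n = {\<omega> \<in> space \<mu>. \<exists>N\<ge>1. \<delta> * real N ^ ?d < (\<Sum>x\<in>sites N. (u n (T x \<omega>))\<^sup>2)}" for \<delta> n
  have B_sets [measurable]: "B \<delta> n \<in> sets \<mu>" for \<delta> n unfolding B_def by measurable
  have small: "AE \<omega> in \<mu>. \<exists>n. \<omega> \<notin> B \<delta> n" if "\<delta> > 0" for \<delta>
  proof -
    have "measure \<mu> (\<Inter>n. B \<delta> n) \<le> 2 ^ ?d / \<delta> * (\<integral>\<omega>. (u n \<omega>)\<^sup>2 \<partial>\<mu>)" for n
    proof -
      have "measure \<mu> (\<Inter>n. B \<delta> n) \<le> measure \<mu> (B \<delta> n)" by (intro finite_measure_mono) auto
      moreover have "\<delta> * measure \<mu> (B \<delta> n) \<le> 2 ^ ?d * (\<integral>\<omega>. (u n \<omega>)\<^sup>2 \<partial>\<mu>)"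
        unfolding B_def using that by (intro maximal_inequality int) auto
      ultimately show ?thesis using that by (simp add: field_simps) (meson mult_left_mono less_imp_le order_trans)
    qed
    moreover have "(\<lambda>n. 2 ^ ?d / \<delta> * (\<integral>\<omega>. (u n \<omega>)\<^sup>2 \<partial>\<mu>)) \<longlonglongrightarrow> 2 ^ ?d / \<delta> * 0"
      by (intro tendsto_mult_left u(2))
    ultimately have "measure \<mu> (\<Inter>n. B \<delta> n) \<le> 0"
      by (intro LIMSEQ_le_const[where X = "\<lambda>n. 2 ^ ?d / \<delta> * (\<integral>\<omega>. (u n \<omega>)\<^sup>2 \<partial>\<mu>)"]) auto
    then have "measure \<mu> (\<Inter>n. B \<delta> n) = 0" by (simp add: measure_le_0_iff)
    then have "AE \<omega> in \<mu>. \<omega> \<notin> (\<Inter>n. B \<delta> n)" by (subst prob_eq_0[symmetric]) auto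
    then show ?thesis by eventually_elim auto
  qed
  have "AE \<omega> in \<mu>. \<forall>k::nat. \<exists>n. \<omega> \<notin> B (1 / real (Suc k)) n"
    unfolding AE_all_countable by (intro allI small) auto
  then show ?thesis using AE_space
  proof eventually_elim
    case (elim \<omega>)
    show ?case
    proof (intro allI impI)
      fix \<delta> :: real assume "\<delta> > 0"
      then obtain k where k: "1 / real (Suc k) < \<delta>" by (metis nat_approx_posE)
      from elim(1) obtain n where "\<omega> \<notin> B (1 / real (Suc k)) n" by blast
      with elim(2) have *: "(\<Sum>x\<in>sites N. (u n (T x \<omega>))\<^sup>2) \<le> 1 / real (Suc k) * real N ^ ?d" if "N \<ge> 1" for N
        using that by (auto simp: B_def not_less)
      have "(\<Sum>x\<in>sites N. (u n (T x \<omega>))\<^sup>2) \<le> \<delta> * real N ^ ?d" if "N \<ge> 1" for N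
        using *[OF that] mult_right_mono[OF less_imp_le[OF k], of "real N ^ ?d"] by simp
      then show "\<exists>u\<in>conv_orbit T h. \<forall>N\<ge>1. (\<Sum>x\<in>sites N. (u (T x \<omega>))\<^sup>2) \<le> \<delta> * real N ^ ?d"
        using u(1) by blast
    qed
  qed
qed

end

section \<open>Oscillation of cadlag functions\<close>

text \<open>There is one limit per quadrant, and finitely many quadrants admit a common radius. The
  set \<open>{k. x $ k \<le> p $ k}\<close> names the quadrant of x in which p lies.\<close>

lemma cadlag_local:
  fixes G :: "real ^ 'd::finite \<Rightarrow> real"
  assumes "cadlag G" "e > 0"
  shows "\<exists>\<delta>>0. \<exists>l. \<forall>p. (\<forall>k. \<bar>p $ k - x $ k\<bar> < \<delta>) \<longrightarrow> \<bar>G p - l {k. x $ k \<le> p $ k}\<bar> \<le> e"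
proof -
  have "\<exists>l r. r > 0 \<and> (\<forall>p\<in>quadrant x S. dist p x < r \<longrightarrow> \<bar>G p - l\<bar> \<le> e)" for S
  proof -
    obtain l where l: "(G \<longlongrightarrow> l) (at x within quadrant x S)" "S = UNIV \<longrightarrow> l = G x"
      using assms(1) unfolding cadlag_def by metis
    then obtain r where r: "r > 0" "\<And>p. p \<in> quadrant x S \<Longrightarrow> 0 < dist p x \<Longrightarrow> dist p x < r \<Longrightarrow> dist (G p) l < e"
      using assms(2) unfolding Lim_within by blast
    \<comment> \<open>The limit says nothing about p = x; that case belongs to the closed upper
      quadrant only, where l was chosen as the value of G.\<close>
    have "\<bar>G p - l\<bar> \<le> e" if "p \<in> quadrant x S" "dist p x < r" for p
    proof (cases "p = x")
      case True
      then have "S = UNIV" using that(1) by (auto simp: quadrant_def split: if_splits)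
      with l(2) True assms(2) show ?thesis by simp
    qed (use r(2)[OF that(1) _ that(2)] in \<open>auto simp: dist_real_def\<close>)
    with r(1) show ?thesis by blast
  qed
  then obtain l r where lr: "\<And>S. r S > 0" "\<And>S p. p \<in> quadrant x S \<Longrightarrow> dist p x < r S \<Longrightarrow> \<bar>G p - l S\<bar> \<le> e"
    by metis
  \<comment> \<open>Division by the dimension lets coordinatewise closeness control the Euclidean
    distance through the l^1 norm.\<close>
  define \<delta> where "\<delta> = Min (range r) / CARD('d)"
  have "\<delta> > 0" using lr(1) by (simp add: \<delta>_def)
  moreover have "\<bar>G p - l {k. x $ k \<le> p $ k}\<bar> \<le> e" if p: "\<forall>k. \<bar>p $ k - x $ k\<bar> < \<delta>" for p
  proof (rule lr(2))
    show "p \<in> quadrant x {k. x $ k \<le> p $ k}" by (auto simp: quadrant_def)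
    have "dist p x \<le> (\<Sum>k\<in>UNIV. \<bar>(p - x) $ k\<bar>)"
      unfolding dist_norm by (rule norm_le_l1_cart)
    also have "\<dots> < (\<Sum>k\<in>(UNIV::'d set). \<delta>)" using p by (intro sum_strict_mono) auto
    also have "\<dots> = Min (range r)" by (simp add: \<delta>_def)
    also have "\<dots> \<le> r {k. x $ k \<le> p $ k}" by (intro Min_le) auto
    finally show "dist p x < r {k. x $ k \<le> p $ k}" .
  qed
  ultimately show ?thesis by blast
qed

text \<open>Compactness of the unit cube. The half radius in the covering leaves room for a second
  point near p inside the full box around the same centre.\<close>

lemma cadlag_cover:
  fixes G :: "real ^ 'd::finite \<Rightarrow> real"
  assumes "cadlag G" "e > 0"
  obtains X \<delta> l where "finite X" "\<And>x. \<delta> x > 0"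
    "\<And>p. (\<And>k. 0 \<le> p $ k \<and> p $ k \<le> 1) \<Longrightarrow> \<exists>x\<in>X. \<forall>k. \<bar>p $ k - x $ k\<bar> < \<delta> x / 2"
    "\<And>x p. (\<And>k. \<bar>p $ k - x $ k\<bar> < \<delta> x) \<Longrightarrow> \<bar>G p - l x {k. x $ k \<le> p $ k}\<bar> \<le> e"
proof -
  obtain \<delta> l where d: "\<And>x. \<delta> x > 0"
    "\<And>x p. (\<And>k. \<bar>p $ k - x $ k\<bar> < \<delta> x) \<Longrightarrow> \<bar>G p - l x {k. x $ k \<le> p $ k}\<bar> \<le> e"
    using cadlag_local[OF assms] by metis
  define U where "U x = {p :: real ^ 'd. \<forall>k. \<bar>p $ k - x $ k\<bar> < \<delta> x / 2}" for x
  have "open (U x)" for x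
  proof -
    have "U x = (\<Inter>k. {p. \<bar>p $ k - x $ k\<bar> < \<delta> x / 2})" by (auto simp: U_def)
    then show ?thesis by (auto intro!: open_INT open_Collect_less continuous_intros)
  qed
  moreover have "p \<in> U p" for p using d(1)[of p] by (simp add: U_def)
  then have "cbox 0 1 \<subseteq> (\<Union>x\<in>UNIV. U x)" by blast
  ultimately obtain X where X: "finite X" "cbox 0 1 \<subseteq> (\<Union>x\<in>X. U x)"
    using compactE_image[OF compact_cbox, of "UNIV" U 0 "1 :: real ^ 'd"] by metis
  show ?thesis
  proof (rule that[OF X(1) d(1)])
    fix p :: "real ^ 'd" assume "\<And>k. 0 \<le> p $ k \<and> p $ k \<le> 1"
    then have "p \<in> cbox 0 1" by (simp add: mem_box_cart)
    with X(2) show "\<exists>x\<in>X. \<forall>k. \<bar>p $ k - x $ k\<bar> < \<delta> x / 2" by (auto simp: U_def)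
  qed (rule d(2))
qed

lemma cadlag_bounded:
  fixes G :: "real ^ 'd::finite \<Rightarrow> real"
  assumes "cadlag G"
  obtains C where "C > 0" "\<And>p. (\<And>k. 0 \<le> p $ k \<and> p $ k \<le> 1) \<Longrightarrow> \<bar>G p\<bar> \<le> C"
proof -
  obtain X \<delta> l where X: "finite X" "\<And>x. \<delta> x > 0"
    "\<And>p. (\<And>k. 0 \<le> p $ k \<and> p $ k \<le> 1) \<Longrightarrow> \<exists>x\<in>X. \<forall>k. \<bar>p $ k - x $ k\<bar> < \<delta> x / 2"
    "\<And>x p. (\<And>k. \<bar>p $ k - x $ k\<bar> < \<delta> x) \<Longrightarrow> \<bar>G p - l x {k. x $ k \<le> p $ k}\<bar> \<le> 1"
    by (rule cadlag_cover[OF assms zero_less_one]) blast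
  define C where "C = (\<Sum>x\<in>X. \<Sum>S\<in>UNIV. \<bar>l x S\<bar>) + 1"
  have "C > 0" by (auto simp: C_def intro!: add_nonneg_pos sum_nonneg)
  moreover have "\<bar>G p\<bar> \<le> C" if p: "\<And>k. 0 \<le> p $ k \<and> p $ k \<le> 1" for p
  proof -
    obtain x where x: "x \<in> X" "\<forall>k. \<bar>p $ k - x $ k\<bar> < \<delta> x / 2" using X(3)[OF p] by blast
    have "\<bar>p $ k - x $ k\<bar> < \<delta> x" for k
      using x(2)[rule_format, of k] X(2)[of x] by linarith
    then have "\<bar>G p - l x {k. x $ k \<le> p $ k}\<bar> \<le> 1" by (rule X(4))
    moreover have "\<bar>l x {k. x $ k \<le> p $ k}\<bar> \<le> (\<Sum>S\<in>UNIV. \<bar>l x S\<bar>)"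
      by (rule member_le_sum) auto
    moreover have "(\<Sum>S\<in>UNIV. \<bar>l x S\<bar>) \<le> (\<Sum>x\<in>X. \<Sum>S\<in>UNIV. \<bar>l x S\<bar>)"
      using x(1) X(1) by (intro member_le_sum) (auto intro: sum_nonneg)
    ultimately show ?thesis unfolding C_def by linarith
  qed
  ultimately show ?thesis using that by blast
qed

text \<open>Z collects the coordinates of the finitely many centres. Two close points not separated
  by any hyperplane with such a coordinate lie in the same quadrant of a common centre, so both
  values are near one limit.\<close>

lemma cadlag_oscillation:
  fixes G :: "real ^ 'd::finite \<Rightarrow> real"
  assumes "cadlag G" "e > 0"
  obtains Z :: "real set" and \<delta> where "finite Z" "\<delta> > 0"
    "\<And>p q. (\<And>k. 0 \<le> p $ k \<and> p $ k \<le> 1) \<Longrightarrow> (\<And>k. \<bar>p $ k - q $ k\<bar> < \<delta>)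
        \<Longrightarrow> (\<And>k c. c \<in> Z \<Longrightarrow> c \<le> p $ k \<longleftrightarrow> c \<le> q $ k) \<Longrightarrow> \<bar>G p - G q\<bar> \<le> e"
proof -
  have "e / 2 > 0" using assms(2) by simp
  obtain X \<delta> l where X: "finite X" "\<And>x. \<delta> x > 0"
    "\<And>p. (\<And>k. 0 \<le> p $ k \<and> p $ k \<le> 1) \<Longrightarrow> \<exists>x\<in>X. \<forall>k. \<bar>p $ k - x $ k\<bar> < \<delta> x / 2"
    "\<And>x p. (\<And>k. \<bar>p $ k - x $ k\<bar> < \<delta> x) \<Longrightarrow> \<bar>G p - l x {k. x $ k \<le> p $ k}\<bar> \<le> e / 2"
    by (rule cadlag_cover[OF assms(1) \<open>e / 2 > 0\<close>]) blast
  define Z where "Z = (\<Union>x\<in>X. range (\<lambda>k. x $ k))"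
  define \<delta>0 where "\<delta>0 = Min (insert 1 ((\<lambda>x. \<delta> x / 2) ` X))"
  have "\<delta>0 > 0" using X(1,2) by (simp add: \<delta>0_def)
  moreover have "finite Z" using X(1) by (simp add: Z_def)
  moreover have "\<bar>G p - G q\<bar> \<le> e" if pq: "\<And>k. 0 \<le> p $ k \<and> p $ k \<le> 1" "\<And>k. \<bar>p $ k - q $ k\<bar> < \<delta>0"
    "\<And>k c. c \<in> Z \<Longrightarrow> c \<le> p $ k \<longleftrightarrow> c \<le> q $ k" for p q
  proof -
    obtain x where x: "x \<in> X" "\<forall>k. \<bar>p $ k - x $ k\<bar> < \<delta> x / 2" using X(3)[OF pq(1)] by blast
    have "\<delta>0 \<le> \<delta> x / 2" unfolding \<delta>0_def using X(1) x(1) by (intro Min_le) auto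
    have near: "\<bar>p $ k - x $ k\<bar> < \<delta> x" "\<bar>q $ k - x $ k\<bar> < \<delta> x" for k
      using x(2)[rule_format, of k] X(2)[of x] pq(2)[of k] \<open>\<delta>0 \<le> \<delta> x / 2\<close> by linarith+
    have 1: "\<bar>G p - l x {k. x $ k \<le> p $ k}\<bar> \<le> e / 2" "\<bar>G q - l x {k. x $ k \<le> q $ k}\<bar> \<le> e / 2"
      by (rule X(4), rule near)+
    have 2: "{k. x $ k \<le> p $ k} = {k. x $ k \<le> q $ k}"
    proof -
      have "x $ k \<in> Z" for k using x(1) by (auto simp: Z_def)
      then show ?thesis using pq(3) by blast
    qed
    show ?thesis using 1 unfolding 2 by linarith
  qed
  ultimately show ?thesis using that by blast
qed

section \<open>Counting lattice points near hyperplanes\<close>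

lemma int_near_subset: "{z :: int. \<bar>real_of_int z - r\<bar> \<le> real m} \<subseteq> {\<lceil>r\<rceil> - int m..\<lfloor>r\<rfloor> + int m}"
proof safe
  fix z :: int assume z: "\<bar>real_of_int z - r\<bar> \<le> real m"
  then have "r \<le> real_of_int (z + int m)" "real_of_int (z - int m) \<le> r" by auto
  then have "\<lceil>r\<rceil> \<le> z + int m" "z - int m \<le> \<lfloor>r\<rfloor>" by (simp_all only: ceiling_le_iff le_floor_iff)
  then show "z \<in> {\<lceil>r\<rceil> - int m..\<lfloor>r\<rfloor> + int m}" by simp
qed

lemma card_int_near: "card {z :: int. \<bar>real_of_int z - r\<bar> \<le> real m} \<le> 2 * m + 1"
proof -
  have "card {z :: int. \<bar>real_of_int z - r\<bar> \<le> real m} \<le> card {\<lceil>r\<rceil> - int m..\<lfloor>r\<rfloor> + int m}"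
    by (intro card_mono int_near_subset) auto
  also have "\<dots> \<le> 2 * m + 1"
  proof -
    have "\<lfloor>r\<rfloor> \<le> \<lceil>r\<rceil>" by linarith
    then show ?thesis by (simp add: nat_le_iff)
  qed
  finally show ?thesis .
qed

lemma card_near_hyperplane:
  "card {y \<in> sites N :: (int ^ 'd::finite) set. \<bar>real_of_int (y $ k) - r\<bar> \<le> real m} \<le> (2 * m + 1) * N ^ (CARD('d) - 1)"
proof -
  define S where "S j = (if j = k then {0..<int N} \<inter> {z. \<bar>real_of_int z - r\<bar> \<le> real m} else {0..<int N})" for j
  have eq: "{y \<in> sites N :: (int ^ 'd) set. \<bar>real_of_int (y $ k) - r\<bar> \<le> real m} = {y. \<forall>j. y $ j \<in> S j}"
    by (auto simp: S_def sites_def)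
  have "card {y :: int ^ 'd. \<forall>j. y $ j \<in> S j} = card (S k) * (\<Prod>j\<in>UNIV - {k}. card (S j))"
    unfolding card_vec_box by (subst prod.remove[of _ k]) auto
  also have "(\<Prod>j\<in>UNIV - {k}. card (S j)) = (\<Prod>j\<in>UNIV - {k}. N)"
    by (rule prod.cong) (auto simp: S_def)
  also have "\<dots> = N ^ (CARD('d) - 1)" by (simp add: card_Diff_singleton)
  also have "card (S k) \<le> 2 * m + 1"
  proof (rule order_trans[OF card_mono card_int_near[of r m]])
    show "finite {z :: int. \<bar>real_of_int z - r\<bar> \<le> real m}"
      by (rule finite_subset[OF int_near_subset]) simp
  qed (auto simp: S_def)
  finally show ?thesis by (simp add: eq)
qed

lemma site_point_unit:
  assumes "N \<ge> 1" "x \<in> sites N"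
  shows "0 \<le> site_point N x $ k \<and> site_point N x $ k \<le> 1"
proof -
  have "0 \<le> x $ k" "x $ k < int N" using assms by (auto simp: sites_def)
  then have "0 \<le> real_of_int (x $ k)" "real_of_int (x $ k) \<le> real N" by linarith+
  then show ?thesis using assms by (simp add: site_point_def)
qed

text \<open>A bad site lies within lattice distance m, a bound for the coordinates of v, of one of
  finitely many coordinate hyperplanes. That leaves order N^(d-1) sites out of N^d.\<close>

lemma few_bad_sites:
  fixes G :: "real ^ 'd::finite \<Rightarrow> real" and v :: "int ^ 'd"
  assumes "cadlag G" "e > 0"
  shows "\<forall>\<^sub>F N in sequentially. real (card {y \<in> sites N. \<not> (y - v \<in> sites N \<and>
     \<bar>G (site_point N y) - G (site_point N (y - v))\<bar> \<le> e)}) \<le> e * real N ^ CARD('d)"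
proof -
  obtain Z :: "real set" and \<delta> where Z: "finite Z" "\<delta> > 0"
    "\<And>p q. (\<And>k. 0 \<le> p $ k \<and> p $ k \<le> 1) \<Longrightarrow> (\<And>k. \<bar>p $ k - q $ k\<bar> < \<delta>)
        \<Longrightarrow> (\<And>k c. c \<in> Z \<Longrightarrow> c \<le> p $ k \<longleftrightarrow> c \<le> q $ k) \<Longrightarrow> \<bar>G p - G q\<bar> \<le> e"
    by (rule cadlag_oscillation[OF assms]) blast
  \<comment> \<open>The faces 0 and 1 are added so that a site far from all hyperplanes also keeps y
    - v inside the cube, without wrapping around.\<close>
  define Z' where "Z' = insert 0 (insert 1 Z)"
  define m where "m = (\<Sum>k\<in>UNIV. nat \<bar>v $ k\<bar>)"
  have m: "\<bar>v $ k\<bar> \<le> int m" for k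
  proof -
    have "nat \<bar>v $ k\<bar> \<le> m" unfolding m_def by (rule member_le_sum) auto
    then show ?thesis by linarith
  qed
  define K where "K = CARD('d) * card Z' * (2 * m + 1)"
  have bad: "card {y \<in> sites N. \<not> (y - v \<in> sites N \<and>
     \<bar>G (site_point N y) - G (site_point N (y - v))\<bar> \<le> e)} \<le> K * N ^ (CARD('d) - 1)" (is "card ?B \<le> _")
    if N: "N \<ge> 1" "real m / \<delta> < real N" for N
  proof -
    have "?B \<subseteq> (\<Union>(k, c)\<in>UNIV \<times> Z'. {y \<in> sites N. \<bar>real_of_int (y $ k) - c * real N\<bar> \<le> real m})"
    proof (rule ccontr)
      assume "\<not> ?thesis"
      then obtain y where y: "y \<in> ?B"
        and y': "y \<notin> (\<Union>(k, c)\<in>UNIV \<times> Z'. {y \<in> sites N. \<bar>real_of_int (y $ k) - c * real N\<bar> \<le> real m})"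
        by blast
      have far: "\<bar>real_of_int (y $ k) - c * real N\<bar> > real m" if "c \<in> Z'" for k c
      proof (rule ccontr)
        assume "\<not> ?thesis"
        with y have "y \<in> {y \<in> sites N. \<bar>real_of_int (y $ k) - c * real N\<bar> \<le> real m}"
          by (simp add: not_less)
        then show False using y' that by blast
      qed
      have ys: "0 \<le> y $ k" "y $ k < int N" for k using y by (auto simp: sites_def)
      have vm: "\<bar>real_of_int (v $ k)\<bar> \<le> real m" for k using m[of k] by (metis of_int_abs of_int_le_iff of_int_of_nat_eq)
      have "0 \<le> (y - v) $ k \<and> (y - v) $ k < int N" for k
        using far[of 0 k] far[of 1 k] ys[of k] m[of k] by (auto simp: Z'_def)
      then have "y - v \<in> sites N" by (simp add: sites_def)
      moreover have "\<bar>G (site_point N y) - G (site_point N (y - v))\<bar> \<le> e"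
      proof (rule Z(3))
        fix k
        show "0 \<le> site_point N y $ k \<and> site_point N y $ k \<le> 1"
          using ys[of k] N by (simp add: site_point_def field_simps)
        have "real m < \<delta> * real N" using N Z(2) by (simp add: field_simps)
        with vm[of k] have "\<bar>real_of_int (v $ k)\<bar> < \<delta> * real N" by linarith
        moreover have "site_point N y $ k - site_point N (y - v) $ k = real_of_int (v $ k) / real N"
          by (simp add: site_point_def diff_divide_distrib)
        ultimately show "\<bar>site_point N y $ k - site_point N (y - v) $ k\<bar> < \<delta>"
          using N by (simp only: abs_divide) (simp add: field_simps)
        fix c assume "c \<in> Z"
        then have "\<bar>real_of_int (y $ k) - c * real N\<bar> > real m" by (intro far) (simp add: Z'_def)
        moreover have "c \<le> site_point N y $ k \<longleftrightarrow> c * real N \<le> real_of_int (y $ k)"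
          "c \<le> site_point N (y - v) $ k \<longleftrightarrow> c * real N \<le> real_of_int (y $ k) - real_of_int (v $ k)"
          using N by (simp_all add: site_point_def field_simps)
        ultimately show "c \<le> site_point N y $ k \<longleftrightarrow> c \<le> site_point N (y - v) $ k"
          using vm[of k] by auto
      qed
      ultimately show False using y by simp
    qed
    then have "card ?B \<le> card (\<Union>(k, c)\<in>UNIV \<times> Z'. {y \<in> sites N :: (int ^ 'd) set. \<bar>real_of_int (y $ k) - c * real N\<bar> \<le> real m})"
      using Z(1) by (intro card_mono) (auto simp: Z'_def)
    also have "\<dots> \<le> (\<Sum>(k, c)\<in>UNIV \<times> Z'. card {y \<in> sites N :: (int ^ 'd) set. \<bar>real_of_int (y $ k) - c * real N\<bar> \<le> real m})"
      unfolding case_prod_beta using Z(1) by (intro card_UN_le) (auto simp: Z'_def)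
    also have "\<dots> \<le> (\<Sum>(k::'d, c)\<in>UNIV \<times> Z'. (2 * m + 1) * N ^ (CARD('d) - 1))"
      unfolding case_prod_beta by (intro sum_mono card_near_hyperplane)
    also have "\<dots> = K * N ^ (CARD('d) - 1)" by (simp add: K_def card_cartesian_product algebra_simps)
    finally show ?thesis .
  qed
  \<comment> \<open>The first threshold makes the displacement v/N smaller than \<delta>, the second
    absorbs K N^(d-1) into e N^d.\<close>
  have "\<forall>\<^sub>F N in sequentially. real N > max (real m / \<delta>) (real K / e)"
    using filterlim_real_sequentially unfolding filterlim_at_top_dense by blast
  then show ?thesis using eventually_ge_at_top[of 1]
  proof eventually_elim
    case (elim N)
    have "real (card {y \<in> sites N. \<not> (y - v \<in> sites N \<and>
     \<bar>G (site_point N y) - G (site_point N (y - v))\<bar> \<le> e)}) \<le> real (K * N ^ (CARD('d) - 1))"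
      unfolding of_nat_le_iff using elim by (intro bad) auto
    also have "\<dots> \<le> (e * real N) * real N ^ (CARD('d) - 1)"
      using elim assms(2) by (simp add: field_simps)
    also have "\<dots> = e * real N ^ CARD('d)"
      by (metis mult.assoc power_minus_mult mult.commute zero_less_card_finite)
    finally show ?case .
  qed
qed

section \<open>Periodic configurations and the Bernoulli measure\<close>

definition modN :: "nat \<Rightarrow> int ^ 'd::finite \<Rightarrow> int ^ 'd" where
  "modN N x = (\<chi> k. x $ k mod int N)"

lemma modN_in_sites: "N > 0 \<Longrightarrow> modN N x \<in> sites N"
  by (simp add: modN_def sites_def)

lemma modN_id: "x \<in> sites N \<Longrightarrow> modN N x = x"
  by (simp add: modN_def sites_def vec_eq_iff)

lemma modN_idem [simp]: "modN N (modN N x) = modN N x"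
  by (simp add: modN_def vec_eq_iff)

lemma modN_eq_iff: "modN N x = modN N y \<longleftrightarrow> (\<forall>k. int N dvd x $ k - y $ k)"
  by (simp add: modN_def vec_eq_iff mod_eq_dvd_iff)

lemma modN_add_left [simp]: "modN N (modN N x + y) = modN N (x + y)"
  by (simp add: modN_def vec_eq_iff mod_simps)

lemma modN_diff_left [simp]: "modN N (modN N x - y) = modN N (x - y)"
  by (simp add: modN_def vec_eq_iff mod_simps)

lemma modN_add_right [simp]: "modN N (x + modN N y) = modN N (x + y)"
  by (simp add: modN_def vec_eq_iff mod_simps)

lemma modN_add_cancel: "modN N (x + z) = modN N (y + z) \<longleftrightarrow> modN N x = modN N y"
  by (simp add: modN_eq_iff)

lemma configs_iff: "\<eta> \<in> configs N \<longleftrightarrow> (\<forall>x y. modN N x = modN N y \<longrightarrow> \<eta> x = \<eta> y)"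
  by (simp add: configs_def modN_eq_iff)

lemma configs_modN: "\<eta> \<in> configs N \<Longrightarrow> \<eta> (modN N x) = \<eta> x"
  unfolding configs_iff by (metis modN_idem)

lemma occ_modN: "\<eta> \<in> configs N \<Longrightarrow> occ \<eta> (modN N x) = occ \<eta> x"
  by (simp add: occ_def configs_modN)

lemma bij_configs_PiE:
  assumes "N > 0"
  shows "bij_betw (\<lambda>\<eta>. restrict \<eta> (sites N)) (configs N) (sites N \<rightarrow>\<^sub>E (UNIV :: bool set))"
proof (rule bij_betw_byWitness[where f' = "\<lambda>f x. f (modN N x)"])
  show "\<forall>\<eta>\<in>configs N. (\<lambda>x. restrict \<eta> (sites N) (modN N x)) = \<eta>"
    using assms by (simp add: configs_modN modN_in_sites)
  show "\<forall>f\<in>sites N \<rightarrow>\<^sub>E UNIV. restrict (\<lambda>x. f (modN N x)) (sites N) = f"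
    by (auto simp: fun_eq_iff modN_id restrict_def PiE_def extensional_def)
  show "(\<lambda>f x. f (modN N x)) ` (sites N \<rightarrow>\<^sub>E UNIV) \<subseteq> configs N"
    by (auto simp only: configs_iff)
qed auto

lemma finite_configs [simp]:
  assumes "N > 0" shows "finite (configs N :: ('d::finite) config set)"
  using bij_betw_finite[OF bij_configs_PiE[OF assms, where 'a = 'd]] by (simp add: finite_PiE)

lemma sum_configs_prod:
  fixes F :: "int ^ 'd::finite \<Rightarrow> bool \<Rightarrow> real"
  assumes "N > 0"
  shows "(\<Sum>\<eta>\<in>configs N. \<Prod>x\<in>sites N. F x (\<eta> x)) = (\<Prod>x\<in>sites N. F x True + F x False)"
proof -
  have "(\<Sum>\<eta>\<in>configs N. \<Prod>x\<in>sites N. F x (\<eta> x))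
      = (\<Sum>\<eta>\<in>configs N. \<Prod>x\<in>sites N. F x (restrict \<eta> (sites N) x))"
    by simp
  also have "\<dots> = (\<Sum>f\<in>sites N \<rightarrow>\<^sub>E UNIV. \<Prod>x\<in>sites N. F x (f x))"
    by (rule sum.reindex_bij_betw[OF bij_configs_PiE[OF assms]])
  also have "\<dots> = (\<Prod>x\<in>sites N. \<Sum>y\<in>UNIV. F x y)"
    by (rule prod_sum_PiE[symmetric]) auto
  finally show ?thesis by (simp add: UNIV_bool add.commute)
qed

lemma bernoulli_product_support:
  assumes "N > 0" shows "set_pmf (bernoulli_product N r) \<subseteq> configs N"
  by (auto simp: bernoulli_product_def configs_iff modN_def[symmetric])

lemma pmf_bernoulli_product:
  assumes N: "N > 0" and \<eta>: "\<eta> \<in> configs N"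
  shows "pmf (bernoulli_product N r) \<eta> = (\<Prod>x\<in>sites N. pmf (bernoulli_pmf r) (\<eta> x))"
proof -
  let ?Q = "Pi_pmf (sites N) False (\<lambda>_. bernoulli_pmf r)"
  \<comment> \<open>The default value False outside the sites makes z the only possible preimage of
    \<eta> within the support of \<open>Pi_pmf\<close>.\<close>
  define z where "z x = (if x \<in> sites N then \<eta> x else False)" for x
  have "(\<lambda>\<zeta> x. \<zeta> (\<chi> k. x $ k mod int N)) -` {\<eta>} \<inter> set_pmf ?Q = {z} \<inter> set_pmf ?Q"
  proof (intro equalityI subsetI)
    fix \<zeta> assume *: "\<zeta> \<in> (\<lambda>\<zeta> x. \<zeta> (\<chi> k. x $ k mod int N)) -` {\<eta>} \<inter> set_pmf ?Q"
    then have "\<zeta> \<in> PiE_dflt (sites N) False (\<lambda>_. set_pmf (bernoulli_pmf r))"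
      by (simp add: set_Pi_pmf)
    then have "\<zeta> x = False" if "x \<notin> sites N" for x using that by (auto simp: PiE_dflt_def)
    moreover have "\<zeta> x = \<eta> x" if "x \<in> sites N" for x
      using * modN_id[OF that] by (auto simp: modN_def)
    ultimately have "\<zeta> = z" by (auto simp: z_def fun_eq_iff)
    with * show "\<zeta> \<in> {z} \<inter> set_pmf ?Q" by simp
  next
    fix \<zeta> assume "\<zeta> \<in> {z} \<inter> set_pmf ?Q"
    then show "\<zeta> \<in> (\<lambda>\<zeta> x. \<zeta> (\<chi> k. x $ k mod int N)) -` {\<eta>} \<inter> set_pmf ?Q"
      using modN_in_sites[OF N] configs_modN[OF \<eta>] by (auto simp: z_def modN_def)
  qed
  then have "pmf (bernoulli_product N r) \<eta> = pmf ?Q z"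
    using measure_Int_set_pmf[of ?Q "(\<lambda>\<zeta> x. \<zeta> (\<chi> k. x $ k mod int N)) -` {\<eta>}"] measure_Int_set_pmf[of ?Q "{z}"]
    unfolding bernoulli_product_def pmf_map pmf.rep_eq by (simp only: measure_map_pmf)
  also have "\<dots> = (\<Prod>x\<in>sites N. pmf (bernoulli_pmf r) (z x))"
    by (rule pmf_Pi') (auto simp: z_def)
  finally show ?thesis by (simp add: z_def)
qed

lemma expectation_bernoulli_product:
  assumes "N > 0"
  shows "measure_pmf.expectation (bernoulli_product N r) f
    = (\<Sum>\<eta>\<in>configs N. pmf (bernoulli_product N r) \<eta> * f \<eta>)"
  using assms bernoulli_product_support[OF assms, of r]
  by (subst integral_measure_pmf_real[of "configs N"]) (auto simp: mult.commute)

lemma bernoulli_product_total: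
  "N > 0 \<Longrightarrow> sum (pmf (bernoulli_product N r)) (configs N) = 1"
  by (intro sum_pmf_eq_1 finite_configs bernoulli_product_support)

lemma exchange_eq:
  "exchange N x y \<eta> z = (if modN N z = modN N x then \<eta> y else if modN N z = modN N y then \<eta> x else \<eta> z)"
  by (simp add: exchange_def modN_eq_iff)

lemma exchange_configs:
  assumes "\<eta> \<in> configs N" shows "exchange N x y \<eta> \<in> configs N"
proof -
  have "exchange N x y \<eta> u = exchange N x y \<eta> v" if "modN N u = modN N v" for u v
  proof -
    have "\<eta> u = \<eta> v" using assms that unfolding configs_iff by blast
    then show ?thesis by (simp add: exchange_eq that)
  qed
  then show ?thesis unfolding configs_iff by blast
qed

lemma exchange_exchange:
  assumes "\<eta> \<in> configs N" shows "exchange N x y (exchange N x y \<eta>) = \<eta>"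
proof
  fix z
  have "modN N z = modN N x \<Longrightarrow> \<eta> z = \<eta> x" "modN N z = modN N y \<Longrightarrow> \<eta> z = \<eta> y"
    using assms unfolding configs_iff by blast+
  then show "exchange N x y (exchange N x y \<eta>) z = \<eta> z"
    unfolding exchange_eq by (smt (verit))
qed

lemma pmf_exchange:
  assumes N: "N > 0" and \<eta>: "\<eta> \<in> configs N"
  shows "pmf (bernoulli_product N r) (exchange N x y \<eta>) = pmf (bernoulli_product N r) \<eta>"
proof -
  \<comment> \<open>The exchange as an involution of the sites; reindexing along it preserves a
    product of identical marginals.\<close>
  define \<tau> where "\<tau> z = (if z = modN N x then modN N y else if z = modN N y then modN N x else z)" for z
  have ex: "exchange N x y \<eta> z = \<eta> (\<tau> z)" if "z \<in> sites N" for z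
    using that \<eta> by (simp add: exchange_eq \<tau>_def modN_id configs_modN)
  have "(\<Prod>z\<in>sites N. pmf (bernoulli_pmf r) (exchange N x y \<eta> z)) = (\<Prod>z\<in>sites N. pmf (bernoulli_pmf r) (\<eta> (\<tau> z)))"
    by (intro prod.cong) (auto simp: ex)
  also have "\<dots> = (\<Prod>z\<in>sites N. pmf (bernoulli_pmf r) (\<eta> z))"
    by (rule prod.reindex_bij_witness[of _ \<tau> \<tau>]) (auto simp: \<tau>_def modN_in_sites[OF N])
  finally show ?thesis by (simp add: pmf_bernoulli_product N \<eta> exchange_configs)
qed

lemma sum_exchange:
  assumes N: "N > 0"
  shows "(\<Sum>\<eta>\<in>configs N. pmf (bernoulli_product N r) \<eta> * f (exchange N x y \<eta>))
    = (\<Sum>\<eta>\<in>configs N. pmf (bernoulli_product N r) \<eta> * f \<eta>)"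
  by (rule sum.reindex_bij_witness[of _ "exchange N x y" "exchange N x y"])
    (auto simp: exchange_configs exchange_exchange pmf_exchange N)

section \<open>Orthogonality of centred products\<close>

definition cocc :: "real \<Rightarrow> 'd::finite config \<Rightarrow> (int ^ 'd) set \<Rightarrow> real" where
  "cocc \<rho> \<eta> S = (\<Prod>s\<in>S. occ \<eta> s - \<rho>)"

lemma expectation_prod:
  fixes F :: "int ^ 'd::finite \<Rightarrow> bool \<Rightarrow> real"
  assumes N: "N > 0" and r: "0 \<le> r" "r \<le> 1"
  shows "(\<Sum>\<eta>\<in>configs N. pmf (bernoulli_product N r) \<eta> * (\<Prod>x\<in>sites N. F x (\<eta> x)))
    = (\<Prod>x\<in>sites N. r * F x True + (1 - r) * F x False)"
proof -
  have "(\<Sum>\<eta>\<in>configs N. pmf (bernoulli_product N r) \<eta> * (\<Prod>x\<in>sites N. F x (\<eta> x)))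
      = (\<Sum>\<eta>\<in>configs N. \<Prod>x\<in>sites N. pmf (bernoulli_pmf r) (\<eta> x) * F x (\<eta> x))"
    by (intro sum.cong) (auto simp: pmf_bernoulli_product N prod.distrib)
  also have "\<dots> = (\<Prod>x\<in>sites N. pmf (bernoulli_pmf r) True * F x True + pmf (bernoulli_pmf r) False * F x False)"
    by (rule sum_configs_prod[OF N])
  finally show ?thesis using r by simp
qed

text \<open>The density r of the measure and the centring \<rho> are kept apart because the mean is
  later differentiated in r at \<rho>.\<close>

lemma expectation_cocc:
  assumes N: "N > 0" and r: "0 \<le> r" "r \<le> 1" and S: "S \<subseteq> sites N"
  shows "(\<Sum>\<eta>\<in>configs N. pmf (bernoulli_product N r) \<eta> * cocc \<rho> \<eta> S) = (r - \<rho>) ^ card S"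
proof -
  define F where "F x e = (if x \<in> S then of_bool e - \<rho> else 1)" for x :: "int ^ 'a" and e
  have "cocc \<rho> \<eta> S = (\<Prod>x\<in>sites N. F x (\<eta> x))" for \<eta> :: "'a config"
    unfolding cocc_def F_def occ_def using S by (subst prod.If_cases) (auto simp: Int_absorb1)
  then have "(\<Sum>\<eta>\<in>configs N. pmf (bernoulli_product N r) \<eta> * cocc \<rho> \<eta> S)
     = (\<Prod>x\<in>sites N. r * F x True + (1 - r) * F x False)"
    by (simp only: expectation_prod[OF N r])
  also have "\<dots> = (\<Prod>x\<in>sites N. if x \<in> S then r - \<rho> else 1)"
    by (intro prod.cong) (auto simp: F_def algebra_simps)
  also have "\<dots> = (r - \<rho>) ^ card S"
    using S by (subst prod.If_cases) (auto simp: Int_absorb1)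
  finally show ?thesis .
qed

text \<open>A site belonging to just one of the sets contributes a factor of mean zero; a common
  site contributes r(1 - r), which is at most 1.\<close>

lemma expectation_cocc_cocc:
  assumes N: "N > 0" and r: "0 \<le> r" "r \<le> 1" and S: "S \<subseteq> sites N" "S' \<subseteq> sites N"
  shows "\<bar>\<Sum>\<eta>\<in>configs N. pmf (bernoulli_product N r) \<eta> * (cocc r \<eta> S * cocc r \<eta> S')\<bar> \<le> of_bool (S = S')"
proof -
  define F where "F x e = (if x \<in> S then of_bool e - r else 1) * (if x \<in> S' then of_bool e - r else 1)"
    for x :: "int ^ 'a" and e
  have "cocc r \<eta> S * cocc r \<eta> S' = (\<Prod>x\<in>sites N. F x (\<eta> x))" for \<eta> :: "'a config"
    unfolding cocc_def F_def occ_def prod.distrib using S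
    by (subst prod.If_cases, simp, subst prod.If_cases) (auto simp: Int_absorb1)
  then have "(\<Sum>\<eta>\<in>configs N. pmf (bernoulli_product N r) \<eta> * (cocc r \<eta> S * cocc r \<eta> S'))
     = (\<Prod>x\<in>sites N. r * F x True + (1 - r) * F x False)"
    by (simp only: expectation_prod[OF N r])
  also have "\<bar>\<dots>\<bar> = (\<Prod>x\<in>sites N. \<bar>r * F x True + (1 - r) * F x False\<bar>)" by (rule abs_prod)
  also have "\<dots> \<le> of_bool (S = S')"
  proof (cases "S = S'")
    case True
    have "\<bar>r * F x True + (1 - r) * F x False\<bar> \<le> 1" for x
    proof -
      have "r * ((1 - r) * (1 - r)) + (1 - r) * (r * r) = r * (1 - r)" by (simp add: algebra_simps)
      moreover have "0 \<le> r * (1 - r)" "r * (1 - r) \<le> 1 * 1" using r by (auto intro!: mult_le_one)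
      ultimately show ?thesis using True by (auto simp: F_def)
    qed
    then show ?thesis using True by (auto intro!: prod_le_1)
  next
    case False
    then obtain s where s: "s \<in> S \<union> S'" "\<not> (s \<in> S \<and> s \<in> S')" by blast
    then have "r * F s True + (1 - r) * F s False = 0" by (auto simp: F_def algebra_simps)
    moreover have "s \<in> sites N" using s S by auto
    ultimately have "(\<Prod>x\<in>sites N. \<bar>r * F x True + (1 - r) * F x False\<bar>) = 0"
      by (intro prod_zero) (auto intro!: bexI[of _ s])
    then show ?thesis by (rule ord_eq_le_trans) simp
  qed
  finally show ?thesis .
qed

text \<open>Different indices may name the same set. By orthogonality only pairs with
  \<open>S i = S j\<close> contribute, each index has at most m partners, and the cross terms are
  split into squares.\<close>

lemma variance_bound:
  assumes N: "N > 0" and r: "0 \<le> r" "r \<le> 1" and I: "finite I"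
    and S: "\<And>i. i \<in> I \<Longrightarrow> S i \<subseteq> sites N"
    and mult: "\<And>i. i \<in> I \<Longrightarrow> card {j \<in> I. S j = S i} \<le> m"
  shows "(\<Sum>\<eta>\<in>configs N. pmf (bernoulli_product N r) \<eta> * (\<Sum>i\<in>I. c i * cocc r \<eta> (S i))\<^sup>2)
    \<le> real m * (\<Sum>i\<in>I. (c i)\<^sup>2)"
proof -
  let ?e = "\<lambda>i j. of_bool (S i = S j) :: real"
  have "(\<Sum>\<eta>\<in>configs N. pmf (bernoulli_product N r) \<eta> * (\<Sum>i\<in>I. c i * cocc r \<eta> (S i))\<^sup>2)
      = (\<Sum>\<eta>\<in>configs N. \<Sum>i\<in>I. \<Sum>j\<in>I. c i * c j * (pmf (bernoulli_product N r) \<eta> * (cocc r \<eta> (S i) * cocc r \<eta> (S j))))"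
    unfolding power2_eq_square sum_product unfolding sum_distrib_left
    by (intro sum.cong refl) (simp only: mult_ac)
  also have "\<dots> = (\<Sum>i\<in>I. \<Sum>j\<in>I. c i * c j * (\<Sum>\<eta>\<in>configs N. pmf (bernoulli_product N r) \<eta> * (cocc r \<eta> (S i) * cocc r \<eta> (S j))))"
    unfolding sum_distrib_left by (subst sum.swap, intro sum.cong refl, rule sum.swap)
  also have "\<dots> \<le> (\<Sum>i\<in>I. \<Sum>j\<in>I. \<bar>c i * c j\<bar> * ?e i j)"
  proof (intro sum_mono)
    fix i j assume "i \<in> I" "j \<in> I"
    then have "\<bar>c i * c j\<bar> * \<bar>\<Sum>\<eta>\<in>configs N. pmf (bernoulli_product N r) \<eta> * (cocc r \<eta> (S i) * cocc r \<eta> (S j))\<bar>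
      \<le> \<bar>c i * c j\<bar> * ?e i j"
      by (intro mult_left_mono expectation_cocc_cocc N r S) auto
    then show "c i * c j * (\<Sum>\<eta>\<in>configs N. pmf (bernoulli_product N r) \<eta> * (cocc r \<eta> (S i) * cocc r \<eta> (S j)))
      \<le> \<bar>c i * c j\<bar> * ?e i j"
      unfolding abs_mult[symmetric] by linarith
  qed
  also have "\<dots> \<le> (\<Sum>i\<in>I. \<Sum>j\<in>I. ((c i)\<^sup>2 / 2 + (c j)\<^sup>2 / 2) * ?e i j)"
  proof (intro sum_mono mult_right_mono)
    fix i j
    have "0 \<le> (\<bar>c i\<bar> - \<bar>c j\<bar>)\<^sup>2" by simp
    then show "\<bar>c i * c j\<bar> \<le> (c i)\<^sup>2 / 2 + (c j)\<^sup>2 / 2"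
      by (simp add: power2_eq_square abs_mult algebra_simps)
  qed auto
  also have "\<dots> = (\<Sum>i\<in>I. \<Sum>j\<in>I. (c i)\<^sup>2 / 2 * ?e i j) + (\<Sum>i\<in>I. \<Sum>j\<in>I. (c j)\<^sup>2 / 2 * ?e i j)"
    by (simp add: distrib_right sum.distrib)
  also have "(\<Sum>i\<in>I. \<Sum>j\<in>I. (c j)\<^sup>2 / 2 * ?e i j) = (\<Sum>i\<in>I. \<Sum>j\<in>I. (c i)\<^sup>2 / 2 * ?e i j)"
    by (subst sum.swap) (simp add: eq_commute)
  also have "(\<Sum>i\<in>I. \<Sum>j\<in>I. (c i)\<^sup>2 / 2 * ?e i j) + (\<Sum>i\<in>I. \<Sum>j\<in>I. (c i)\<^sup>2 / 2 * ?e i j)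
      = (\<Sum>i\<in>I. (c i)\<^sup>2 * (\<Sum>j\<in>I. ?e i j))"
    by (simp add: sum.distrib[symmetric] sum_distrib_left distrib_right[symmetric])
  also have "\<dots> \<le> (\<Sum>i\<in>I. (c i)\<^sup>2 * real m)"
  proof (intro sum_mono mult_left_mono)
    fix i assume "i \<in> I"
    have "(\<Sum>j\<in>I. ?e i j) = real (card {j \<in> I. S j = S i})"
      using I by (simp add: of_bool_def sum.If_cases Int_def eq_commute)
    also have "\<dots> \<le> real m" using mult[OF \<open>i \<in> I\<close>] by simp
    finally show "(\<Sum>j\<in>I. ?e i j) \<le> real m" .
  qed auto
  finally show ?thesis by (simp add: sum_distrib_left mult.commute)
qed

section \<open>The Dirichlet form of the exclusion process\<close>

lemma axis_add: "axis j (m::int) + axis j n = axis j (m + n)"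
  by (simp add: vec_eq_iff axis_def)

lemma modN_axis_eq:
  "modN N (x + axis j m) = modN N (x + axis j n) \<longleftrightarrow> int N dvd m - n"
proof
  assume "int N dvd m - n"
  then show "modN N (x + axis j m) = modN N (x + axis j n)"
    by (auto simp: modN_eq_iff axis_def)
next
  assume "modN N (x + axis j m) = modN N (x + axis j n)"
  then have "int N dvd (x + axis j m) $ j - (x + axis j n) $ j"
    unfolding modN_eq_iff by (rule spec)
  then show "int N dvd m - n" by (simp add: axis_def)
qed

locale exclusion_env =
  fixes W :: "'d::finite \<Rightarrow> real \<Rightarrow> real" and env :: "'d \<Rightarrow> int ^ 'd \<Rightarrow> real" and \<theta> b \<rho> :: real
  assumes W: "\<And>k. admissible_W (W k)" and b: "b > - 1 / 2" and rho: "0 \<le> \<rho>" "\<rho> \<le> 1"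
    and theta: "\<theta> > 0" and env: "\<And>j x. inverse \<theta> \<le> env j x"
begin

definition rate :: "nat \<Rightarrow> 'd \<Rightarrow> int ^ 'd \<Rightarrow> 'd config \<Rightarrow> real" where
  "rate N j x \<eta> = (real N)\<^sup>2 * conductance W env N x j * speed b x j \<eta>"

abbreviation swap :: "nat \<Rightarrow> 'd \<Rightarrow> int ^ 'd \<Rightarrow> 'd config \<Rightarrow> 'd config" where
  "swap N j x \<equiv> exchange N x (x + axis j 1)"

abbreviation gen :: "nat \<Rightarrow> ('d config \<Rightarrow> real) \<Rightarrow> 'd config \<Rightarrow> real" where
  "gen N \<equiv> \<lambda>h \<eta>. (real N)\<^sup>2 * L_N W env b N h \<eta>"

abbreviation wt :: "nat \<Rightarrow> 'd config \<Rightarrow> real" where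
  "wt N \<equiv> pmf (bernoulli_product N \<rho>)"

lemma gen_eq: "gen N h \<eta> = (\<Sum>j\<in>UNIV. \<Sum>x\<in>sites N. rate N j x \<eta> * (h (swap N j x \<eta>) - h \<eta>))"
  by (simp add: L_N_def rate_def sum_distrib_left mult_ac)

definition W_total :: real where "W_total = (\<Sum>k\<in>UNIV. W k 1 - W k 0)"

text \<open>A lower bound for the rates divided by N: \<open>min 1 (1 + 2 * b)\<close> is the least
  of the speeds 1, 1 + b, 1 + 2b, the environment is at least 1/\<theta>, and \<open>W_total\<close>
  exceeds the increment of W over any bond.\<close>

definition \<kappa> :: real where "\<kappa> = min 1 (1 + 2 * b) / (\<theta> * W_total)"

lemma W_mono: "x < y \<Longrightarrow> W k x < W k y"
  using W[of k] by (simp add: admissible_W_def strict_mono_def)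

lemma W_total_pos: "W_total > 0"
  unfolding W_total_def by (intro sum_pos) (auto intro: W_mono)

lemma kappa_pos: "\<kappa> > 0"
  using W_total_pos theta b by (simp add: \<kappa>_def)

lemma speed_ge: "min 1 (1 + 2 * b) \<le> speed b x j \<eta>"
  using b by (auto simp: speed_def occ_def of_bool_def min_def)

text \<open>An atom of \<open>W\<close> only lowers a conductance to order \<open>1/N\<close>, so after the time scaling by \<open>N\<^sup>2\<close>
  every bond still exchanges at a rate of order at least \<open>N\<close>.\<close>

lemma rate_ge:
  assumes N: "N \<ge> 1" and x: "x \<in> sites N"
  shows "\<kappa> * real N \<le> rate N j x \<eta>"
proof -
  define D where "D = W_sum W (site_point N (x + axis j 1)) - W_sum W (site_point N x)"
  have "D = (\<Sum>k\<in>UNIV. W k (site_point N (x + axis j 1) $ k) - W k (site_point N x $ k))"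
    by (simp add: D_def W_sum_def sum_subtractf)
  also have "\<dots> = (\<Sum>k\<in>UNIV. if k = j then W j ((real_of_int (x $ j) + 1) / real N) - W j (real_of_int (x $ j) / real N) else 0)"
    by (intro sum.cong) (auto simp: site_point_def axis_def)
  finally have D: "D = W j ((real_of_int (x $ j) + 1) / real N) - W j (real_of_int (x $ j) / real N)" by simp
  have xj: "0 \<le> x $ j" "x $ j < int N" using x by (auto simp: sites_def)
  have "real_of_int (x $ j) + 1 \<le> real N" using xj by linarith
  then have "(real_of_int (x $ j) + 1) / real N \<le> 1" using N by simp
  then have "W j ((real_of_int (x $ j) + 1) / real N) \<le> W j 1" using W_mono[of _ 1 j] by (cases rule: le_less[THEN iffD1, THEN disjE]) (auto intro: less_imp_le)
  moreover have "0 \<le> real_of_int (x $ j) / real N" using xj by simp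
  then have "W j 0 \<le> W j (real_of_int (x $ j) / real N)" using W_mono[of 0 _ j] by (cases rule: le_less[THEN iffD1, THEN disjE]) (auto intro: less_imp_le)
  ultimately have "D \<le> W j 1 - W j 0" by (simp add: D)
  also have "\<dots> \<le> W_total" unfolding W_total_def
    by (rule member_le_sum) (auto simp: less_imp_le[OF W_mono])
  finally have D_le: "D \<le> W_total" .
  have D_pos: "D > 0" using N by (auto simp: D intro!: W_mono divide_strict_right_mono)
  have "real N / (\<theta> * W_total) = (real N)\<^sup>2 * (inverse \<theta> / (real N * W_total))"
    using N theta W_total_pos by (simp add: power2_eq_square field_simps)
  also have "\<dots> \<le> (real N)\<^sup>2 * (env j x / (real N * D))"
  proof (intro mult_left_mono frac_le)
    show "inverse \<theta> \<le> env j x" by (rule env)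
    then show "0 \<le> env j x" using theta by (meson inverse_positive_iff_positive less_imp_le order_trans)
  qed (use N D_pos D_le in auto)
  also have "\<dots> = (real N)\<^sup>2 * conductance W env N x j" by (simp add: conductance_def D_def)
  finally have "real N / (\<theta> * W_total) * min 1 (1 + 2 * b)
      \<le> (real N)\<^sup>2 * conductance W env N x j * speed b x j \<eta>"
    using b W_total_pos theta by (intro mult_mono speed_ge) (auto intro: order_trans[rotated])
  then show ?thesis by (simp add: rate_def \<kappa>_def mult.commute)
qed

lemma rate_nonneg: "N \<ge> 1 \<Longrightarrow> x \<in> sites N \<Longrightarrow> 0 \<le> rate N j x \<eta>"
  using rate_ge[of N x j \<eta>] kappa_pos by (smt (verit) mult_nonneg_nonneg of_nat_0_le_iff)

text \<open>From N = 3 on, the two sites read by the speed are off the bond. They may coincide with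
  each other, as for N = 3, without harm.\<close>

lemma rate_swap:
  assumes N: "N \<ge> 3"
  shows "rate N j x (swap N j x \<eta>) = rate N j x \<eta>"
proof -
  have ne: "modN N (x + axis j m) \<noteq> modN N (x + axis j n)" if "m - n \<in> {-2, -1, 1, 2}" for m n
  proof
    assume "modN N (x + axis j m) = modN N (x + axis j n)"
    then have "int N dvd m - n" by (simp add: modN_axis_eq)
    moreover have "m - n \<noteq> 0" using that by auto
    ultimately have "\<bar>int N\<bar> \<le> \<bar>m - n\<bar>" by (intro dvd_imp_le_int)
    with that N show False by auto
  qed
  have "occ (swap N j x \<eta>) (x - axis j 1) = occ \<eta> (x - axis j 1)"
  proof -
    have e: "x - axis j 1 = x + axis j (-1)" "x + axis j 0 = x" by (simp_all add: vec_eq_iff axis_def)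
    have "modN N (x - axis j 1) \<noteq> modN N x" "modN N (x - axis j 1) \<noteq> modN N (x + axis j 1)"
      using ne[of "-1" 0] ne[of "-1" 1] unfolding e by auto
    then show ?thesis by (simp add: occ_def exchange_eq)
  qed
  moreover have "occ (swap N j x \<eta>) (x + axis j 2) = occ \<eta> (x + axis j 2)"
  proof -
    have e: "x + axis j 0 = x" by (simp add: vec_eq_iff axis_def)
    have "modN N (x + axis j 2) \<noteq> modN N x" "modN N (x + axis j 2) \<noteq> modN N (x + axis j 1)"
      using ne[of 2 0] ne[of 2 1] unfolding e by auto
    then show ?thesis by (simp add: occ_def exchange_eq)
  qed
  ultimately show ?thesis by (simp add: rate_def speed_def)
qed

text \<open>The exchange is an involution preserving the measure and the rate of its bond, so the
  sum equals half of itself plus its image.\<close>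

lemma bond_pairing:
  assumes N: "N \<ge> 3"
  shows "(\<Sum>\<eta>\<in>configs N. wt N \<eta> * (f \<eta> * (rate N j x \<eta> * (h (swap N j x \<eta>) - h \<eta>))))
    = - (1 / 2) * (\<Sum>\<eta>\<in>configs N. wt N \<eta> * (rate N j x \<eta> * ((f (swap N j x \<eta>) - f \<eta>) * (h (swap N j x \<eta>) - h \<eta>))))"
    (is "?L = _")
proof -
  have "?L = (\<Sum>\<eta>\<in>configs N. wt N \<eta> * (f (swap N j x \<eta>) * (rate N j x (swap N j x \<eta>) * (h (swap N j x (swap N j x \<eta>)) - h (swap N j x \<eta>)))))"
    by (rule sum_exchange[symmetric]) (use N in simp)
  also have "\<dots> = (\<Sum>\<eta>\<in>configs N. wt N \<eta> * (f (swap N j x \<eta>) * (rate N j x \<eta> * (h \<eta> - h (swap N j x \<eta>)))))"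
    by (intro sum.cong) (auto simp: rate_swap[OF N] exchange_exchange)
  finally have "2 * ?L = ?L + (\<Sum>\<eta>\<in>configs N. wt N \<eta> * (f (swap N j x \<eta>) * (rate N j x \<eta> * (h \<eta> - h (swap N j x \<eta>)))))"
    by simp
  also have "\<dots> = - (\<Sum>\<eta>\<in>configs N. wt N \<eta> * (rate N j x \<eta> * ((f (swap N j x \<eta>) - f \<eta>) * (h (swap N j x \<eta>) - h \<eta>))))"
    unfolding sum.distrib[symmetric] sum_negf[symmetric] by (intro sum.cong) (auto simp: algebra_simps)
  finally show ?thesis by simp
qed

definition dirichlet :: "nat \<Rightarrow> ('d config \<Rightarrow> real) \<Rightarrow> ('d config \<Rightarrow> real) \<Rightarrow> real" where
  "dirichlet N f h = 1 / 2 * (\<Sum>j\<in>UNIV. \<Sum>x\<in>sites N. \<Sum>\<eta>\<in>configs N.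
     wt N \<eta> * (rate N j x \<eta> * ((f (swap N j x \<eta>) - f \<eta>) * (h (swap N j x \<eta>) - h \<eta>))))"

lemma gen_pairing:
  assumes N: "N \<ge> 3"
  shows "(\<Sum>\<eta>\<in>configs N. wt N \<eta> * (f \<eta> * gen N h \<eta>)) = - dirichlet N f h"
proof -
  have "(\<Sum>\<eta>\<in>configs N. wt N \<eta> * (f \<eta> * gen N h \<eta>))
      = (\<Sum>j\<in>UNIV. \<Sum>x\<in>sites N. \<Sum>\<eta>\<in>configs N. wt N \<eta> * (f \<eta> * (rate N j x \<eta> * (h (swap N j x \<eta>) - h \<eta>))))"
    unfolding gen_eq sum_distrib_left by (subst sum.swap, intro sum.cong refl, rule sum.swap)
  then show ?thesis
    unfolding bond_pairing[OF N] by (simp add: dirichlet_def sum_negf sum_distrib_left)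
qed

lemma generator:
  assumes N: "N \<ge> 3"
  shows "reversible_generator (configs N) (gen N) (bernoulli_product N \<rho>)"
proof
  show "finite (configs N :: 'd config set)" "set_pmf (bernoulli_product N \<rho>) \<subseteq> configs N"
    using N bernoulli_product_support[of N \<rho>] by auto
  show "gen N (\<lambda>\<eta>. c * f \<eta> + g \<eta>) \<xi> = c * gen N f \<xi> + gen N g \<xi>" for c f g \<xi>
    unfolding gen_eq sum_distrib_left sum.distrib[symmetric] by (intro sum.cong refl) (simp add: algebra_simps)
  show "gen N (\<lambda>_. 1) \<eta> = 0" for \<eta> by (simp only: gen_eq) simp
  show "(\<Sum>\<eta>\<in>configs N. wt N \<eta> * (f \<eta> * gen N g \<eta>)) = (\<Sum>\<eta>\<in>configs N. wt N \<eta> * (gen N f \<eta> * g \<eta>))" for f g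
    using gen_pairing[OF N, of f g] gen_pairing[OF N, of g f] by (simp add: dirichlet_def mult.commute)
  show "(\<Sum>\<eta>\<in>configs N. wt N \<eta> * (f \<eta> * gen N f \<eta>)) \<le> 0" for f
    unfolding gen_pairing[OF N] dirichlet_def power2_eq_square[symmetric] using N
    by (auto intro!: sum_nonneg mult_nonneg_nonneg rate_nonneg)
  show "\<exists>M\<ge>0. \<forall>f (B::real). (\<forall>\<eta>\<in>configs N. \<bar>f \<eta>\<bar> \<le> B) \<longrightarrow> (\<forall>\<eta>\<in>configs N. \<bar>gen N f \<eta>\<bar> \<le> M * B)"
  proof (intro exI conjI allI impI ballI)
    let ?M = "\<Sum>\<eta>\<in>configs N. \<Sum>j\<in>UNIV. \<Sum>x\<in>sites N. \<bar>rate N j x \<eta>\<bar> * 2"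
    show "0 \<le> ?M" by (intro sum_nonneg) auto
    fix f :: "'d config \<Rightarrow> real" and B :: real and \<eta> :: "'d config"
    assume f: "\<forall>\<eta>\<in>configs N. \<bar>f \<eta>\<bar> \<le> B" and \<eta>: "\<eta> \<in> configs N"
    have B: "B \<ge> 0" using order_trans[OF abs_ge_zero bspec[OF f \<eta>]] .
    have "\<bar>gen N f \<eta>\<bar> \<le> (\<Sum>j\<in>UNIV. \<Sum>x\<in>sites N. \<bar>rate N j x \<eta> * (f (swap N j x \<eta>) - f \<eta>)\<bar>)"
      unfolding gen_eq by (rule order_trans[OF sum_abs sum_mono[OF sum_abs]])
    also have "\<dots> \<le> (\<Sum>j\<in>UNIV. \<Sum>x\<in>sites N. \<bar>rate N j x \<eta>\<bar> * 2 * B)"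
    proof (intro sum_mono)
      fix j x
      have "\<bar>f (swap N j x \<eta>)\<bar> \<le> B" "\<bar>f \<eta>\<bar> \<le> B"
        using bspec[OF f \<eta>] bspec[OF f exchange_configs[OF \<eta>]] by auto
      then have "\<bar>f (swap N j x \<eta>) - f \<eta>\<bar> \<le> 2 * B" by linarith
      then show "\<bar>rate N j x \<eta> * (f (swap N j x \<eta>) - f \<eta>)\<bar> \<le> \<bar>rate N j x \<eta>\<bar> * 2 * B"
        unfolding abs_mult mult.assoc by (intro mult_left_mono) auto
    qed
    also have "\<dots> = (\<Sum>j\<in>UNIV. \<Sum>x\<in>sites N. \<bar>rate N j x \<eta>\<bar> * 2) * B" by (simp add: sum_distrib_right)
    also have "\<dots> \<le> ?M * B"
      using N \<eta> B by (intro mult_right_mono member_le_sum) (auto intro!: sum_nonneg)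
    finally show "\<bar>gen N f \<eta>\<bar> \<le> ?M * B" .
  qed
qed

text \<open>Integration by parts over one bond: the exchange reverses the sign of the gradient and
  leaves \<gamma> alone, so \<psi> may be replaced by half its increment across the bond.
  Cauchy-Schwarz then meets the Dirichlet form, which exceeds the sum of squared increments by a
  factor of order N.\<close>

lemma gradient_dual_bound:
  fixes \<gamma> :: "int ^ 'd \<Rightarrow> 'd config \<Rightarrow> real"
  assumes N: "N \<ge> 3" and C: "C \<ge> 0"
    and bound: "\<And>x \<eta>. x \<in> sites N \<Longrightarrow> \<eta> \<in> configs N \<Longrightarrow> \<bar>\<gamma> x \<eta>\<bar> \<le> C"
    and inv: "\<And>x \<eta>. x \<in> sites N \<Longrightarrow> \<eta> \<in> configs N \<Longrightarrow> \<gamma> x (swap N j x \<eta>) = \<gamma> x \<eta>"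
  shows "(\<Sum>\<eta>\<in>configs N. wt N \<eta> * ((\<Sum>x\<in>sites N. \<gamma> x \<eta> * (occ \<eta> x - occ \<eta> (x + axis j 1))) * \<psi> \<eta>))\<^sup>2
    \<le> C\<^sup>2 * real N ^ CARD('d) / (\<kappa> * real N) * dirichlet N \<psi> \<psi>"
proof -
  let ?D = "\<lambda>x \<eta>. occ \<eta> x - occ \<eta> (x + axis j 1)"
  let ?I = "sites N \<times> configs N :: ((int ^ 'd) \<times> 'd config) set"
  have N0: "N > 0" using N by simp
  have bond: "(\<Sum>\<eta>\<in>configs N. wt N \<eta> * (\<gamma> x \<eta> * ?D x \<eta> * \<psi> \<eta>))
      = (\<Sum>\<eta>\<in>configs N. wt N \<eta> * (1 / 2 * (\<gamma> x \<eta> * ?D x \<eta>) * (\<psi> \<eta> - \<psi> (swap N j x \<eta>))))" (is "?L = ?R")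
    if x: "x \<in> sites N" for x
  proof -
    have "?L = (\<Sum>\<eta>\<in>configs N. wt N \<eta> * (\<gamma> x (swap N j x \<eta>) * ?D x (swap N j x \<eta>) * \<psi> (swap N j x \<eta>)))"
      by (rule sum_exchange[OF N0, symmetric])
    also have "\<dots> = (\<Sum>\<eta>\<in>configs N. - (wt N \<eta> * (\<gamma> x \<eta> * ?D x \<eta> * \<psi> (swap N j x \<eta>))))"
    proof (intro sum.cong refl)
      fix \<eta> :: "'d config" assume \<eta>: "\<eta> \<in> configs N"
      have "modN N x = modN N (x + axis j 1) \<Longrightarrow> \<eta> x = \<eta> (x + axis j 1)"
        using \<eta> unfolding configs_iff by blast
      then have D: "?D x (swap N j x \<eta>) = - ?D x \<eta>"
        by (simp add: occ_def exchange_eq)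
      show "wt N \<eta> * (\<gamma> x (swap N j x \<eta>) * ?D x (swap N j x \<eta>) * \<psi> (swap N j x \<eta>))
        = - (wt N \<eta> * (\<gamma> x \<eta> * ?D x \<eta> * \<psi> (swap N j x \<eta>)))"
        unfolding D inv[OF x \<eta>] by (simp only: mult_minus_left mult_minus_right)
    qed
    finally have "2 * ?L = ?L + (\<Sum>\<eta>\<in>configs N. - (wt N \<eta> * (\<gamma> x \<eta> * ?D x \<eta> * \<psi> (swap N j x \<eta>))))"
      by simp
    also have "\<dots> = 2 * ?R"
      unfolding sum.distrib[symmetric] sum_distrib_left by (intro sum.cong refl) (simp add: field_simps)
    finally show ?thesis by simp
  qed
  \<comment> \<open>Each factor carries the square root of the weight, so that the plain
    Cauchy-Schwarz inequality over pairs of a bond and a configuration applies.\<close>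
  define u where "u z = sqrt (wt N (snd z)) * (1 / 2 * (\<gamma> (fst z) (snd z) * ?D (fst z) (snd z)))" for z :: "(int ^ 'd) \<times> 'd config"
  define v where "v z = sqrt (wt N (snd z)) * (\<psi> (snd z) - \<psi> (swap N j (fst z) (snd z)))" for z :: "(int ^ 'd) \<times> 'd config"
  have "(\<Sum>\<eta>\<in>configs N. wt N \<eta> * ((\<Sum>x\<in>sites N. \<gamma> x \<eta> * ?D x \<eta>) * \<psi> \<eta>))
      = (\<Sum>x\<in>sites N. \<Sum>\<eta>\<in>configs N. wt N \<eta> * (\<gamma> x \<eta> * ?D x \<eta> * \<psi> \<eta>))"
    unfolding sum_distrib_right sum_distrib_left by (rule sum.swap)
  also have "\<dots> = (\<Sum>x\<in>sites N. \<Sum>\<eta>\<in>configs N. wt N \<eta> * (1 / 2 * (\<gamma> x \<eta> * ?D x \<eta>) * (\<psi> \<eta> - \<psi> (swap N j x \<eta>))))"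
    by (intro sum.cong refl bond)
  also have "\<dots> = (\<Sum>z\<in>?I. wt N (snd z) * (1 / 2 * (\<gamma> (fst z) (snd z) * ?D (fst z) (snd z)) * (\<psi> (snd z) - \<psi> (swap N j (fst z) (snd z)))))"
    by (simp add: sum.cartesian_product case_prod_beta)
  also have "\<dots> = (\<Sum>z\<in>?I. u z * v z)"
  proof (intro sum.cong refl)
    fix z :: "(int ^ 'd) \<times> 'd config"
    have "u z * v z = (sqrt (wt N (snd z)) * sqrt (wt N (snd z))) *
      (1 / 2 * (\<gamma> (fst z) (snd z) * ?D (fst z) (snd z)) * (\<psi> (snd z) - \<psi> (swap N j (fst z) (snd z))))"
      unfolding u_def v_def by (simp only: mult_ac)
    then show "wt N (snd z) * (1 / 2 * (\<gamma> (fst z) (snd z) * ?D (fst z) (snd z)) * (\<psi> (snd z) - \<psi> (swap N j (fst z) (snd z)))) = u z * v z"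
      by simp
  qed
  finally have "(\<Sum>\<eta>\<in>configs N. wt N \<eta> * ((\<Sum>x\<in>sites N. \<gamma> x \<eta> * ?D x \<eta>) * \<psi> \<eta>))\<^sup>2 = (\<Sum>z\<in>?I. u z * v z)\<^sup>2"
    by simp
  also have "\<dots> \<le> (\<Sum>z\<in>?I. (u z)\<^sup>2) * (\<Sum>z\<in>?I. (v z)\<^sup>2)" by (rule Cauchy_Schwarz_ineq_sum)
  \<comment> \<open>The half from the antisymmetrisation gives C^2 / 4, the half in
    \<open>dirichlet\<close> gives the 2 in the other factor.\<close>
  also have "\<dots> \<le> (C\<^sup>2 / 4 * real N ^ CARD('d)) * (2 / (\<kappa> * real N) * dirichlet N \<psi> \<psi>)"
  proof (rule mult_mono)
    have "(\<Sum>z\<in>?I. (u z)\<^sup>2) \<le> (\<Sum>z\<in>?I. wt N (snd z) * (C\<^sup>2 / 4))"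
    proof (intro sum_mono)
      fix z assume z: "z \<in> ?I"
      have "\<bar>?D (fst z) (snd z)\<bar> \<le> 1" by (simp add: occ_def of_bool_def)
      then have "\<bar>\<gamma> (fst z) (snd z) * ?D (fst z) (snd z)\<bar> \<le> C * 1"
        unfolding abs_mult using z bound C by (intro mult_mono) auto
      then have "(\<gamma> (fst z) (snd z) * ?D (fst z) (snd z))\<^sup>2 \<le> C\<^sup>2"
        by (metis abs_ge_zero mult.right_neutral power2_abs power_mono)
      then have "wt N (snd z) * ((\<gamma> (fst z) (snd z) * ?D (fst z) (snd z))\<^sup>2 / 4) \<le> wt N (snd z) * (C\<^sup>2 / 4)"
        by (intro mult_left_mono) auto
      then show "(u z)\<^sup>2 \<le> wt N (snd z) * (C\<^sup>2 / 4)"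
        unfolding u_def power_mult_distrib by (simp add: power_divide)
    qed
    also have "\<dots> = (\<Sum>x\<in>(sites N :: (int ^ 'd) set). \<Sum>\<eta>\<in>configs N. wt N \<eta> * (C\<^sup>2 / 4))"
      unfolding sum.cartesian_product case_prod_beta ..
    also have "\<dots> = C\<^sup>2 / 4 * real N ^ CARD('d)"
      by (simp add: bernoulli_product_total[OF N0] sum_distrib_right[symmetric] sum_divide_distrib[symmetric])
    finally show "(\<Sum>z\<in>?I. (u z)\<^sup>2) \<le> C\<^sup>2 / 4 * real N ^ CARD('d)" .
    have nn: "0 \<le> wt N \<eta> * (rate N j' x \<eta> * ((\<psi> (swap N j' x \<eta>) - \<psi> \<eta>) * (\<psi> (swap N j' x \<eta>) - \<psi> \<eta>)))"
      if "x \<in> sites N" for x \<eta> j'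
      unfolding power2_eq_square[symmetric] using that N by (auto intro!: mult_nonneg_nonneg rate_nonneg)
    have v2: "(v z)\<^sup>2 = wt N (snd z) * ((\<psi> (swap N j (fst z) (snd z)) - \<psi> (snd z)) * (\<psi> (swap N j (fst z) (snd z)) - \<psi> (snd z)))" for z
      by (simp add: v_def power_mult_distrib power2_commute[of "\<psi> (snd z)"] flip: power2_eq_square)
    have "\<kappa> * real N * (\<Sum>z\<in>?I. (v z)\<^sup>2) = (\<Sum>x\<in>sites N. \<Sum>\<eta>\<in>configs N. wt N \<eta> * (\<kappa> * real N * ((\<psi> (swap N j x \<eta>) - \<psi> \<eta>) * (\<psi> (swap N j x \<eta>) - \<psi> \<eta>))))"
      by (simp add: v2 sum.cartesian_product case_prod_beta sum_distrib_left mult_ac)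
    also have "\<dots> \<le> (\<Sum>x\<in>sites N. \<Sum>\<eta>\<in>configs N. wt N \<eta> * (rate N j x \<eta> * ((\<psi> (swap N j x \<eta>) - \<psi> \<eta>) * (\<psi> (swap N j x \<eta>) - \<psi> \<eta>))))"
      using N by (intro sum_mono mult_left_mono mult_right_mono rate_ge) auto
    also have "\<dots> \<le> (\<Sum>j\<in>UNIV. \<Sum>x\<in>sites N. \<Sum>\<eta>\<in>configs N. wt N \<eta> * (rate N j x \<eta> * ((\<psi> (swap N j x \<eta>) - \<psi> \<eta>) * (\<psi> (swap N j x \<eta>) - \<psi> \<eta>))))"
      by (rule member_le_sum[of j UNIV]) (auto intro!: sum_nonneg nn)
    also have "\<dots> = 2 * dirichlet N \<psi> \<psi>" by (simp add: dirichlet_def)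
    finally show "(\<Sum>z\<in>?I. (v z)\<^sup>2) \<le> 2 / (\<kappa> * real N) * dirichlet N \<psi> \<psi>"
      using kappa_pos N0 by (simp add: field_simps)
  qed (use C in \<open>auto intro!: sum_nonneg\<close>)
  also have "\<dots> = C\<^sup>2 * real N ^ CARD('d) / (\<kappa> * real N) * dirichlet N \<psi> \<psi> / 2" by simp
  also have "\<dots> \<le> C\<^sup>2 * real N ^ CARD('d) / (\<kappa> * real N) * dirichlet N \<psi> \<psi>"
  proof -
    have "0 \<le> dirichlet N \<psi> \<psi>"
      using reversible_generator.nonpos[OF generator[OF N], of \<psi>] gen_pairing[OF N, of \<psi> \<psi>] by simp
    then have "0 \<le> C\<^sup>2 * real N ^ CARD('d) / (\<kappa> * real N) * dirichlet N \<psi> \<psi>"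
      using kappa_pos by simp
    then show ?thesis by simp
  qed
  finally show ?thesis .
qed

end

section \<open>Negligible additive functionals\<close>

lemma sum_shift:
  assumes "N > 0"
  shows "(\<Sum>x\<in>sites N. f x (modN N (x + v))) = (\<Sum>y\<in>sites N. f (modN N (y - v)) y)"
  by (rule sum.reindex_bij_witness[of _ "\<lambda>y. modN N (y - v)" "\<lambda>x. modN N (x + v)"])
    (use assms in \<open>auto simp: modN_in_sites modN_id\<close>)

text \<open>Once N exceeds all coordinate differences within A, the torus cannot identify two points
  of the pattern, wherever it is placed; finite patterns then behave as on \<int>^d.\<close>

lemma eventually_modN_distinct:
  assumes "finite (A :: (int ^ 'd::finite) set)"
  shows "\<forall>\<^sub>F N in sequentially. \<forall>u\<in>A. \<forall>v\<in>A. \<forall>x. modN N (x + u) = modN N (x + v) \<longrightarrow> u = v"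
proof -
  define M where "M = (\<Sum>u\<in>A. \<Sum>v\<in>A. \<Sum>k\<in>UNIV. nat \<bar>u $ k - v $ k\<bar>)"
  have M: "nat \<bar>u $ k - v $ k\<bar> \<le> M" if "u \<in> A" "v \<in> A" for u v k
  proof -
    have "nat \<bar>u $ k - v $ k\<bar> \<le> (\<Sum>k\<in>UNIV. nat \<bar>u $ k - v $ k\<bar>)"
      by (rule member_le_sum) auto
    also have "\<dots> \<le> (\<Sum>v\<in>A. \<Sum>k\<in>UNIV. nat \<bar>u $ k - v $ k\<bar>)"
      using that assms by (intro member_le_sum) auto
    also have "\<dots> \<le> M" unfolding M_def using that assms by (intro member_le_sum) auto
    finally show ?thesis .
  qed
  show ?thesis
    using eventually_gt_at_top[of M]
  proof eventually_elim
    case (elim N)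
    show ?case
    proof (intro ballI allI impI)
      fix u v x assume uv: "u \<in> A" "v \<in> A" "modN N (x + u) = modN N (x + v)"
      have "u $ k = v $ k" for k
      proof (rule ccontr)
        assume ne: "u $ k \<noteq> v $ k"
        have "int N dvd (x + u) $ k - (x + v) $ k" using uv(3) unfolding modN_eq_iff by (rule spec)
        then have "int N dvd u $ k - v $ k" by simp
        with ne have "\<bar>int N\<bar> \<le> \<bar>u $ k - v $ k\<bar>" by (intro dvd_imp_le_int) auto
        with M[OF uv(1,2), of k] elim show False by linarith
      qed
      then show "u = v" by (simp add: vec_eq_iff)
    qed
  qed
qed

lemma cocc_image:
  assumes "\<eta> \<in> configs N" "inj_on (\<lambda>z. modN N (x + z)) A"
  shows "(\<Prod>z\<in>A. occ \<eta> (x + z) - \<rho>) = cocc \<rho> \<eta> ((\<lambda>z. modN N (x + z)) ` A)"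
  unfolding cocc_def prod.reindex[OF assms(2)] using assms(1) by (simp add: occ_modN)

section \<open>Calculus of negligible families\<close>

locale exclusion_family = exclusion_env W env \<theta> b \<rho>
  for W :: "'d::finite \<Rightarrow> real \<Rightarrow> real" and env \<theta> b \<rho> +
  fixes P :: "nat \<Rightarrow> 'p measure" and X :: "nat \<Rightarrow> real \<Rightarrow> 'p \<Rightarrow> 'd config" and t :: real
  assumes t: "t > 0"
    and process: "\<And>N. N \<ge> 1 \<Longrightarrow> exclusion_process W env b \<rho> N (P N) (X N)"
begin

lemma reversible: "N \<ge> 3 \<Longrightarrow> reversible_process (configs N) (gen N) (bernoulli_product N \<rho>) (P N) (X N)"
  using process[of N]
  by (intro reversible_process.intro reversible_process_axioms.intro generator)
    (simp_all add: exclusion_process_def)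

text \<open>Restated for every N: the process locale is instantiated for N \<ge> 3 only, whereas
  limits concern sequences indexed by all N.\<close>

definition J :: "nat \<Rightarrow> ('d config \<Rightarrow> real) \<Rightarrow> real" where
  "J N F = (\<integral>p. (LBINT s:{0..t}. F (X N s p))\<^sup>2 \<partial>P N)"

definition scl :: "nat \<Rightarrow> real" where
  "scl N = 1 / (real N powr (real CARD('d) / 2))"

definition negligible :: "(nat \<Rightarrow> 'd config \<Rightarrow> real) \<Rightarrow> bool" where
  "negligible F \<longleftrightarrow> (\<lambda>N. J N (F N)) \<longlonglongrightarrow> 0"

definition bounded_field :: "(nat \<Rightarrow> int ^ 'd \<Rightarrow> real) \<Rightarrow> real \<Rightarrow> bool" where
  "bounded_field g C \<longleftrightarrow> (\<forall>N\<ge>1. \<forall>x\<in>sites N. \<bar>g N x\<bar> \<le> C)"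

lemma scl_square: "N \<ge> 1 \<Longrightarrow> (scl N)\<^sup>2 * real N ^ CARD('d) = 1"
proof -
  assume N: "N \<ge> 1"
  have "(real N powr (real CARD('d) / 2))\<^sup>2 = real N ^ CARD('d)"
    using N by (simp add: power2_eq_square powr_add[symmetric] powr_realpow)
  then show ?thesis using N by (simp add: scl_def power_divide)
qed

lemma J_nonneg: "0 \<le> J N F" by (simp add: J_def)

lemma J_add: "N \<ge> 3 \<Longrightarrow> J N (\<lambda>\<eta>. F \<eta> + F' \<eta>) \<le> 2 * J N F + 2 * J N F'"
  using reversible_process.J_add[OF reversible t] by (simp add: reversible_process.J_def[OF reversible] J_def)

lemma J_cong:
  assumes "N \<ge> 3" "\<And>\<eta>. \<eta> \<in> configs N \<Longrightarrow> F \<eta> = F' \<eta>"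
  shows "J N F = J N F'"
  using reversible_process.J_cong[where f = F and g = F' and t = t, OF reversible[OF assms(1)] assms(2)]
  unfolding reversible_process.J_def[OF reversible[OF assms(1)]] J_def by simp

lemma J_cmult: "J N (\<lambda>\<eta>. c * F \<eta>) = c\<^sup>2 * J N F"
proof -
  have "(LBINT s:{0..t}. c * F (X N s p)) = c * (LBINT s:{0..t}. F (X N s p))" for p
    by (rule set_integral_mult_right)
  then show ?thesis by (simp only: J_def power_mult_distrib integral_mult_right_zero)
qed

lemma J_static: "N \<ge> 3 \<Longrightarrow> J N F \<le> t\<^sup>2 * (\<Sum>\<eta>\<in>configs N. wt N \<eta> * (F \<eta>)\<^sup>2)"
  using reversible_process.J_le_static[OF reversible t]
  by (simp add: reversible_process.J_def[OF reversible] J_def reversible_generator.ip_def[OF generator] power2_eq_square)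

text \<open>The squared scaling cancels the volume N^d in the dual bound; what remains is the factor
  1/N gained from the rates.\<close>

lemma J_gradient:
  assumes N: "N \<ge> 3" and C: "C \<ge> 0"
    and bound: "\<And>x \<eta>. x \<in> sites N \<Longrightarrow> \<eta> \<in> configs N \<Longrightarrow> \<bar>\<gamma> x \<eta>\<bar> \<le> C"
    and inv: "\<And>x \<eta>. x \<in> sites N \<Longrightarrow> \<eta> \<in> configs N \<Longrightarrow> \<gamma> x (swap N j x \<eta>) = \<gamma> x \<eta>"
  shows "J N (\<lambda>\<eta>. scl N * (\<Sum>x\<in>sites N. \<gamma> x \<eta> * (occ \<eta> x - occ \<eta> (x + axis j 1)))) \<le> 2 * t * C\<^sup>2 / (\<kappa> * real N)"
proof -
  define F where "F \<eta> = (\<Sum>x\<in>sites N. \<gamma> x \<eta> * (occ \<eta> x - occ \<eta> (x + axis j 1)))" for \<eta>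
  define K where "K = C\<^sup>2 * real N ^ CARD('d) / (\<kappa> * real N)"
  have "K \<ge> 0" using kappa_pos by (simp add: K_def)
  have "J N F \<le> 2 * t * K"
  proof -
    have "reversible_process.J (P N) (X N) t F \<le> 2 * t * K"
    proof (rule reversible_process.J_le_dual[OF reversible[OF N] _ \<open>K \<ge> 0\<close> t])
      fix \<psi> :: "'d config \<Rightarrow> real"
      show "(reversible_generator.ip (configs N) (bernoulli_product N \<rho>) F \<psi>)\<^sup>2
        \<le> K * - reversible_generator.ip (configs N) (bernoulli_product N \<rho>) \<psi> (gen N \<psi>)"
        unfolding reversible_generator.ip_def[OF generator[OF N]] gen_pairing[OF N] F_def K_def
        using gradient_dual_bound[where \<gamma> = \<gamma> and C = C and j = j, OF N C bound inv, of \<psi>] by simp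
    qed
    then show ?thesis by (simp add: reversible_process.J_def[OF reversible[OF N]] J_def)
  qed
  then have "(scl N)\<^sup>2 * J N F \<le> (scl N)\<^sup>2 * (2 * t * K)" by (intro mult_left_mono) auto
  also have "\<dots> = ((scl N)\<^sup>2 * real N ^ CARD('d)) * (2 * t * C\<^sup>2 / (\<kappa> * real N))" by (simp add: K_def)
  also have "\<dots> = 2 * t * C\<^sup>2 / (\<kappa> * real N)" using N by (simp add: scl_square)
  finally have "J N (\<lambda>\<eta>. scl N * F \<eta>) \<le> 2 * t * C\<^sup>2 / (\<kappa> * real N)" by (simp only: J_cmult)
  then show ?thesis by (simp only: F_def)
qed

lemma eventually_ge3: "\<forall>\<^sub>F N in sequentially. N \<ge> (3::nat)"
  by (rule eventually_ge_at_top)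

lemma negligible_bound:
  assumes "\<And>e. e > 0 \<Longrightarrow> \<forall>\<^sub>F N in sequentially. J N (F N) \<le> e"
  shows "negligible F"
  unfolding negligible_def
proof (rule tendstoI)
  fix e :: real assume "e > 0"
  then have "\<forall>\<^sub>F N in sequentially. J N (F N) \<le> e / 2" by (intro assms) auto
  then show "\<forall>\<^sub>F N in sequentially. dist (J N (F N)) 0 < e"
    by eventually_elim (use \<open>e > 0\<close> J_nonneg in \<open>auto simp: dist_real_def\<close>)
qed

lemma negligible_eventually: "negligible F \<Longrightarrow> e > 0 \<Longrightarrow> \<forall>\<^sub>F N in sequentially. J N (F N) \<le> e"
  unfolding negligible_def
  by (drule order_tendstoD(2)[of _ 0 _ e]) (auto elim: eventually_mono)

lemma negligible_cong:
  assumes "negligible F" "\<forall>\<^sub>F N in sequentially. \<forall>\<eta>\<in>configs N. F' N \<eta> = F N \<eta>"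
  shows "negligible F'"
proof (rule negligible_bound)
  fix e :: real assume "e > 0"
  show "\<forall>\<^sub>F N in sequentially. J N (F' N) \<le> e"
    using negligible_eventually[OF assms(1) \<open>e > 0\<close>] assms(2) eventually_ge3
    by eventually_elim (metis J_cong)
qed

text \<open>The comparison family may depend on e. This is how an averaging length or a convex
  combination is fixed before N tends to infinity.\<close>

lemma negligible_approx:
  assumes "\<And>e. e > 0 \<Longrightarrow> \<exists>F'. negligible (\<lambda>N \<eta>. F N \<eta> - F' N \<eta>) \<and> (\<forall>\<^sub>F N in sequentially. J N (F' N) \<le> e)"
  shows "negligible F"
proof (rule negligible_bound)
  fix e :: real assume e: "e > 0"
  then obtain F' where F': "negligible (\<lambda>N \<eta>. F N \<eta> - F' N \<eta>)" "\<forall>\<^sub>F N in sequentially. J N (F' N) \<le> e / 4"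
    using assms[of "e / 4"] by auto
  have "e / 4 > 0" using e by simp
  show "\<forall>\<^sub>F N in sequentially. J N (F N) \<le> e"
    using negligible_eventually[OF F'(1) \<open>e / 4 > 0\<close>] F'(2) eventually_ge3
  proof eventually_elim
    case (elim N)
    then show ?case using J_add[of N "\<lambda>\<eta>. F N \<eta> - F' N \<eta>" "F' N"] by simp
  qed
qed

lemma negligible_zero: "negligible (\<lambda>N \<eta>. 0)"
  by (simp add: negligible_def J_def)

lemma negligible_add:
  assumes "negligible F" "negligible F'" shows "negligible (\<lambda>N \<eta>. F N \<eta> + F' N \<eta>)"
proof (rule negligible_approx)
  fix e :: real assume "e > 0"
  then show "\<exists>H. negligible (\<lambda>N \<eta>. F N \<eta> + F' N \<eta> - H N \<eta>) \<and> (\<forall>\<^sub>F N in sequentially. J N (H N) \<le> e)"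
    using assms by (intro exI[of _ F']) (auto intro: negligible_eventually)
qed

lemma negligible_cmult:
  assumes "negligible F" shows "negligible (\<lambda>N \<eta>. c * F N \<eta>)"
  using tendsto_mult_left[OF assms[unfolded negligible_def], of "c\<^sup>2"] by (simp add: negligible_def J_cmult)

lemma negligible_sum:
  "finite I \<Longrightarrow> (\<And>i. i \<in> I \<Longrightarrow> negligible (F i)) \<Longrightarrow> negligible (\<lambda>N \<eta>. \<Sum>i\<in>I. F i N \<eta>)"
  by (induction I rule: finite_induct) (auto intro: negligible_zero negligible_add)

lemma negligible_static:
  assumes "\<And>e. e > 0 \<Longrightarrow> \<forall>\<^sub>F N in sequentially. (\<Sum>\<eta>\<in>configs N. wt N \<eta> * (F N \<eta>)\<^sup>2) \<le> e"
  shows "negligible F"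
proof (rule negligible_bound)
  fix e :: real assume "e > 0"
  then have "\<forall>\<^sub>F N in sequentially. (\<Sum>\<eta>\<in>configs N. wt N \<eta> * (F N \<eta>)\<^sup>2) \<le> e / t\<^sup>2"
    using t by (intro assms) auto
  then show "\<forall>\<^sub>F N in sequentially. J N (F N) \<le> e"
    using eventually_ge3
  proof eventually_elim
    case (elim N)
    have "t\<^sup>2 * (\<Sum>\<eta>\<in>configs N. wt N \<eta> * (F N \<eta>)\<^sup>2) \<le> t\<^sup>2 * (e / t\<^sup>2)"
      using elim by (intro mult_left_mono) auto
    with J_static[OF elim(2), of "F N"] t show ?case by simp
  qed
qed

lemma negligible_gradient:
  assumes "\<forall>\<^sub>F N in sequentially. \<forall>x\<in>sites N. \<forall>\<eta>\<in>configs N.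
      \<bar>\<gamma> N x \<eta>\<bar> \<le> C \<and> \<gamma> N x (swap N j x \<eta>) = \<gamma> N x \<eta>"
  shows "negligible (\<lambda>N \<eta>. scl N * (\<Sum>x\<in>sites N. \<gamma> N x \<eta> * (occ \<eta> x - occ \<eta> (x + axis j 1))))"
proof (rule negligible_bound)
  fix e :: real assume "e > 0"
  have "(\<lambda>N. (2 * t * \<bar>C\<bar>\<^sup>2 / \<kappa>) / real N) \<longlonglongrightarrow> 0" by (rule lim_const_over_n)
  then have "\<forall>\<^sub>F N in sequentially. (2 * t * \<bar>C\<bar>\<^sup>2 / \<kappa>) / real N < e" using \<open>e > 0\<close> by (rule order_tendstoD)
  then show "\<forall>\<^sub>F N in sequentially. J N (\<lambda>\<eta>. scl N * (\<Sum>x\<in>sites N. \<gamma> N x \<eta> * (occ \<eta> x - occ \<eta> (x + axis j 1)))) \<le> e"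
    using assms eventually_ge3
  proof eventually_elim
    case (elim N)
    have "J N (\<lambda>\<eta>. scl N * (\<Sum>x\<in>sites N. \<gamma> N x \<eta> * (occ \<eta> x - occ \<eta> (x + axis j 1)))) \<le> 2 * t * \<bar>C\<bar>\<^sup>2 / (\<kappa> * real N)"
    proof (rule J_gradient[OF elim(3)])
      show "\<bar>\<gamma> N x \<eta>\<bar> \<le> \<bar>C\<bar>" "\<gamma> N x (swap N j x \<eta>) = \<gamma> N x \<eta>" if "x \<in> sites N" "\<eta> \<in> configs N" for x \<eta>
        using elim(2) that by fastforce+
    qed simp
    also have "\<dots> \<le> e" using elim(1) by simp
    finally show ?case .
  qed
qed

section \<open>Moving a particle along lattice paths\<close>

lemma bounded_field_shift: "bounded_field g C \<Longrightarrow> bounded_field (\<lambda>N y. g N (modN N (y + v))) C"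
  by (auto simp: bounded_field_def modN_in_sites)

lemma bounded_field_shift_diff: "bounded_field g C \<Longrightarrow> bounded_field (\<lambda>N y. g N (modN N (y - v))) C"
  by (auto simp: bounded_field_def modN_in_sites)

text \<open>All bounded fields are included at once because composing two shifts replaces g by a
  translate of g.\<close>

definition shift_ok :: "int ^ 'd \<Rightarrow> bool" where
  "shift_ok v \<longleftrightarrow> (\<forall>g C. bounded_field g C \<longrightarrow>
     negligible (\<lambda>N \<eta>. scl N * (\<Sum>x\<in>sites N. g N x * (occ \<eta> (x + v) - occ \<eta> x))))"

lemma eventually_pos: "\<forall>\<^sub>F N in sequentially. N > (0::nat)"
  by (rule eventually_gt_at_top)

lemma shift_ok_add:
  assumes v: "shift_ok v" and w: "shift_ok w" shows "shift_ok (v + w)"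
  unfolding shift_ok_def
proof (intro allI impI)
  fix g C assume g: "bounded_field g C"
  have 1: "negligible (\<lambda>N \<eta>. scl N * (\<Sum>x\<in>sites N. g N x * (occ \<eta> (x + w) - occ \<eta> x)))"
    using w g unfolding shift_ok_def by blast
  have 2: "negligible (\<lambda>N \<eta>. scl N * (\<Sum>x\<in>sites N. g N (modN N (x - w)) * (occ \<eta> (x + v) - occ \<eta> x)))"
    using v bounded_field_shift_diff[OF g, of w] unfolding shift_ok_def by blast
  show "negligible (\<lambda>N \<eta>. scl N * (\<Sum>x\<in>sites N. g N x * (occ \<eta> (x + (v + w)) - occ \<eta> x)))"
  proof (rule negligible_cong[OF negligible_add[OF 1 2]])
    show "\<forall>\<^sub>F N in sequentially. \<forall>\<eta>\<in>configs N. scl N * (\<Sum>x\<in>sites N. g N x * (occ \<eta> (x + (v + w)) - occ \<eta> x))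
      = scl N * (\<Sum>x\<in>sites N. g N x * (occ \<eta> (x + w) - occ \<eta> x))
        + scl N * (\<Sum>x\<in>sites N. g N (modN N (x - w)) * (occ \<eta> (x + v) - occ \<eta> x))"
      using eventually_pos
    proof eventually_elim
      case (elim N)
      show ?case
      proof
        fix \<eta> :: "'d config" assume \<eta>: "\<eta> \<in> configs N"
        have "(\<Sum>x\<in>sites N. g N (modN N (x - w)) * (occ \<eta> (x + v) - occ \<eta> x))
            = (\<Sum>x\<in>sites N. g N x * (occ \<eta> (modN N (x + w) + v) - occ \<eta> (modN N (x + w))))"
          by (rule sum_shift[OF elim, of "\<lambda>x y. g N x * (occ \<eta> (y + v) - occ \<eta> y)" w, symmetric])
        also have "\<dots> = (\<Sum>x\<in>sites N. g N x * (occ \<eta> (x + (v + w)) - occ \<eta> (x + w)))"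
        proof (intro sum.cong refl)
          fix x
          have "occ \<eta> (modN N (x + w) + v) = occ \<eta> (x + (v + w))"
            using occ_modN[OF \<eta>, of "modN N (x + w) + v"] occ_modN[OF \<eta>, of "x + w + v"] by (simp add: add_ac)
          then show "g N x * (occ \<eta> (modN N (x + w) + v) - occ \<eta> (modN N (x + w)))
            = g N x * (occ \<eta> (x + (v + w)) - occ \<eta> (x + w))" by (simp add: occ_modN[OF \<eta>])
        qed
        finally show "scl N * (\<Sum>x\<in>sites N. g N x * (occ \<eta> (x + (v + w)) - occ \<eta> x))
      = scl N * (\<Sum>x\<in>sites N. g N x * (occ \<eta> (x + w) - occ \<eta> x))
        + scl N * (\<Sum>x\<in>sites N. g N (modN N (x - w)) * (occ \<eta> (x + v) - occ \<eta> x))"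
          by (simp add: distrib_left[symmetric] sum.distrib[symmetric] right_diff_distrib)
      qed
    qed
  qed
qed

lemma shift_ok_unit: "shift_ok (axis j 1)" "shift_ok (axis j (-1))"
proof -
  have 1: "negligible (\<lambda>N \<eta>. scl N * (\<Sum>x\<in>sites N. g N x * (occ \<eta> x - occ \<eta> (x + axis j 1))))"
    if "bounded_field g C" for g C
  proof (rule negligible_gradient)
    show "\<forall>\<^sub>F N in sequentially. \<forall>x\<in>sites N. \<forall>\<eta>\<in>configs N. \<bar>g N x\<bar> \<le> C \<and> g N x = g N x"
      using eventually_ge_at_top[of 1] by eventually_elim (use that in \<open>auto simp: bounded_field_def\<close>)
  qed
  show "shift_ok (axis j 1)"
    unfolding shift_ok_def
  proof (intro allI impI)
    fix g C assume "bounded_field g C"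
    from negligible_cmult[OF 1[OF this], of "-1"]
    show "negligible (\<lambda>N \<eta>. scl N * (\<Sum>x\<in>sites N. g N x * (occ \<eta> (x + axis j 1) - occ \<eta> x)))"
      by (simp add: sum_negf[symmetric] mult_minus_right[symmetric] del: mult_minus_right)
  qed
  show "shift_ok (axis j (-1))"
    unfolding shift_ok_def
  proof (intro allI impI)
    fix g C assume g: "bounded_field g C"
    show "negligible (\<lambda>N \<eta>. scl N * (\<Sum>x\<in>sites N. g N x * (occ \<eta> (x + axis j (-1)) - occ \<eta> x)))"
    proof (rule negligible_cong[OF 1[OF bounded_field_shift[OF g, of "axis j 1"]]])
      show "\<forall>\<^sub>F N in sequentially. \<forall>\<eta>\<in>configs N.
         scl N * (\<Sum>x\<in>sites N. g N x * (occ \<eta> (x + axis j (- 1)) - occ \<eta> x)) =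
         scl N * (\<Sum>x\<in>sites N. g N (modN N (x + axis j 1)) * (occ \<eta> x - occ \<eta> (x + axis j 1)))"
        using eventually_pos
      proof (eventually_elim, intro ballI)
        fix N and \<eta> :: "'d config" assume N: "N > 0" and \<eta>: "\<eta> \<in> configs N"
        have e: "x + axis j (-1) = x - axis j 1" for x :: "int ^ 'd" by (simp add: vec_eq_iff axis_def)
        have "(\<Sum>x\<in>sites N. g N (modN N (x + axis j 1)) * (occ \<eta> x - occ \<eta> (modN N (x + axis j 1))))
          = (\<Sum>x\<in>sites N. g N x * (occ \<eta> (modN N (x - axis j 1)) - occ \<eta> x))"
          by (rule sum_shift[OF N, of "\<lambda>x y. g N y * (occ \<eta> x - occ \<eta> y)"])
        then show "scl N * (\<Sum>x\<in>sites N. g N x * (occ \<eta> (x + axis j (- 1)) - occ \<eta> x)) =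
         scl N * (\<Sum>x\<in>sites N. g N (modN N (x + axis j 1)) * (occ \<eta> x - occ \<eta> (x + axis j 1)))"
          by (simp add: occ_modN[OF \<eta>] e)
      qed
    qed
  qed
qed

text \<open>The admissible shifts are closed under addition and contain the unit vectors and their
  negatives.\<close>

lemma shift_ok: "shift_ok v"
proof -
  have zero: "shift_ok 0" by (simp add: shift_ok_def negligible_zero)
  have ax: "shift_ok (axis j n)" for j n
  proof (induction n rule: int_induct[where k = 0])
    case base
    have "axis j 0 = (0 :: int ^ 'd)" by (simp add: vec_eq_iff axis_def)
    then show ?case using zero by (simp only:)
  next
    case (step1 i)
    then show ?case using shift_ok_add[OF _ shift_ok_unit(1)] by (metis axis_add)
  next
    case (step2 i)
    then show ?case using shift_ok_add[OF _ shift_ok_unit(2)[of j], of "axis j i"] by (simp add: axis_add)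
  qed
  have "shift_ok (\<Sum>k\<in>K. axis k (v $ k))" for K :: "'d set"
    by (induction K rule: infinite_finite_induct) (auto intro: zero shift_ok_add ax)
  moreover have "(\<Sum>k\<in>UNIV. axis k (v $ k)) = v" by (simp add: vec_eq_iff axis_def)
  ultimately show ?thesis by metis
qed

lemma negligible_shift:
  "bounded_field g C \<Longrightarrow> negligible (\<lambda>N \<eta>. scl N * (\<Sum>x\<in>sites N. g N x * (occ \<eta> (x + v) - occ \<eta> x)))"
  using shift_ok[of v] unfolding shift_ok_def by blast

lemma linear_variance:
  assumes N: "N \<ge> 1"
  shows "(\<Sum>\<eta>\<in>configs N. wt N \<eta> * (scl N * (\<Sum>x\<in>sites N. c x * (occ \<eta> x - \<rho>)))\<^sup>2)
    \<le> (\<Sum>x\<in>sites N. (c x)\<^sup>2) / real N ^ CARD('d)"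
proof -
  have "(\<Sum>\<eta>\<in>configs N. wt N \<eta> * (\<Sum>x\<in>sites N. c x * cocc \<rho> \<eta> {x})\<^sup>2) \<le> real 1 * (\<Sum>x\<in>sites N. (c x)\<^sup>2)"
  proof (rule variance_bound)
    fix x :: "int ^ 'd" assume "x \<in> sites N"
    then have "{j \<in> sites N. {j} = {x}} = {x}" by auto
    then show "card {j \<in> sites N. {j} = {x}} \<le> 1" by simp
  qed (use N rho in auto)
  then have "(scl N)\<^sup>2 * (\<Sum>\<eta>\<in>configs N. wt N \<eta> * (\<Sum>x\<in>sites N. c x * (occ \<eta> x - \<rho>))\<^sup>2)
      \<le> (scl N)\<^sup>2 * (\<Sum>x\<in>sites N. (c x)\<^sup>2)"
    by (intro mult_left_mono) (auto simp: cocc_def)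
  also have "(scl N)\<^sup>2 * (\<Sum>x\<in>sites N. (c x)\<^sup>2) = (\<Sum>x\<in>sites N. (c x)\<^sup>2) / real N ^ CARD('d)"
    using scl_square[OF N] N by (simp add: field_simps)
  also have "(scl N)\<^sup>2 * (\<Sum>\<eta>\<in>configs N. wt N \<eta> * (\<Sum>x\<in>sites N. c x * (occ \<eta> x - \<rho>))\<^sup>2)
      = (\<Sum>\<eta>\<in>configs N. wt N \<eta> * (scl N * (\<Sum>x\<in>sites N. c x * (occ \<eta> x - \<rho>)))\<^sup>2)"
    unfolding power_mult_distrib by (subst sum_distrib_left) (intro sum.cong refl mult.left_commute)
  finally show ?thesis .
qed

text \<open>Summation by parts: the shift is moved from the environment to \<open>G\<close> and to the configuration.\<close>

lemma negligible_coboundary: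
  fixes H :: "int ^ 'd \<Rightarrow> real"
  assumes G: "cadlag G" and H: "\<And>x. \<bar>H x\<bar> \<le> C"
  shows "negligible (\<lambda>N \<eta>. scl N * (\<Sum>x\<in>sites N. G (site_point N x) * (H x - H (x + v)) * (occ \<eta> x - \<rho>)))"
proof -
  obtain CG where CG: "CG > 0" "\<And>p. (\<And>k. 0 \<le> p $ k \<and> p $ k \<le> 1) \<Longrightarrow> \<bar>G p\<bar> \<le> CG"
    by (rule cadlag_bounded[OF G]) blast
  have C: "C \<ge> 0" using order_trans[OF abs_ge_zero H] .
  have Gb: "\<bar>G (site_point N x)\<bar> \<le> CG" if "N \<ge> 1" "x \<in> sites N" for N and x :: "int ^ 'd"
    by (rule CG(2)) (rule site_point_unit[OF that])
  have GH: "\<bar>G (site_point N x) * H y\<bar> \<le> CG * C" if "N \<ge> 1" "x \<in> sites N" for N and x y :: "int ^ 'd"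
    unfolding abs_mult using Gb[OF that] H CG(1) by (intro mult_mono) auto
  \<comment> \<open>The coefficient of \<eta>(y) after the second sum is reindexed. H lives on
    \<int>^d and is not periodic, so \<open>modN N (y - v) + v\<close> need not give back the value
    at y; this happens only where the shift wraps around, and such sites are counted as bad.\<close>
  define c where "c N y = G (site_point N y) * H y - G (site_point N (modN N (y - v))) * H (modN N (y - v) + v)" for N y
  have 1: "negligible (\<lambda>N \<eta>. scl N * (\<Sum>x\<in>sites N. (G (site_point N x) * H (x + v)) * (occ \<eta> (x + v) - occ \<eta> x)))"
    by (rule negligible_shift[of _ "CG * C"]) (auto simp: bounded_field_def GH)
  have 2: "negligible (\<lambda>N \<eta>. scl N * (\<Sum>y\<in>sites N. c N y * (occ \<eta> y - \<rho>)))"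
  proof (rule negligible_static)
    fix \<epsilon> :: real assume "\<epsilon> > 0"
    \<comment> \<open>C^2 accounts for the good sites, the second square for the bad ones, and 1
      ensures positivity.\<close>
    define M where "M = C\<^sup>2 + (2 * (CG * C))\<^sup>2 + 1"
    have "M > 0" unfolding M_def by (intro add_nonneg_pos) auto
    define e where "e = min 1 (\<epsilon> / M)"
    have e: "e > 0" "e \<le> 1" "M * e \<le> \<epsilon>" using \<open>\<epsilon> > 0\<close> \<open>M > 0\<close> by (auto simp: e_def min_def field_simps)
    show "\<forall>\<^sub>F N in sequentially. (\<Sum>\<eta>\<in>configs N. wt N \<eta> * (scl N * (\<Sum>y\<in>sites N. c N y * (occ \<eta> y - \<rho>)))\<^sup>2) \<le> \<epsilon>"
      using few_bad_sites[OF G e(1), of v] eventually_ge3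
    proof eventually_elim
      case (elim N)
      then have N: "N \<ge> 1" "N > 0" by auto
      define Bad where "Bad = {y \<in> sites N. \<not> (y - v \<in> sites N \<and>
         \<bar>G (site_point N y) - G (site_point N (y - v))\<bar> \<le> e)}"
      have "(c N y)\<^sup>2 \<le> C\<^sup>2 * e + (if y \<in> Bad then (2 * (CG * C))\<^sup>2 else 0)" if y: "y \<in> sites N" for y
      proof (cases "y \<in> Bad")
        case True
        have "\<bar>c N y\<bar> \<le> 2 * (CG * C)"
          using GH[OF N(1) y, of y] GH[OF N(1) modN_in_sites[OF N(2)], of "y - v" "modN N (y - v) + v"]
          unfolding c_def by linarith
        from power_mono[OF this, of 2] show ?thesis using True e(1) by (simp add: add_increasing)
      next
        case False
        with y have good: "y - v \<in> sites N" "\<bar>G (site_point N y) - G (site_point N (y - v))\<bar> \<le> e"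
          by (auto simp: Bad_def)
        then have "c N y = H y * (G (site_point N y) - G (site_point N (y - v)))"
          by (simp add: c_def modN_id algebra_simps)
        then have "\<bar>c N y\<bar> \<le> C * e" using H[of y] good(2) C by (simp add: abs_mult mult_mono)
        from power_mono[OF this, of 2] have "(c N y)\<^sup>2 \<le> C\<^sup>2 * (e * e)"
          by (simp add: power2_eq_square mult_ac)
        also have "\<dots> \<le> C\<^sup>2 * (e * 1)" using e by (intro mult_left_mono) auto
        finally show ?thesis using False by simp
      qed
      then have "(\<Sum>y\<in>sites N. (c N y)\<^sup>2) \<le> (\<Sum>y\<in>sites N. C\<^sup>2 * e + (if y \<in> Bad then (2 * (CG * C))\<^sup>2 else 0))"
        by (intro sum_mono)
      also have "\<dots> = C\<^sup>2 * e * real N ^ CARD('d) + real (card Bad) * (2 * (CG * C))\<^sup>2"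
        by (simp add: sum.distrib sum.If_cases Bad_def Int_def)
      also have "\<dots> \<le> C\<^sup>2 * e * real N ^ CARD('d) + (e * real N ^ CARD('d)) * (2 * (CG * C))\<^sup>2"
        using elim(1) by (intro add_left_mono mult_right_mono) (auto simp: Bad_def)
      also have "\<dots> \<le> M * e * real N ^ CARD('d)"
        using e by (simp add: M_def algebra_simps)
      also have "\<dots> \<le> \<epsilon> * real N ^ CARD('d)" using e by (intro mult_right_mono) auto
      finally have "(\<Sum>y\<in>sites N. (c N y)\<^sup>2) / real N ^ CARD('d) \<le> \<epsilon>"
        using N by (simp add: field_simps)
      with linear_variance[OF N(1), of "c N"] show ?case by linarith
    qed
  qed
  show ?thesis
  proof (rule negligible_cong[OF negligible_add[OF 1 2]])
    show "\<forall>\<^sub>F N in sequentially. \<forall>\<eta>\<in>configs N.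
       scl N * (\<Sum>x\<in>sites N. G (site_point N x) * (H x - H (x + v)) * (occ \<eta> x - \<rho>)) =
       scl N * (\<Sum>x\<in>sites N. G (site_point N x) * H (x + v) * (occ \<eta> (x + v) - occ \<eta> x)) +
       scl N * (\<Sum>y\<in>sites N. c N y * (occ \<eta> y - \<rho>))"
      using eventually_pos
    proof (eventually_elim, intro ballI)
      fix N and \<eta> :: "'d config" assume N: "N > 0" and \<eta>: "\<eta> \<in> configs N"
      have "(\<Sum>y\<in>sites N. G (site_point N (modN N (y - v))) * H (modN N (y - v) + v) * (occ \<eta> y - \<rho>))
        = (\<Sum>x\<in>sites N. G (site_point N x) * H (x + v) * (occ \<eta> (modN N (x + v)) - \<rho>))"
        by (rule sum_shift[OF N, of "\<lambda>x y. G (site_point N x) * H (x + v) * (occ \<eta> y - \<rho>)" v, symmetric])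
      then have "(\<Sum>y\<in>sites N. c N y * (occ \<eta> y - \<rho>))
         = (\<Sum>x\<in>sites N. G (site_point N x) * H x * (occ \<eta> x - \<rho>)) - (\<Sum>x\<in>sites N. G (site_point N x) * H (x + v) * (occ \<eta> (x + v) - \<rho>))"
        by (simp add: c_def left_diff_distrib sum_subtractf occ_modN[OF \<eta>])
      then show "scl N * (\<Sum>x\<in>sites N. G (site_point N x) * (H x - H (x + v)) * (occ \<eta> x - \<rho>)) =
       scl N * (\<Sum>x\<in>sites N. G (site_point N x) * H (x + v) * (occ \<eta> (x + v) - occ \<eta> x)) +
       scl N * (\<Sum>y\<in>sites N. c N y * (occ \<eta> y - \<rho>))"
        unfolding distrib_left[symmetric]
        by (simp add: sum_subtractf[symmetric] sum.distrib[symmetric] algebra_simps)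
    qed
  qed
qed

end

lemma abs_cocc_factor: "0 \<le> \<rho> \<Longrightarrow> \<rho> \<le> 1 \<Longrightarrow> \<bar>occ \<eta> x - \<rho>\<bar> \<le> 1"
  by (simp add: occ_def of_bool_def)

context exclusion_family
begin

lemma abs_prod_occ_le: "\<bar>\<Prod>z\<in>B. occ \<eta> (f z) - \<rho>\<bar> \<le> 1"
  unfolding abs_prod using rho by (intro prod_le_1) (auto intro: abs_cocc_factor)

text \<open>One particle of the product, extremal in direction \<open>k\<close>, is moved away along that direction; its
  path never meets the other sites, and averaging over its positions makes the variance small.\<close>

lemma negligible_prod:
  assumes A: "finite A" "card A \<ge> 2" and g: "bounded_field g C"
  shows "negligible (\<lambda>N \<eta>. scl N * (\<Sum>x\<in>sites N. g N x * (\<Prod>z\<in>A. occ \<eta> (x + z) - \<rho>)))"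
proof -
  define k :: 'd where "k = undefined"
  have "A \<noteq> {}" using A by auto
  then have "Max ((\<lambda>z. z $ k) ` A) \<in> (\<lambda>z. z $ k) ` A" using A(1) by (intro Max_in) auto
  then obtain z where "z \<in> A" "z $ k = Max ((\<lambda>z. z $ k) ` A)" by (metis imageE)
  then have z: "z \<in> A" "\<And>w. w \<in> A \<Longrightarrow> w $ k \<le> z $ k" using A(1) by auto
  define B where "B = A - {z}"
  have B: "finite B" "z \<notin> B" "A = insert z B" using A(1) z(1) by (auto simp: B_def)
  have "B \<noteq> {}"
  proof
    assume "B = {}"
    then have "A = {z}" using B(3) by simp
    then show False using A(2) by simp
  qed
  \<comment> \<open>The second site keeps a fixed offset from x while the other one moves; it
    identifies x in the count of multiplicities.\<close>
  then obtain b0 where b0: "b0 \<in> B" by blast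
  define u where "u i = z + axis k (int i)" for i :: nat
  have u_notin: "u i \<notin> B" for i
  proof
    assume "u i \<in> B"
    then have "u i $ k \<le> z $ k" using z(2) B(3) by blast
    then have "i = 0" by (simp add: u_def axis_def)
    then have "u i = z" by (simp add: u_def vec_eq_iff axis_def)
    with \<open>u i \<in> B\<close> B(2) show False by simp
  qed
  have u_Suc: "u i + axis k 1 = u (Suc i)" for i by (simp add: u_def add.assoc axis_add add.commute)
  have u_inj: "u i = u j \<Longrightarrow> i = j" for i j
  proof -
    assume "u i = u j"
    then have "u i $ k = u j $ k" by simp
    then show "i = j" by (simp add: u_def axis_def)
  qed
  define pB where "pB x \<eta> = (\<Prod>b\<in>B. occ \<eta> (x + b) - \<rho>)" for x and \<eta> :: "'d config"
  have pB_le: "\<bar>pB x \<eta>\<bar> \<le> 1" for x \<eta> unfolding pB_def by (rule abs_prod_occ_le)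
  have pB_modN: "pB (modN N x) \<eta> = pB x \<eta>" if "\<eta> \<in> configs N" for N x \<eta>
    unfolding pB_def
  proof (intro prod.cong refl)
    fix b
    show "occ \<eta> (modN N x + b) - \<rho> = occ \<eta> (x + b) - \<rho>"
      using occ_modN[OF that, of "modN N x + b"] occ_modN[OF that, of "x + b"] by simp
  qed
  have step: "negligible (\<lambda>N \<eta>. scl N * (\<Sum>x\<in>sites N. g N x * pB x \<eta> * (occ \<eta> (x + u i) - occ \<eta> (x + u (Suc i)))))" for i
  proof (rule negligible_cong)
    let ?\<gamma> = "\<lambda>N y \<eta>. g N (modN N (y - u i)) * pB (y - u i) \<eta>"
    show "negligible (\<lambda>N \<eta>. scl N * (\<Sum>y\<in>sites N. ?\<gamma> N y \<eta> * (occ \<eta> y - occ \<eta> (y + axis k 1))))"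
    proof (rule negligible_gradient)
      \<comment> \<open>Positions, relative to y, of the two ends of the bond and of the fixed
        sites. When they are distinct modulo N the exchange does not affect \<open>pB\<close>, as
        the gradient bound demands.\<close>
      define A' where "A' = insert 0 (insert (axis k 1) ((\<lambda>b. b - u i) ` B))"
      have "finite A'" using B(1) by (simp add: A'_def)
      from eventually_modN_distinct[OF this] eventually_ge3
      show "\<forall>\<^sub>F N in sequentially. \<forall>y\<in>sites N. \<forall>\<eta>\<in>configs N. \<bar>?\<gamma> N y \<eta>\<bar> \<le> C \<and> ?\<gamma> N y (swap N k y \<eta>) = ?\<gamma> N y \<eta>"
      proof (eventually_elim, intro ballI conjI)
        fix N and y :: "int ^ 'd" and \<eta> :: "'d config"
        assume dist: "\<forall>v\<in>A'. \<forall>w\<in>A'. \<forall>x. modN N (x + v) = modN N (x + w) \<longrightarrow> v = w" and N: "N \<ge> 3"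
          and y: "y \<in> sites N" and \<eta>: "\<eta> \<in> configs N"
        have "modN N (y - u i) \<in> sites N" using N by (intro modN_in_sites) simp
        then have "\<bar>g N (modN N (y - u i))\<bar> \<le> C" using g N by (auto simp: bounded_field_def)
        then have "\<bar>?\<gamma> N y \<eta>\<bar> \<le> C * 1" unfolding abs_mult by (intro mult_mono pB_le) auto
        then show "\<bar>?\<gamma> N y \<eta>\<bar> \<le> C" by simp
        have "occ (swap N k y \<eta>) (y - u i + b) = occ \<eta> (y - u i + b)" if b: "b \<in> B" for b
        proof -
          have "b - u i \<noteq> 0" "b - u i \<noteq> axis k 1"
            using u_notin[of i] u_notin[of "Suc i"] b u_Suc[of i] by (auto simp: algebra_simps)
          moreover have "b - u i \<in> A'" "0 \<in> A'" "axis k 1 \<in> A'" using b by (auto simp: A'_def)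
          ultimately have "modN N (y + (b - u i)) \<noteq> modN N (y + 0)" "modN N (y + (b - u i)) \<noteq> modN N (y + axis k 1)"
            using dist by blast+
          then show ?thesis by (simp add: occ_def exchange_eq algebra_simps)
        qed
        then have "pB (y - u i) (swap N k y \<eta>) = pB (y - u i) \<eta>"
          unfolding pB_def by (intro prod.cong) auto
        then show "?\<gamma> N y (swap N k y \<eta>) = ?\<gamma> N y \<eta>" by simp
      qed
    qed
    show "\<forall>\<^sub>F N in sequentially. \<forall>\<eta>\<in>configs N. scl N * (\<Sum>x\<in>sites N. g N x * pB x \<eta> * (occ \<eta> (x + u i) - occ \<eta> (x + u (Suc i))))
        = scl N * (\<Sum>y\<in>sites N. ?\<gamma> N y \<eta> * (occ \<eta> y - occ \<eta> (y + axis k 1)))"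
      using eventually_pos
    proof (eventually_elim, intro ballI)
      fix N and \<eta> :: "'d config" assume N: "N > 0" and \<eta>: "\<eta> \<in> configs N"
      have "(\<Sum>x\<in>sites N. g N x * pB x \<eta> * (occ \<eta> (modN N (x + u i)) - occ \<eta> (modN N (x + u i) + axis k 1)))
        = (\<Sum>y\<in>sites N. g N (modN N (y - u i)) * pB (modN N (y - u i)) \<eta> * (occ \<eta> y - occ \<eta> (y + axis k 1)))"
        by (rule sum_shift[OF N, of "\<lambda>x y. g N x * pB x \<eta> * (occ \<eta> y - occ \<eta> (y + axis k 1))"])
      moreover have "occ \<eta> (modN N (x + u i) + axis k 1) = occ \<eta> (x + u (Suc i))" for x
        using occ_modN[OF \<eta>, of "modN N (x + u i) + axis k 1"] occ_modN[OF \<eta>, of "x + u (Suc i)"]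
        by (simp add: u_Suc[symmetric] add.assoc)
      ultimately show "scl N * (\<Sum>x\<in>sites N. g N x * pB x \<eta> * (occ \<eta> (x + u i) - occ \<eta> (x + u (Suc i))))
        = scl N * (\<Sum>y\<in>sites N. ?\<gamma> N y \<eta> * (occ \<eta> y - occ \<eta> (y + axis k 1)))"
        by (simp add: occ_modN[OF \<eta>] pB_modN[OF \<eta>])
    qed
  qed
  define D where "D i N \<eta> = scl N * (\<Sum>x\<in>sites N. g N x * pB x \<eta> * (occ \<eta> (x + z) - occ \<eta> (x + u i)))"
    for i N and \<eta> :: "'d config"
  have D: "negligible (D i)" for i
  proof (induction i)
    case 0
    have "u 0 = z" by (simp add: u_def vec_eq_iff axis_def)
    then have "D 0 = (\<lambda>N \<eta>. 0)" by (simp add: D_def fun_eq_iff)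
    then show ?case by (simp add: negligible_zero)
  next
    case (Suc i)
    have "D (Suc i) = (\<lambda>N \<eta>. D i N \<eta> + scl N * (\<Sum>x\<in>sites N. g N x * pB x \<eta> * (occ \<eta> (x + u i) - occ \<eta> (x + u (Suc i)))))"
      unfolding D_def distrib_left[symmetric] sum.distrib[symmetric] by simp
    then show ?case using negligible_add[OF Suc step[of i]] by simp
  qed
  \<comment> \<open>The factor at z is replaced by its average over the first l positions of the
    path; the cost is the mean of D 0, ..., D (l - 1).\<close>
  define F' where "F' l N \<eta> = scl N * (\<Sum>x\<in>sites N. g N x * pB x \<eta> * ((\<Sum>i<l. occ \<eta> (x + u i) - \<rho>) / real l))"
    for l N and \<eta> :: "'d config"
  have static: "\<forall>\<^sub>F N in sequentially. J N (F' l N) \<le> t\<^sup>2 * (real (card A))\<^sup>2 * C\<^sup>2 / real l" if l: "l > 0" for l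
  proof -
    define Q where "Q = B \<union> u ` {..<l}"
    have "finite Q" using B(1) by (simp add: Q_def)
    from eventually_modN_distinct[OF this] eventually_ge3 show ?thesis
    proof eventually_elim
      case (elim N)
      have dist: "v = w" if "v \<in> Q" "w \<in> Q" "modN N (x + v) = modN N (x + w)" for v w x
        using elim(1) that by blast
      have N: "N > 0" "N \<ge> 1" using elim(2) by auto
      define S where "S xi = (\<lambda>w. modN N (fst xi + w)) ` insert (u (snd xi)) B" for xi :: "(int ^ 'd) \<times> nat"
      define I where "I = (sites N :: (int ^ 'd) set) \<times> {..<l}"
      define c where "c xi = scl N * g N (fst xi) / real l" for xi :: "(int ^ 'd) \<times> nat"
      have inj: "inj_on (\<lambda>w. modN N (x + w)) (insert (u i) B)" if "i < l" for x i
        using that by (auto simp: inj_on_def Q_def intro: dist)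
      have F'_eq: "F' l N \<eta> = (\<Sum>xi\<in>I. c xi * cocc \<rho> \<eta> (S xi))" if \<eta>: "\<eta> \<in> configs N" for \<eta>
      proof -
        have "cocc \<rho> \<eta> (S (x, i)) = pB x \<eta> * (occ \<eta> (x + u i) - \<rho>)" if "i < l" for x i
          using cocc_image[where \<rho> = \<rho>, OF \<eta> inj[where x = x and i = i, OF that], symmetric] B(1) u_notin
          by (simp add: S_def pB_def mult.commute)
        then have "(\<Sum>xi\<in>I. c xi * cocc \<rho> \<eta> (S xi))
          = (\<Sum>x\<in>sites N. \<Sum>i<l. scl N * g N x / real l * (pB x \<eta> * (occ \<eta> (x + u i) - \<rho>)))"
          unfolding I_def by (subst sum.cartesian_product) (auto simp: c_def intro!: sum.cong)
        also have "\<dots> = F' l N \<eta>"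
          unfolding F'_def sum_distrib_left sum_divide_distrib by (simp add: mult_ac)
        finally show ?thesis ..
      qed
      \<comment> \<open>A pair (x, i) can be recovered from its set of sites once it is known which
        elements are x + b0 and x + u i; this leaves at most the square of card A
        possibilities.\<close>
      have mult: "card {xi' \<in> I. S xi' = S xi} \<le> (card A)\<^sup>2" for xi
      proof -
        let ?\<phi> = "\<lambda>xi :: (int ^ 'd) \<times> nat. (modN N (fst xi + b0), modN N (fst xi + u (snd xi)))"
        have fin: "finite (S xi)" using B(1) by (simp add: S_def)
        have "inj_on ?\<phi> {xi' \<in> I. S xi' = S xi}"
        proof (rule inj_onI)
          fix p q assume p: "p \<in> {xi' \<in> I. S xi' = S xi}" and q: "q \<in> {xi' \<in> I. S xi' = S xi}"
            and eq: "?\<phi> p = ?\<phi> q"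
          have "modN N (fst p) = modN N (fst q)" using eq by (simp add: modN_add_cancel)
          then have 1: "fst p = fst q" using p q by (auto simp: I_def modN_id)
          then have "modN N (fst p + u (snd p)) = modN N (fst p + u (snd q))" using eq by simp
          then have "u (snd p) = u (snd q)" by (rule dist[rotated 2]) (use p q in \<open>auto simp: I_def Q_def\<close>)
          then show "p = q" using 1 u_inj by (simp add: prod_eq_iff)
        qed
        moreover have "?\<phi> ` {xi' \<in> I. S xi' = S xi} \<subseteq> S xi \<times> S xi"
        proof
          fix w assume "w \<in> ?\<phi> ` {xi' \<in> I. S xi' = S xi}"
          then obtain p where p: "S p = S xi" "w = ?\<phi> p" by auto
          have "fst w \<in> S p" "snd w \<in> S p" using b0 by (auto simp: p(2) S_def)
          then show "w \<in> S xi \<times> S xi" unfolding p(1) by (simp add: mem_Times_iff)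
        qed
        ultimately have "card {xi' \<in> I. S xi' = S xi} \<le> card (S xi \<times> S xi)"
          using fin by (intro card_inj_on_le) auto
        also have "\<dots> = (card (S xi))\<^sup>2" by (simp add: card_cartesian_product power2_eq_square)
        also have "\<dots> \<le> (card A)\<^sup>2"
        proof (rule power_mono)
          have "card (S xi) \<le> card (insert (u (snd xi)) B)" unfolding S_def using B(1) by (intro card_image_le) simp
          also have "\<dots> = card A" using B u_notin by simp
          finally show "card (S xi) \<le> card A" .
        qed simp
        finally show ?thesis .
      qed
      have "(\<Sum>\<eta>\<in>configs N. wt N \<eta> * (F' l N \<eta>)\<^sup>2) = (\<Sum>\<eta>\<in>configs N. wt N \<eta> * (\<Sum>xi\<in>I. c xi * cocc \<rho> \<eta> (S xi))\<^sup>2)"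
        by (intro sum.cong) (auto simp: F'_eq)
      also have "\<dots> \<le> real ((card A)\<^sup>2) * (\<Sum>xi\<in>I. (c xi)\<^sup>2)"
      proof (rule variance_bound[OF N(1) rho])
        show "finite I" by (simp add: I_def)
        show "S xi \<subseteq> sites N" for xi using N by (auto simp: S_def modN_in_sites)
      qed (rule mult)
      also have "\<dots> \<le> real ((card A)\<^sup>2) * (\<Sum>xi\<in>I. (scl N)\<^sup>2 * (C\<^sup>2 / (real l)\<^sup>2))"
      proof (intro mult_left_mono sum_mono)
        fix xi assume "xi \<in> I"
        then have "\<bar>g N (fst xi)\<bar> \<le> C" using g N by (auto simp: I_def bounded_field_def)
        from power_mono[OF this, of 2] have "(g N (fst xi))\<^sup>2 \<le> C\<^sup>2" by simp
        then have "(scl N)\<^sup>2 * ((g N (fst xi))\<^sup>2 / (real l)\<^sup>2) \<le> (scl N)\<^sup>2 * (C\<^sup>2 / (real l)\<^sup>2)"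
          by (intro mult_left_mono divide_right_mono) auto
        then show "(c xi)\<^sup>2 \<le> (scl N)\<^sup>2 * (C\<^sup>2 / (real l)\<^sup>2)"
          by (simp add: c_def power_mult_distrib power_divide)
      qed auto
      \<comment> \<open>There are l N^d indices, each with a term of order C^2 / l^2; this is the
        gain 1/l.\<close>
      also have "\<dots> = (real (card A))\<^sup>2 * (((scl N)\<^sup>2 * real N ^ CARD('d)) * (C\<^sup>2 / real l))"
        using l by (simp add: I_def card_cartesian_product power2_eq_square)
      also have "\<dots> = (real (card A))\<^sup>2 * (C\<^sup>2 / real l)" using scl_square[OF N(2)] by simp
      finally have "t\<^sup>2 * (\<Sum>\<eta>\<in>configs N. wt N \<eta> * (F' l N \<eta>)\<^sup>2) \<le> t\<^sup>2 * ((real (card A))\<^sup>2 * (C\<^sup>2 / real l))"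
        by (intro mult_left_mono) auto
      with J_static[OF elim(2), of "F' l N"] show ?case by simp
    qed
  qed
  have prod_A: "(\<Prod>w\<in>A. occ \<eta> (x + w) - \<rho>) = pB x \<eta> * (occ \<eta> (x + z) - \<rho>)" for x and \<eta> :: "'d config"
    using B by (simp add: pB_def mult.commute)
  show ?thesis
  proof (rule negligible_approx)
    fix e :: real assume e: "e > 0"
    obtain l :: nat where l: "real l > t\<^sup>2 * (real (card A))\<^sup>2 * C\<^sup>2 / e" "l > 0"
      by (metis e divide_nonneg_pos le_less_trans mult_nonneg_nonneg of_nat_0_less_iff reals_Archimedean2 zero_le_power2)
    have "negligible (\<lambda>N \<eta>. \<Sum>i<l. 1 / real l * D i N \<eta>)"
      by (intro negligible_sum negligible_cmult D) auto
    moreover have "(\<Sum>i<l. 1 / real l * D i N \<eta>) =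
      scl N * (\<Sum>x\<in>sites N. g N x * (\<Prod>z\<in>A. occ \<eta> (x + z) - \<rho>)) - F' l N \<eta>" for N and \<eta> :: "'d config"
    proof -
      have "(\<Sum>i<l. 1 / real l * D i N \<eta>)
          = scl N * (\<Sum>x\<in>sites N. \<Sum>i<l. g N x * pB x \<eta> * (occ \<eta> (x + z) - occ \<eta> (x + u i)) / real l)"
        unfolding D_def sum_distrib_left by (subst sum.swap) (simp add: mult_ac)
      also have "\<dots> = scl N * (\<Sum>x\<in>sites N. g N x * pB x \<eta> * (occ \<eta> (x + z) - \<rho>)
          - g N x * pB x \<eta> * ((\<Sum>i<l. occ \<eta> (x + u i) - \<rho>) / real l))"
      proof (intro arg_cong[where f = "\<lambda>s. scl N * s"] sum.cong refl)
        fix x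
        have "(\<Sum>i<l. g N x * pB x \<eta> * (occ \<eta> (x + z) - occ \<eta> (x + u i)) / real l)
          = g N x * pB x \<eta> * ((\<Sum>i<l. (occ \<eta> (x + z) - \<rho>) - (occ \<eta> (x + u i) - \<rho>)) / real l)"
          by (simp add: sum_distrib_left sum_divide_distrib)
        also have "(\<Sum>i<l. (occ \<eta> (x + z) - \<rho>) - (occ \<eta> (x + u i) - \<rho>))
            = real l * (occ \<eta> (x + z) - \<rho>) - (\<Sum>i<l. occ \<eta> (x + u i) - \<rho>)"
          by (simp only: sum_subtractf) (simp add: algebra_simps)
        finally show "(\<Sum>i<l. g N x * pB x \<eta> * (occ \<eta> (x + z) - occ \<eta> (x + u i)) / real l)
          = g N x * pB x \<eta> * (occ \<eta> (x + z) - \<rho>) - g N x * pB x \<eta> * ((\<Sum>i<l. occ \<eta> (x + u i) - \<rho>) / real l)"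
          using l(2) by (simp add: diff_divide_distrib right_diff_distrib)
      qed
      finally show ?thesis by (simp add: F'_def prod_A sum_subtractf right_diff_distrib mult.assoc)
    qed
    moreover have "t\<^sup>2 * (real (card A))\<^sup>2 * C\<^sup>2 / real l \<le> e" using l e by (simp add: field_simps)
    then have "\<forall>\<^sub>F N in sequentially. J N (F' l N) \<le> e"
      using static[OF l(2)] by (auto elim: eventually_mono)
    ultimately show "\<exists>F'. negligible (\<lambda>N \<eta>. scl N * (\<Sum>x\<in>sites N. g N x * (\<Prod>z\<in>A. occ \<eta> (x + z) - \<rho>)) - F' N \<eta>)
        \<and> (\<forall>\<^sub>F N in sequentially. J N (F' N) \<le> e)"
      by (intro exI[of _ "F' l"]) simp
  qed
qed

text \<open>Replacing h by a member u of its convex orbit changes the functional negligibly, by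
  induction over the orbit; the functional of u has stationary variance at most CG^2
  \<delta>.\<close>

lemma negligible_mean_zero:
  fixes T :: "int ^ 'd \<Rightarrow> 'w \<Rightarrow> 'w"
  assumes erg: "ergodic_env \<mu> T" and \<omega>: "\<omega> \<in> space \<mu>"
    and h: "h \<in> borel_measurable \<mu>" "\<And>\<omega>. \<omega> \<in> space \<mu> \<Longrightarrow> \<bar>h \<omega>\<bar> \<le> C"
    and small: "\<forall>\<delta>>0. \<exists>u\<in>conv_orbit T h. \<forall>N\<ge>1. (\<Sum>x\<in>sites N. (u (T x \<omega>))\<^sup>2) \<le> \<delta> * real N ^ CARD('d)"
    and G: "cadlag G"
  shows "negligible (\<lambda>N \<eta>. scl N * (\<Sum>x\<in>sites N. G (site_point N x) * h (T x \<omega>) * (occ \<eta> x - \<rho>)))"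
proof -
  interpret ergodic_env \<mu> T by (rule erg)
  define \<Phi> where "\<Phi> u N \<eta> = scl N * (\<Sum>x\<in>sites N. G (site_point N x) * u (T x \<omega>) * (occ \<eta> x - \<rho>))"
    for u N and \<eta> :: "'d config"
  have diff: "negligible (\<lambda>N \<eta>. \<Phi> h N \<eta> - \<Phi> u N \<eta>)" if "u \<in> conv_orbit T h" for u
    using that
  proof induction
    case base
    then show ?case by (simp add: negligible_zero)
  next
    \<comment> \<open>With \<open>H x = u (T x \<omega>)\<close> the translated function gives
      \<open>H (x + v)\<close>, so the difference is a coboundary.\<close>
    case (shift u v)
    have "\<bar>u (T x \<omega>)\<bar> \<le> C" for x
      using conv_orbit_props(2)[OF shift.hyps h T_space[OF \<omega>]] by simp
    from negligible_coboundary[where v = v and H = "\<lambda>x. u (T x \<omega>)", OF G this]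
    have "negligible (\<lambda>N \<eta>. \<Phi> u N \<eta> - \<Phi> (\<lambda>\<omega>. u (T v \<omega>)) N \<eta>)"
      by (simp only: \<Phi>_def T_add[OF \<omega>] add.commute[of v] right_diff_distrib[symmetric]
          left_diff_distrib[symmetric] sum_subtractf[symmetric])
    from negligible_add[OF shift.IH this] show ?case by simp
  next
    case (mean u v)
    have eq: "\<Phi> h N \<eta> - \<Phi> (\<lambda>\<omega>. (u \<omega> + v \<omega>) / 2) N \<eta> = 1 / 2 * ((\<Phi> h N \<eta> - \<Phi> u N \<eta>) + (\<Phi> h N \<eta> - \<Phi> v N \<eta>))" for N \<eta>
    proof -
      have "\<Phi> (\<lambda>\<omega>. (u \<omega> + v \<omega>) / 2) N \<eta> = 1 / 2 * (\<Phi> u N \<eta> + \<Phi> v N \<eta>)"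
        unfolding \<Phi>_def distrib_left[symmetric] sum.distrib[symmetric] unfolding sum_distrib_left
        by (intro sum.cong refl) (simp add: field_simps)
      then show ?thesis by simp
    qed
    show ?case unfolding eq by (intro negligible_cmult negligible_add mean.IH)
  qed
  obtain CG where CG: "CG > 0" "\<And>p. (\<And>k. 0 \<le> p $ k \<and> p $ k \<le> 1) \<Longrightarrow> \<bar>G p\<bar> \<le> CG"
    by (rule cadlag_bounded[OF G]) blast
  have Gb: "\<bar>G (site_point N x)\<bar> \<le> CG" if "N \<ge> 1" "x \<in> sites N" for N and x :: "int ^ 'd"
    by (rule CG(2)) (rule site_point_unit[OF that])
  have "negligible (\<Phi> h)"
  proof (rule negligible_approx)
    fix e :: real assume e: "e > 0"
    \<comment> \<open>Chosen so that the static bound t^2 CG^2 \<delta> equals e.\<close>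
    define \<delta> where "\<delta> = e / (t\<^sup>2 * CG\<^sup>2)"
    have "\<delta> > 0" using e t CG by (simp add: \<delta>_def)
    with small obtain u where u: "u \<in> conv_orbit T h"
      "\<And>N. N \<ge> 1 \<Longrightarrow> (\<Sum>x\<in>sites N. (u (T x \<omega>))\<^sup>2) \<le> \<delta> * real N ^ CARD('d)" by blast
    have "\<forall>\<^sub>F N in sequentially. J N (\<Phi> u N) \<le> e"
      using eventually_ge3
    proof eventually_elim
      case (elim N)
      then have N: "N \<ge> 1" by simp
      have "(\<Sum>x\<in>sites N. (G (site_point N x) * u (T x \<omega>))\<^sup>2) \<le> (\<Sum>x\<in>sites N. CG\<^sup>2 * (u (T x \<omega>))\<^sup>2)"
        unfolding power_mult_distrib
        using Gb[OF N] CG(1) by (intro sum_mono mult_right_mono) (auto simp: abs_le_square_iff[symmetric])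
      also have "\<dots> \<le> CG\<^sup>2 * (\<delta> * real N ^ CARD('d))"
        unfolding sum_distrib_left[symmetric] by (intro mult_left_mono u(2) N) auto
      finally have "(\<Sum>x\<in>sites N. (G (site_point N x) * u (T x \<omega>))\<^sup>2) / real N ^ CARD('d) \<le> CG\<^sup>2 * \<delta>"
        using N by (simp add: field_simps)
      with linear_variance[OF N, of "\<lambda>x. G (site_point N x) * u (T x \<omega>)"]
      have "(\<Sum>\<eta>\<in>configs N. wt N \<eta> * (\<Phi> u N \<eta>)\<^sup>2) \<le> CG\<^sup>2 * \<delta>" by (simp add: \<Phi>_def)
      then have "t\<^sup>2 * (\<Sum>\<eta>\<in>configs N. wt N \<eta> * (\<Phi> u N \<eta>)\<^sup>2) \<le> t\<^sup>2 * (CG\<^sup>2 * \<delta>)"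
        by (intro mult_left_mono) auto
      also have "\<dots> = e" using t CG by (simp add: \<delta>_def)
      finally show ?case using J_static[OF elim, of "\<Phi> u N"] by linarith
    qed
    with diff[OF u(1)] show "\<exists>F'. negligible (\<lambda>N \<eta>. \<Phi> h N \<eta> - F' N \<eta>) \<and> (\<forall>\<^sub>F N in sequentially. J N (F' N) \<le> e)"
      by blast
  qed
  then show ?thesis by (simp add: \<Phi>_def[abs_def])
qed

end

section \<open>Expansion of local functions\<close>

text \<open>The coefficient of the centred product over A in the indicator that \<eta> agrees with B
  on L: that indicator is a product of factors (\<eta>(z) - \<rho>) + \<rho> for z in B and
  -(\<eta>(z) - \<rho>) + (1 - \<rho>) otherwise.\<close>

definition coef :: "real \<Rightarrow> 'a set \<Rightarrow> 'a set \<Rightarrow> 'a set \<Rightarrow> real" where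
  "coef \<rho> L B A = (\<Prod>z\<in>A. if z \<in> B then 1 else - 1) * (\<Prod>z\<in>L - A. if z \<in> B then \<rho> else 1 - \<rho>)"

definition increment :: "('w \<Rightarrow> 'd::finite config \<Rightarrow> real) \<Rightarrow> 'w \<Rightarrow> (int ^ 'd) set \<Rightarrow> real" where
  "increment f \<omega> B = f \<omega> (\<lambda>y. y \<in> B) - f \<omega> (\<lambda>_. False)"

text \<open>The coefficients of \<open>f - f(\<omega>, 0)\<close> in the products of the centred variables \<open>\<eta>(z) - \<rho>\<close>;
  unlike \<open>f\<close> itself they are bounded.\<close>

definition centred_coeff :: "real \<Rightarrow> (int ^ 'd::finite) set \<Rightarrow> ('w \<Rightarrow> 'd config \<Rightarrow> real) \<Rightarrow> (int ^ 'd) set \<Rightarrow> 'w \<Rightarrow> real" where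
  "centred_coeff \<rho> L f A \<omega> = (\<Sum>B\<in>Pow L. increment f \<omega> B * coef \<rho> L B A)"

lemma indicator_expansion:
  assumes L: "finite L" and B: "B \<subseteq> L"
  shows "(\<Sum>A\<in>Pow L. coef \<rho> L B A * (\<Prod>z\<in>A. occ \<eta> z - \<rho>)) = of_bool (\<forall>z\<in>L. \<eta> z \<longleftrightarrow> z \<in> B)"
proof -
  let ?s = "\<lambda>z. if z \<in> B then 1 else - 1 :: real" and ?p = "\<lambda>z. if z \<in> B then \<rho> else 1 - \<rho>"
  have "(\<Sum>A\<in>Pow L. coef \<rho> L B A * (\<Prod>z\<in>A. occ \<eta> z - \<rho>))
      = (\<Sum>A\<in>Pow L. (\<Prod>z\<in>A. ?s z * (occ \<eta> z - \<rho>)) * (\<Prod>z\<in>L - A. ?p z))"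
    by (simp add: coef_def prod.distrib mult_ac)
  also have "\<dots> = (\<Prod>z\<in>L. ?s z * (occ \<eta> z - \<rho>) + ?p z)"
    by (rule prod_add[OF L, symmetric])
  also have "\<dots> = (\<Prod>z\<in>L. of_bool (\<eta> z \<longleftrightarrow> z \<in> B))"
    by (intro prod.cong) (auto simp: occ_def)
  also have "\<dots> = of_bool (\<forall>z\<in>L. \<eta> z \<longleftrightarrow> z \<in> B)"
    using L by (induction L rule: finite_induct) auto
  finally show ?thesis .
qed

lemma local_expansion:
  assumes L: "finite L"
    and loc: "\<And>\<eta> \<eta>'. (\<And>y. y \<in> L \<Longrightarrow> \<eta> y = \<eta>' y) \<Longrightarrow> f \<omega> \<eta> = f \<omega> \<eta>'"
  shows "f \<omega> \<eta> = f \<omega> (\<lambda>_. False) + (\<Sum>A\<in>Pow L. centred_coeff \<rho> L f A \<omega> * (\<Prod>z\<in>A. occ \<eta> z - \<rho>))"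
proof -
  \<comment> \<open>The trace of \<eta> on L; its indicator is the only one that does not vanish at
    \<eta>.\<close>
  define B0 where "B0 = {y \<in> L. \<eta> y}"
  have "(\<Sum>A\<in>Pow L. centred_coeff \<rho> L f A \<omega> * (\<Prod>z\<in>A. occ \<eta> z - \<rho>))
      = (\<Sum>B\<in>Pow L. increment f \<omega> B * (\<Sum>A\<in>Pow L. coef \<rho> L B A * (\<Prod>z\<in>A. occ \<eta> z - \<rho>)))"
    unfolding centred_coeff_def sum_distrib_left sum_distrib_right by (subst sum.swap) (simp add: mult_ac)
  also have "\<dots> = (\<Sum>B\<in>Pow L. increment f \<omega> B * of_bool (B = B0))"
    using L by (intro sum.cong refl) (auto simp: indicator_expansion B0_def)
  also have "\<dots> = (\<Sum>B\<in>Pow L. if B = B0 then increment f \<omega> B0 else 0)"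
    by (intro sum.cong) auto
  also have "\<dots> = increment f \<omega> B0" using L by (simp add: B0_def)
  finally show ?thesis using loc[of \<eta> "\<lambda>y. y \<in> B0"] by (simp add: increment_def B0_def)
qed

lemma increment_bound:
  assumes "finite B" and "\<And>x \<eta> \<eta>'. (\<And>y. y \<noteq> x \<Longrightarrow> \<eta> y = \<eta>' y) \<Longrightarrow> \<bar>f \<omega> \<eta> - f \<omega> \<eta>'\<bar> \<le> c * \<bar>occ \<eta> x - occ \<eta>' x\<bar>"
    and "c \<ge> 0"
  shows "\<bar>increment f \<omega> B\<bar> \<le> c * real (card B)"
  using assms(1)
proof (induction B rule: finite_induct)
  case (insert x B)
  have "\<bar>f \<omega> (\<lambda>y. y \<in> insert x B) - f \<omega> (\<lambda>y. y \<in> B)\<bar> \<le> c * \<bar>occ (\<lambda>y. y \<in> insert x B) x - occ (\<lambda>y. y \<in> B) x\<bar>"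
    by (rule assms(2)) auto
  also have "\<dots> = c" using insert by (simp add: occ_def)
  finally show ?case using insert by (simp add: increment_def algebra_simps)
qed (simp add: increment_def)

lemma finite_cube: "finite {y :: int ^ 'd::finite. \<forall>k. \<bar>y $ k\<bar> \<le> int R}"
proof -
  have "{y :: int ^ 'd. \<forall>k. \<bar>y $ k\<bar> \<le> int R} = {y. \<forall>k. y $ k \<in> {- int R..int R}}"
    by (auto simp: abs_le_iff minus_le_iff)
  then show ?thesis by (simp add: finite_vec_box del: atLeastAtMost_iff)
qed

section \<open>Quenched and annealed means of a local function\<close>

locale local_env = ergodic_env \<mu> T for \<mu> :: "'w measure" and T :: "int ^ 'd::finite \<Rightarrow> 'w \<Rightarrow> 'w" +
  fixes f :: "'w \<Rightarrow> 'd config \<Rightarrow> real" and \<rho> :: real and L :: "(int ^ 'd) set" and c :: real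
  assumes rho: "0 < \<rho>" "\<rho> \<le> 1"
    and L: "finite L"
    and loc: "\<And>\<omega> \<eta> \<eta>'. \<omega> \<in> space \<mu> \<Longrightarrow> (\<And>y. y \<in> L \<Longrightarrow> \<eta> y = \<eta>' y) \<Longrightarrow> f \<omega> \<eta> = f \<omega> \<eta>'"
    and c: "c > 0"
    and lip: "\<And>\<omega> x \<eta> \<eta>'. \<omega> \<in> space \<mu> \<Longrightarrow> (\<And>y. y \<noteq> x \<Longrightarrow> \<eta> y = \<eta>' y) \<Longrightarrow>
        \<bar>f \<omega> \<eta> - f \<omega> \<eta>'\<bar> \<le> c * \<bar>occ \<eta> x - occ \<eta>' x\<bar>"
    and f_int: "\<And>\<eta>. integrable \<mu> (\<lambda>\<omega>. f \<omega> \<eta>)"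
begin

abbreviation cf :: "(int ^ 'd) set \<Rightarrow> 'w \<Rightarrow> real" where "cf \<equiv> centred_coeff \<rho> L f"

lemma cf_integrable: "integrable \<mu> (cf A)"
  unfolding centred_coeff_def[abs_def] increment_def
  by (intro Bochner_Integration.integrable_sum integrable_mult_left Bochner_Integration.integrable_diff f_int)

lemma cf_bounded: "\<exists>K. \<forall>\<omega>\<in>space \<mu>. \<bar>cf A \<omega>\<bar> \<le> K"
proof (intro exI ballI)
  fix \<omega> assume \<omega>: "\<omega> \<in> space \<mu>"
  have "\<bar>cf A \<omega>\<bar> \<le> (\<Sum>B\<in>Pow L. \<bar>increment f \<omega> B\<bar> * \<bar>coef \<rho> L B A\<bar>)"
    unfolding centred_coeff_def abs_mult[symmetric] by (rule sum_abs)
  also have "\<dots> \<le> (\<Sum>B\<in>Pow L. (c * real (card B)) * \<bar>coef \<rho> L B A\<bar>)"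
    using L c lip[OF \<omega>] by (intro sum_mono mult_right_mono increment_bound) (auto intro: finite_subset)
  finally show "\<bar>cf A \<omega>\<bar> \<le> (\<Sum>B\<in>Pow L. (c * real (card B)) * \<bar>coef \<rho> L B A\<bar>)" .
qed

lemma f_at_expansion:
  assumes \<omega>: "\<omega> \<in> space \<mu>"
  shows "f_at T f \<omega> x \<eta> = f (T x \<omega>) (\<lambda>_. False)
    + (\<Sum>A\<in>Pow L. cf A (T x \<omega>) * (\<Prod>z\<in>A. occ \<eta> (x + z) - \<rho>))"
  unfolding f_at_def
  by (subst local_expansion[where f = f and \<omega> = "T x \<omega>" and \<rho> = \<rho>, OF L loc[OF T_space[OF \<omega>]]])
    (auto simp: shift_def occ_def)

lemma expectation_f_at:
  assumes N: "N > 0" and inj: "inj_on (\<lambda>z. modN N (x + z)) L" and \<omega>: "\<omega> \<in> space \<mu>"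
    and r: "0 \<le> r" "r \<le> 1"
  shows "measure_pmf.expectation (bernoulli_product N r) (f_at T f \<omega> x)
    = f (T x \<omega>) (\<lambda>_. False) + (\<Sum>A\<in>Pow L. cf A (T x \<omega>) * (r - \<rho>) ^ card A)"
proof -
  let ?w = "\<lambda>\<eta> :: 'd config. pmf (bernoulli_product N r) \<eta>"
  have "measure_pmf.expectation (bernoulli_product N r) (f_at T f \<omega> x)
    = (\<Sum>\<eta>\<in>configs N. ?w \<eta> * f_at T f \<omega> x \<eta>)" by (rule expectation_bernoulli_product[OF N])
  also have "\<dots> = (\<Sum>\<eta>\<in>configs N. ?w \<eta> * f (T x \<omega>) (\<lambda>_. False))
     + (\<Sum>\<eta>\<in>configs N. \<Sum>A\<in>Pow L. cf A (T x \<omega>) * (?w \<eta> * (\<Prod>z\<in>A. occ \<eta> (x + z) - \<rho>)))"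
    unfolding f_at_expansion[OF \<omega>] distrib_left sum.distrib sum_distrib_left by (simp add: mult_ac)
  also have "(\<Sum>\<eta>\<in>configs N. ?w \<eta> * f (T x \<omega>) (\<lambda>_. False)) = f (T x \<omega>) (\<lambda>_. False)"
    by (simp add: bernoulli_product_total[OF N] sum_distrib_right[symmetric])
  also have "(\<Sum>\<eta>\<in>configs N. \<Sum>A\<in>Pow L. cf A (T x \<omega>) * (?w \<eta> * (\<Prod>z\<in>A. occ \<eta> (x + z) - \<rho>)))
      = (\<Sum>A\<in>Pow L. cf A (T x \<omega>) * (\<Sum>\<eta>\<in>configs N. ?w \<eta> * (\<Prod>z\<in>A. occ \<eta> (x + z) - \<rho>)))"
    by (subst sum.swap) (simp add: sum_distrib_left)
  also have "\<dots> = (\<Sum>A\<in>Pow L. cf A (T x \<omega>) * (r - \<rho>) ^ card A)"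
  proof (intro sum.cong refl)
    fix A assume A: "A \<in> Pow L"
    have injA: "inj_on (\<lambda>z. modN N (x + z)) A" using inj A by (auto intro: inj_on_subset)
    have "(\<Sum>\<eta>\<in>configs N. ?w \<eta> * (\<Prod>z\<in>A. occ \<eta> (x + z) - \<rho>))
        = (\<Sum>\<eta>\<in>configs N. ?w \<eta> * cocc \<rho> \<eta> ((\<lambda>z. modN N (x + z)) ` A))"
      using injA by (intro sum.cong) (simp_all add: cocc_image)
    also have "\<dots> = (r - \<rho>) ^ card A"
    proof -
      have "(\<lambda>z. modN N (x + z)) ` A \<subseteq> sites N" using N by (auto intro: modN_in_sites)
      from expectation_cocc[OF N r this, of \<rho>] show ?thesis by (simp only: card_image[OF injA])
    qed
    finally show "cf A (T x \<omega>) * (\<Sum>\<eta>\<in>configs N. ?w \<eta> * (\<Prod>z\<in>A. occ \<eta> (x + z) - \<rho>))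
      = cf A (T x \<omega>) * (r - \<rho>) ^ card A" by simp
  qed
  finally show ?thesis .
qed

definition slope :: real where "slope = (\<Sum>z\<in>L. \<integral>\<omega>. cf {z} \<omega> \<partial>\<mu>)"

lemma sum_card_one: "(\<Sum>A\<in>{A \<in> Pow L. card A = 1}. g A) = (\<Sum>z\<in>L. g {z} :: real)"
proof -
  have "{A \<in> Pow L. card A = 1} = (\<lambda>z. {z}) ` L" by (auto simp: card_1_singleton_iff)
  then show ?thesis by (simp add: sum.reindex)
qed

text \<open>On [0,1] the annealed mean is a polynomial in r - \<rho>, whose coefficients do not
  depend on x because \<mu> is invariant; at \<rho> only the terms of degree one contribute to the
  derivative.\<close>

lemma annealed_derivative:
  assumes N: "N > 0" and inj: "inj_on (\<lambda>z. modN N (x + z)) L"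
  shows "vector_derivative (\<lambda>r. \<integral>\<omega>. measure_pmf.expectation (bernoulli_product N r) (f_at T f \<omega> x) \<partial>\<mu>)
    (at \<rho> within {0..1}) = slope"
proof -
  define m0 where "m0 = (\<integral>\<omega>. f (T x \<omega>) (\<lambda>_. False) \<partial>\<mu>)"
  define m where "m A = (\<integral>\<omega>. cf A \<omega> \<partial>\<mu>)" for A
  define p where "p r = m0 + (\<Sum>A\<in>Pow L. m A * (r - \<rho>) ^ card A)" for r
  have eq: "(\<integral>\<omega>. measure_pmf.expectation (bernoulli_product N r) (f_at T f \<omega> x) \<partial>\<mu>) = p r"
    if r: "r \<in> {0..1}" for r
  proof -
    have "(\<integral>\<omega>. measure_pmf.expectation (bernoulli_product N r) (f_at T f \<omega> x) \<partial>\<mu>)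
      = (\<integral>\<omega>. f (T x \<omega>) (\<lambda>_. False) + (\<Sum>A\<in>Pow L. cf A (T x \<omega>) * (r - \<rho>) ^ card A) \<partial>\<mu>)"
      using r by (intro Bochner_Integration.integral_cong refl expectation_f_at N inj) auto
    also have "\<dots> = m0 + (\<Sum>A\<in>Pow L. (\<integral>\<omega>. cf A (T x \<omega>) \<partial>\<mu>) * (r - \<rho>) ^ card A)"
      unfolding m0_def
      by (subst Bochner_Integration.integral_add)
        (auto intro!: Bochner_Integration.integrable_sum integrable_mult_left integrable_T[OF f_int] integrable_T[OF cf_integrable]
          simp: Bochner_Integration.integral_sum integrable_T[OF cf_integrable])
    also have "\<dots> = p r"
      using integral_T[OF borel_measurable_integrable[OF cf_integrable]] by (simp add: p_def m_def)
    finally show ?thesis .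
  qed
  have "(p has_real_derivative (\<Sum>A\<in>Pow L. m A * (real (card A) * (\<rho> - \<rho>) ^ (card A - 1)))) (at \<rho> within {0..1})"
    unfolding p_def by (auto intro!: derivative_eq_intros simp: mult_ac)
  also have "(\<Sum>A\<in>Pow L. m A * (real (card A) * (\<rho> - \<rho>) ^ (card A - 1))) = (\<Sum>A\<in>Pow L. if card A = 1 then m A else 0)"
  proof (intro sum.cong refl)
    fix A :: "(int ^ 'd) set"
    \<comment> \<open>For card A = 0 the natural subtraction truncates, but the factor card A
      vanishes; for card A = 1 the power is 0^0 = 1.\<close>
    have "card A = 0 \<or> card A = 1 \<or> card A - 1 > 0" by linarith
    then show "m A * (real (card A) * (\<rho> - \<rho>) ^ (card A - 1)) = (if card A = 1 then m A else 0)"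
      by (elim disjE) auto
  qed
  also have "\<dots> = (\<Sum>A\<in>{A \<in> Pow L. card A = 1}. m A)"
    using L by (intro sum.inter_filter[symmetric]) simp
  also have "\<dots> = slope" by (simp only: sum_card_one) (simp add: slope_def m_def)
  finally have "(p has_vector_derivative slope) (at \<rho> within {0..1})"
    by (simp add: has_real_derivative_iff_has_vector_derivative)
  \<comment> \<open>The mean agrees with the polynomial only on [0,1], where the Bernoulli parameter
    is not truncated; at \<rho> = 1 the derivative is one-sided.\<close>
  then have "((\<lambda>r. \<integral>\<omega>. measure_pmf.expectation (bernoulli_product N r) (f_at T f \<omega> x) \<partial>\<mu>)
      has_vector_derivative slope) (at \<rho> within {0..1})"
    by (rule has_vector_derivative_transform[rotated 2]) (use rho eq in auto)
  then show ?thesis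
    using rho by (intro vector_derivative_within_cbox[of 0 1, simplified]) auto
qed

text \<open>The total quenched coefficient of degree one minus the annealed derivative: the only
  remainder that ergodicity has to remove.\<close>

definition h :: "'w \<Rightarrow> real" where "h \<omega> = (\<Sum>z\<in>L. cf {z} \<omega>) - slope"

lemma h_measurable: "h \<in> borel_measurable \<mu>"
  unfolding h_def[abs_def] using borel_measurable_integrable[OF cf_integrable] by measurable

lemma h_mean: "(\<integral>\<omega>. h \<omega> \<partial>\<mu>) = 0"
  unfolding h_def using cf_integrable
  by (simp add: Bochner_Integration.integral_sum Bochner_Integration.integrable_sum prob_space slope_def)

lemma h_bounded: "\<exists>K. \<forall>\<omega>\<in>space \<mu>. \<bar>h \<omega>\<bar> \<le> K"
proof -
  have "\<exists>K. \<forall>z. \<forall>\<omega>\<in>space \<mu>. \<bar>cf {z} \<omega>\<bar> \<le> K z" by (intro choice allI cf_bounded)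
  then obtain K where K: "\<And>z \<omega>. \<omega> \<in> space \<mu> \<Longrightarrow> \<bar>cf {z} \<omega>\<bar> \<le> K z" by blast
  have "\<bar>h \<omega>\<bar> \<le> (\<Sum>z\<in>L. K z) + \<bar>slope\<bar>" if "\<omega> \<in> space \<mu>" for \<omega>
  proof -
    have "\<bar>\<Sum>z\<in>L. cf {z} \<omega>\<bar> \<le> (\<Sum>z\<in>L. K z)"
      by (rule order_trans[OF sum_abs sum_mono]) (rule K[OF that])
    then show ?thesis unfolding h_def by linarith
  qed
  then show ?thesis by blast
qed

text \<open>In degree one every \<eta>(x + z) is exchanged for \<eta>(x) at the price of a gradient;
  all coefficients then sit at the same site and combine with the annealed derivative into
  h.\<close>

lemma V_f_expansion:
  assumes N: "N > 0" and inj: "inj_on (\<lambda>z. modN N (x + z)) L" and \<omega>: "\<omega> \<in> space \<mu>"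
  shows "V_f \<mu> T \<rho> f N \<omega> x \<eta> =
    (\<Sum>A\<in>{A \<in> Pow L. card A \<ge> 2}. cf A (T x \<omega>) * (\<Prod>z\<in>A. occ \<eta> (x + z) - \<rho>))
    + (\<Sum>z\<in>L. cf {z} (T x \<omega>) * (occ \<eta> (x + z) - occ \<eta> x)) + h (T x \<omega>) * (occ \<eta> x - \<rho>)"
proof -
  let ?o = "\<lambda>A. \<Prod>z\<in>A. occ \<eta> (x + z) - \<rho>"
  have finL: "finite A" if "A \<in> Pow L" for A using that L by (auto intro: finite_subset)
  have split: "(\<Sum>A\<in>Pow L. g A) = g {} + (\<Sum>z\<in>L. g {z}) + (\<Sum>A\<in>{A \<in> Pow L. card A \<ge> 2}. g A)" for g :: "(int ^ 'd) set \<Rightarrow> real"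
  proof -
    have "Pow L = {{}} \<union> {A \<in> Pow L. card A = 1} \<union> {A \<in> Pow L. card A \<ge> 2}"
    proof (intro equalityI subsetI)
      fix A assume A: "A \<in> Pow L"
      have "A = {} \<or> card A = 1 \<or> card A \<ge> 2" using finL[OF A] by (metis card_0_eq less_2_cases not_le_imp_less One_nat_def)
      then show "A \<in> {{}} \<union> {A \<in> Pow L. card A = 1} \<union> {A \<in> Pow L. card A \<ge> 2}" using A by auto
    qed auto
    then have "(\<Sum>A\<in>Pow L. g A) = (\<Sum>A\<in>{{}} \<union> {A \<in> Pow L. card A = 1} \<union> {A \<in> Pow L. card A \<ge> 2}. g A)"
      by (rule arg_cong[where f = "sum g"])
    also have "\<dots> = (\<Sum>A\<in>{{}} \<union> {A \<in> Pow L. card A = 1}. g A) + (\<Sum>A\<in>{A \<in> Pow L. card A \<ge> 2}. g A)"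
      using L by (intro sum.union_disjoint) auto
    also have "(\<Sum>A\<in>{{}} \<union> {A \<in> Pow L. card A = 1}. g A) = (\<Sum>A\<in>{{}}. g A) + (\<Sum>A\<in>{A \<in> Pow L. card A = 1}. g A)"
      using L by (intro sum.union_disjoint) auto
    finally show ?thesis by (simp only: sum_card_one) simp
  qed
  have E: "measure_pmf.expectation (bernoulli_product N \<rho>) (f_at T f \<omega> x) = f (T x \<omega>) (\<lambda>_. False) + cf {} (T x \<omega>)"
  proof -
    \<comment> \<open>As 0^0 = 1, the empty set survives, and it alone.\<close>
    have "(\<Sum>A\<in>Pow L. cf A (T x \<omega>) * (\<rho> - \<rho>) ^ card A) = (\<Sum>A\<in>Pow L. if A = {} then cf {} (T x \<omega>) else 0)"
      using finL by (intro sum.cong) auto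
    also have "\<dots> = cf {} (T x \<omega>)" using L by simp
    finally show ?thesis using expectation_f_at[OF N inj \<omega>, of \<rho>] rho by simp
  qed
  have "V_f \<mu> T \<rho> f N \<omega> x \<eta> = (\<Sum>A\<in>Pow L. cf A (T x \<omega>) * ?o A) - cf {} (T x \<omega>) - slope * (occ \<eta> x - \<rho>)"
    unfolding V_f_def annealed_derivative[OF N inj] E f_at_expansion[OF \<omega>] by simp
  also have "\<dots> = (\<Sum>A\<in>{A \<in> Pow L. card A \<ge> 2}. cf A (T x \<omega>) * ?o A)
    + ((\<Sum>z\<in>L. cf {z} (T x \<omega>) * (occ \<eta> (x + z) - \<rho>)) - slope * (occ \<eta> x - \<rho>))"
    unfolding split by simp
  also have "(\<Sum>z\<in>L. cf {z} (T x \<omega>) * (occ \<eta> (x + z) - \<rho>)) - slope * (occ \<eta> x - \<rho>)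
    = (\<Sum>z\<in>L. cf {z} (T x \<omega>) * (occ \<eta> (x + z) - occ \<eta> x)) + h (T x \<omega>) * (occ \<eta> x - \<rho>)"
  proof -
    have "(\<Sum>z\<in>L. cf {z} (T x \<omega>) * (occ \<eta> (x + z) - \<rho>))
      = (\<Sum>z\<in>L. cf {z} (T x \<omega>) * (occ \<eta> (x + z) - occ \<eta> x)) + (\<Sum>z\<in>L. cf {z} (T x \<omega>)) * (occ \<eta> x - \<rho>)"
      unfolding sum_distrib_right sum.distrib[symmetric] by (intro sum.cong refl) (simp add: algebra_simps)
    then show ?thesis by (simp add: h_def algebra_simps)
  qed
  finally show ?thesis by simp
qed

end

theorem theorem6p1:
  fixes W :: "'d::finite \<Rightarrow> real \<Rightarrow> real"
    and A :: "'d \<Rightarrow> (real \<Rightarrow> real) set"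
    and \<phi> :: "nat \<Rightarrow> real ^ 'd \<Rightarrow> real" and \<alpha> :: "nat \<Rightarrow> real"
    and \<mu> :: "'w measure" and T :: "int ^ 'd \<Rightarrow> 'w \<Rightarrow> 'w"
    and a :: "'d \<Rightarrow> 'w \<Rightarrow> real" and \<theta> b \<rho> :: real
    and f :: "'w \<Rightarrow> 'd config \<Rightarrow> real"
  assumes rho: "0 < \<rho>" "\<rho> \<le> 1" and b: "b > - 1 / 2"
    and W: "\<And>k. admissible_W (W k)"
    and A: "\<And>k. eigenbasis_LW (W k) (A k)"
    and phi: "eigen_enumeration W A \<phi> \<alpha>"
    and env: "standard_prob_space \<mu>" "ergodic_action \<mu> T"
    and a: "\<And>j. a j \<in> borel_measurable \<mu>" "\<theta> > 0"
      "\<And>j \<omega>. \<omega> \<in> space \<mu> \<Longrightarrow> inverse \<theta> \<le> a j \<omega> \<and> a j \<omega> \<le> \<theta>"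
    and f: "local_fn (space \<mu>) f" "uniformly_Lipschitz (space \<mu>) f"
    and f_integrable: "\<And>\<eta>. integrable \<mu> (\<lambda>\<omega>. f \<omega> \<eta>)"
  shows "AE \<omega> in \<mu>. \<forall>G \<in> S_W A \<phi> \<alpha>. \<forall>t>0.
    \<forall>(P :: nat \<Rightarrow> 'p measure) (X :: nat \<Rightarrow> real \<Rightarrow> 'p \<Rightarrow> 'd config).
      (\<forall>N\<ge>1. exclusion_process W (\<lambda>j x. a j (T x \<omega>)) b \<rho> N (P N) (X N)) \<longrightarrow>
      (\<lambda>N. \<integral>p. (LBINT s:{0..t}. 1 / (real N powr (real CARD('d) / 2))
              * (\<Sum>x\<in>sites N. G (site_point N x) * V_f \<mu> T \<rho> f N \<omega> x (X N s p)))\<^sup>2 \<partial>P N)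
        \<longlonglongrightarrow> 0"
proof -
  obtain R :: nat where "\<forall>\<omega>\<in>space \<mu>. \<forall>\<eta> \<eta>'.
     (\<forall>y. (\<forall>k. \<bar>y $ k\<bar> \<le> int R) \<longrightarrow> \<eta> y = \<eta>' y) \<longrightarrow> f \<omega> \<eta> = f \<omega> \<eta>'"
    using f(1) unfolding local_fn_def by (rule exE)
  then have R: "f \<omega> \<eta> = f \<omega> \<eta>'" if "\<omega> \<in> space \<mu>" "\<forall>y. (\<forall>k. \<bar>y $ k\<bar> \<le> int R) \<longrightarrow> \<eta> y = \<eta>' y" for \<omega> \<eta> \<eta>'
    using that by simp
  obtain c where c: "c > 0" "\<forall>\<omega>\<in>space \<mu>. \<forall>x \<eta> \<eta>'.
     (\<forall>y. y \<noteq> x \<longrightarrow> \<eta> y = \<eta>' y) \<longrightarrow> \<bar>f \<omega> \<eta> - f \<omega> \<eta>'\<bar> \<le> c * \<bar>occ \<eta> x - occ \<eta>' x\<bar>"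
    using f(2) unfolding uniformly_Lipschitz_def by (elim exE conjE)
  define L where "L = {y :: int ^ 'd. \<forall>k. \<bar>y $ k\<bar> \<le> int R}"
  interpret prob_space \<mu> using env(1) by (simp add: standard_prob_space_def)
  interpret local_env \<mu> T f \<rho> L c
  proof
    show "finite L" unfolding L_def by (rule finite_cube)
    show "f \<omega> \<eta> = f \<omega> \<eta>'" if "\<omega> \<in> space \<mu>" "\<And>y. y \<in> L \<Longrightarrow> \<eta> y = \<eta>' y" for \<omega> \<eta> \<eta>'
      using R[OF that(1), of \<eta> \<eta>'] that(2) by (simp add: L_def)
  qed (use env(2) rho c f_integrable in auto)
  obtain K where K: "\<And>\<omega>. \<omega> \<in> space \<mu> \<Longrightarrow> \<bar>h \<omega>\<bar> \<le> K" using h_bounded by blast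
  have erg: "ergodic_env \<mu> T" by unfold_locales
  \<comment> \<open>The null set is fixed here from h alone, ahead of G, t and the processes, over
    which no almost-sure statement could be united afterwards.\<close>
  have "AE \<omega> in \<mu>. \<forall>\<delta>>0. \<exists>u\<in>conv_orbit T h. \<forall>N\<ge>1.
      (\<Sum>x\<in>sites N. (u (T x \<omega>))\<^sup>2) \<le> \<delta> * real N ^ CARD('d)"
    by (rule AE_sup_average_small[where C = K]) (use K h_measurable h_mean in auto)
  then show ?thesis
    using AE_space
  proof eventually_elim
    case (elim \<omega>)
    note \<omega> = elim(2)
    show ?case
    proof (intro ballI allI impI)
      fix G and t :: real and P :: "nat \<Rightarrow> 'p measure" and X :: "nat \<Rightarrow> real \<Rightarrow> 'p \<Rightarrow> 'd config"
      assume G: "G \<in> S_W A \<phi> \<alpha>" and t: "t > 0"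
        and proc: "\<forall>N\<ge>1. exclusion_process W (\<lambda>j x. a j (T x \<omega>)) b \<rho> N (P N) (X N)"
      have cadlag: "cadlag G" using G by (simp add: S_W_def)
      interpret exclusion_family W "\<lambda>j x. a j (T x \<omega>)" \<theta> b \<rho> P X t
        by unfold_locales (use W b rho a t proc T_space[OF \<omega>] in auto)
      obtain CG where CG: "CG > 0" "\<And>p. (\<And>k. 0 \<le> p $ k \<and> p $ k \<le> 1) \<Longrightarrow> \<bar>G p\<bar> \<le> CG"
        by (rule cadlag_bounded[OF cadlag]) blast
      have bounded_field: "\<exists>C. bounded_field (\<lambda>N x. G (site_point N x) * cf B (T x \<omega>)) C" for B
      proof -
        obtain KB where KB: "\<And>\<omega>. \<omega> \<in> space \<mu> \<Longrightarrow> \<bar>cf B \<omega>\<bar> \<le> KB" using cf_bounded by blast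
        have "\<bar>G (site_point N x) * cf B (T x \<omega>)\<bar> \<le> CG * KB" if "N \<ge> 1" "x \<in> sites N" for N x
        proof -
          have "\<bar>G (site_point N x)\<bar> \<le> CG"
            by (rule CG(2)) (rule site_point_unit[OF that])
          then show ?thesis unfolding abs_mult using KB[OF T_space[OF \<omega>]] CG(1) by (intro mult_mono) auto
        qed
        then show ?thesis by (auto simp: bounded_field_def)
      qed
      define F1 where "F1 B N \<eta> = scl N * (\<Sum>x\<in>sites N. (G (site_point N x) * cf B (T x \<omega>)) * (\<Prod>z\<in>B. occ \<eta> (x + z) - \<rho>))" for B N and \<eta> :: "'d config"
      define F2 where "F2 z N \<eta> = scl N * (\<Sum>x\<in>sites N. (G (site_point N x) * cf {z} (T x \<omega>)) * (occ \<eta> (x + z) - occ \<eta> x))" for z N and \<eta> :: "'d config"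
      define F3 where "F3 N \<eta> = scl N * (\<Sum>x\<in>sites N. G (site_point N x) * h (T x \<omega>) * (occ \<eta> x - \<rho>))" for N and \<eta> :: "'d config"
      have "negligible (F1 B)" if "B \<in> {B \<in> Pow L. card B \<ge> 2}" for B
      proof -
        obtain C where "bounded_field (\<lambda>N x. G (site_point N x) * cf B (T x \<omega>)) C" using bounded_field by blast
        moreover have "finite B" using that L by (auto intro: finite_subset)
        ultimately show ?thesis using that unfolding F1_def by (intro negligible_prod) auto
      qed
      then have 1: "negligible (\<lambda>N \<eta>. \<Sum>B\<in>{B \<in> Pow L. card B \<ge> 2}. F1 B N \<eta>)"
        using L by (intro negligible_sum) auto
      have "negligible (F2 z)" for z unfolding F2_def using bounded_field[of "{z}"] negligible_shift by blast
      then have 2: "negligible (\<lambda>N \<eta>. \<Sum>z\<in>L. F2 z N \<eta>)" using L by (intro negligible_sum) auto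
      have 3: "negligible F3" unfolding F3_def[abs_def]
        by (rule negligible_mean_zero[where C = K and \<mu> = \<mu>])
          (use erg \<omega> h_measurable K elim(1) cadlag in auto)
      have "negligible (\<lambda>N \<eta>. scl N * (\<Sum>x\<in>sites N. G (site_point N x) * V_f \<mu> T \<rho> f N \<omega> x \<eta>))"
      proof (rule negligible_cong[OF negligible_add[OF negligible_add[OF 1 2] 3]])
        show "\<forall>\<^sub>F N in sequentially. \<forall>\<eta>\<in>configs N. scl N * (\<Sum>x\<in>sites N. G (site_point N x) * V_f \<mu> T \<rho> f N \<omega> x \<eta>)
          = (\<Sum>B\<in>{B \<in> Pow L. card B \<ge> 2}. F1 B N \<eta>) + (\<Sum>z\<in>L. F2 z N \<eta>) + F3 N \<eta>"
          \<comment> \<open>For small N the set L wraps around the torus and the expansion may fail,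
            so the identity is claimed eventually only.\<close>
          using eventually_modN_distinct[OF L] eventually_pos
        proof (eventually_elim, intro ballI)
          fix N and \<eta> :: "'d config"
          assume dist: "\<forall>u\<in>L. \<forall>v\<in>L. \<forall>x. modN N (x + u) = modN N (x + v) \<longrightarrow> u = v" and N: "N > 0"
          have inj: "inj_on (\<lambda>z. modN N (x + z)) L" for x using dist by (auto intro: inj_onI)
          have 1: "(\<Sum>B\<in>{B \<in> Pow L. card B \<ge> 2}. F1 B N \<eta>)
            = scl N * (\<Sum>x\<in>sites N. G (site_point N x) * (\<Sum>B\<in>{B \<in> Pow L. card B \<ge> 2}. cf B (T x \<omega>) * (\<Prod>z\<in>B. occ \<eta> (x + z) - \<rho>)))"
            unfolding F1_def sum_distrib_left by (subst sum.swap) (simp add: mult.assoc)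
          have 2: "(\<Sum>z\<in>L. F2 z N \<eta>)
            = scl N * (\<Sum>x\<in>sites N. G (site_point N x) * (\<Sum>z\<in>L. cf {z} (T x \<omega>) * (occ \<eta> (x + z) - occ \<eta> x)))"
            unfolding F2_def sum_distrib_left by (subst sum.swap) (simp add: mult.assoc)
          show "scl N * (\<Sum>x\<in>sites N. G (site_point N x) * V_f \<mu> T \<rho> f N \<omega> x \<eta>)
          = (\<Sum>B\<in>{B \<in> Pow L. card B \<ge> 2}. F1 B N \<eta>) + (\<Sum>z\<in>L. F2 z N \<eta>) + F3 N \<eta>"
            unfolding 1 2 F3_def V_f_expansion[OF N inj \<omega>] distrib_left[symmetric] sum.distrib[symmetric] mult.assoc ..
        qed
      qed
      then show "(\<lambda>N. \<integral>p. (LBINT s:{0..t}. 1 / (real N powr (real CARD('d) / 2))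
              * (\<Sum>x\<in>sites N. G (site_point N x) * V_f \<mu> T \<rho> f N \<omega> x (X N s p)))\<^sup>2 \<partial>P N) \<longlonglongrightarrow> 0"
        unfolding negligible_def J_def scl_def .
    qed
  qed
qed

end
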